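(* Assume that (i) potentials $\varphi(t,\mathbf x)$, $\mathbf A(t,\mathbf x)$ are defined and regular (twice continuously differentiable) in a domain $D\subset\mathbb R\times\mathbb R^3$; (ii) $\hat{\mathbf r}:[T_-,T_+]\to\mathbb R^3$ is a trajectory such that $(t,\hat{\mathbf r}(t))$ lies in $D$, and the limit potentials are $$\varphi_\infty(t,\mathbf x)=\varphi(t,\hat{\mathbf r})+(\mathbf x-\hat{\mathbf r})\cdot\nabla\varphi(t,\hat{\mathbf r}),\qquad \mathbf A_\infty(t,\mathbf x)=\mathbf A(t,\hat{\mathbf r})+(\mathbf x-\hat{\mathbf r})\cdot\nabla\mathbf A(t,\hat{\mathbf r}).$$ Let $\mathbf E=-\nabla\varphi-\frac1{\mathrm c}\partial_t\mathbf A$ and $\mathbf B=\nabla\times\mathbf A$. Let solutions $\psi_n$ of the NLS equation concentrate at $\hat{\mathbf r}(t)$ (with these limit potentials). Then $\hat{\mathbf r}$ satisfies Newton's law of motion with the Lorentz force, $$m\,\partial_t^2\hat{\mathbf r}=q\,\mathbf E(t,\hat{\mathbf r})+\frac q{\mathrm c}\,\partial_t\hat{\mathbf r}\times\mathbf B(t,\hat{\mathbf r}).$$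
   Context: **NLS equation and densities.** $m,q,\chi,\mathrm c>0$ are fixed constants. Given real $\varphi(t,\mathbf x)$ and $\mathbf A(t,\mathbf x)\in\mathbb R^3$ put $\tilde\partial_t=\partial_t+\frac{iq}{\chi}\varphi$, $\tilde\nabla=\nabla-\frac{iq}{\chi\mathrm c}\mathbf A$ (components $\tilde\partial_j$), $\tilde\partial_t^*=\partial_t-\frac{iq}{\chi}\varphi$, $\tilde\nabla^*=\nabla+\frac{iq}{\chi\mathrm c}\mathbf A$, $\mathbf E=-\nabla\varphi-\frac1{\mathrm c}\partial_t\mathbf A$, $\mathbf B=\nabla\times\mathbf A$. The NLS equation with size parameter $a>0$ is $i\tilde\partial_t\psi=\frac{\chi}{2m}\left[-\tilde\nabla^2\psi+G_a'(\psi^*\psi)\psi\right]$, where $\psi$ is complex valued, $G_a'(s)=a^{-2}G_1'(a^3s)$, $G_a(s)=\int_0^sG_a'(s')\,ds'$. Standing condition on the nonlinearity: $G_1'$ is real valued and continuous for $s>0$, it is the derivative of $G_1$, which is differentiable for $s>0$ and continuous for $s\ge0$; $\psi\mapsto G_1(\psi^*\psi)$ is differentiable on $\mathbb C$ with differential $g(\psi)\,d\psi^*+g^*(\psi)\,d\psi$, where $g(\psi)=G_1'(\psi^*\psi)\psi$ for $\psi\ne0$, $g(0)=0$, and $g$ is continuous on $\mathbb C$. Define $\rho=q\psi\psi^*$, $\mathbf J=-\frac{iq\chi}{2m}(\psi^*\tilde\nabla\psi-\psi\tilde\nabla^*\psi^* )$, $\mathbf P=\frac{i\chi}{2}(\psi\tilde\nabla^*\psi^*-\psi^*\tilde\nabla\psi)$,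 $u=\frac{\chi^2}{2m}\left[|\tilde\nabla\psi|^2+G_a(|\psi|^2)\right]$, and for $i,j\in\{1,2,3\}$: $T^{ij}=\frac{\chi^2}{2m}(\tilde\partial_i\psi\,\tilde\partial_j^*\psi^*+\tilde\partial_j\psi\,\tilde\partial_i^*\psi^* )$ if $i\ne j$; $T^{ii}=-u+\frac{\chi^2}{m}\tilde\partial_i\psi\,\tilde\partial_i^*\psi^*+\frac{i\chi}{2}(\psi^*\tilde\partial_t\psi-\psi\tilde\partial_t^*\psi^* )$ (no sum). **Trajectories and neighborhoods.** A trajectory is a $C^2$ function $\hat{\mathbf r}:[T_-,T_+]\to\mathbb R^3$ with bounded first and second derivatives; $\hat{\mathbf v}=\partial_t\hat{\mathbf r}$. For $R_n\to0$ let $\Omega_n=\Omega_n(t)=\{\mathbf x:|\mathbf x-\hat{\mathbf r}(t)|\le R_n\}$ and $\hat\Omega_n=\{(t,\mathbf x):T_-\le t\le T_+,\ \mathbf x\in\Omega_n(t)\}$; $\bar{\mathbf n}$ is the outer unit normal to $\partial\Omega_n$, $d\sigma$ surface measure. $C$ denotes constants independent of $n$; $\nabla_{0,\mathbf x}=(\frac1{\mathrm c}\partial_t,\nabla)$. **Localized NLS equations.** Sequences $a_n\to0$, $R_n\to0$ with $R_n/a_n\to\infty$, and potentials $\varphi_n,\mathbf A_n$ twice continuously differentiable in $\hat\Omega_n$. There are limit potentials, linear in $\mathbf x$: $\varphi_\infty(t,\mathbf x)=\varphi_\infty(t)+(\mathbf x-\hat{\mathbf r})\cdot\nabla\varphi_\infty(t)$,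 $\mathbf A_\infty(t,\mathbf x)=\mathbf A_\infty(t)+(\mathbf x-\hat{\mathbf r})\cdot\nabla\mathbf A_\infty(t)$, with $|\varphi_\infty|,|\nabla_{0,\mathbf x}\varphi_\infty|,|\mathbf A_\infty|,|\nabla_{0,\mathbf x}\mathbf A_\infty|\le C$ on the trajectory for $T_-\le t\le T_+$, such that $\max_{\hat\Omega_n}(|\varphi_n-\varphi_\infty|+|\nabla_{0,\mathbf x}\varphi_n-\nabla_{0,\mathbf x}\varphi_\infty|)\to0$, $\max_{\hat\Omega_n}(|\mathbf A_n-\mathbf A_\infty|+|\nabla_{0,\mathbf x}\mathbf A_n-\nabla_{0,\mathbf x}\mathbf A_\infty|)\to0$, and $|\varphi_n|,|\nabla_{0,\mathbf x}\varphi_n|,|\mathbf A_n|,|\nabla_{0,\mathbf x}\mathbf A_n|\le C$ in $\hat\Omega_n$. Put $\mathbf E_\infty(t)=-\nabla\varphi_\infty(t,\hat{\mathbf r})-\frac1{\mathrm c}\partial_t\mathbf A_\infty(t,\hat{\mathbf r})$, $\mathbf B_\infty(t)=\nabla\times\mathbf A_\infty(t,\hat{\mathbf r})$ (derivatives at fixed $\mathbf x$, evaluated at $\mathbf x=\hat{\mathbf r}(t)$). **Concentrating solutions.** Solutions $\psi_n$ of the NLS equations concentrate at $\hat{\mathbf r}$ if the condition on the nonlinearity holds, there are sequences $a_n\to0$, $R_n\to0$ with $R_n/a_n\to\infty$ and potentials $\varphi_n,\mathbf A_n$ twice continuously differentiable in $\hat\Omega_n$, with limit potentials $\varphi_\infty,\mathbf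 A_\infty$ linear in $\mathbf x$ satisfying $|\varphi_\infty|,|\nabla_{0,\mathbf x}\varphi_\infty|,|\mathbf A_\infty|,|\nabla_{0,\mathbf x}\mathbf A_\infty|\le C$ on the trajectory for $T_-\le t\le T_+$, such that $\max_{\hat\Omega_n}(|\varphi_n-\varphi_\infty|+|\nabla_{0,\mathbf x}\varphi_n-\nabla_{0,\mathbf x}\varphi_\infty|)\to0$, $\max_{\hat\Omega_n}(|\mathbf A_n-\mathbf A_\infty|+|\nabla_{0,\mathbf x}\mathbf A_n-\nabla_{0,\mathbf x}\mathbf A_\infty|)\to0$ and $|\varphi_n|,|\nabla_{0,\mathbf x}\varphi_n|,|\mathbf A_n|,|\nabla_{0,\mathbf x}\mathbf A_n|\le C$ in $\hat\Omega_n$, and there are $\psi_n\in C^2(\hat\Omega_n)$ such that the following hold, where all densities are computed from $\psi_n,\varphi_n,\mathbf A_n,a_n$, $\bar\rho_n(t)=\int_{\Omega_n}\rho_n\,d\mathbf x$, and $\mathbf r=\mathbf r_n(t)=\frac1{\bar\rho_n}\int_{\Omega_n}\mathbf x\rho_n\,d\mathbf x$: (i) $\psi_n$ solves the NLS equation (with $a=a_n$, $\varphi=\varphi_n$, $\mathbf A=\mathbf A_n$) in $\hat\Omega_n$. (ii) $\left|\int_{\Omega_n}\mathbf P_n(t)\,d\mathbf x\right|\le C$ for $T_-\le t\le T_+$. (iii) $C\ge\bar\rho_n(t)\ge c_0>0$ for $n\ge n_0$, $T_-\le t\le T_+$. (iv) There is $t_0\in[T_-,T_+]$ with $\bar\rho_n(t_0)\to\bar\rho_\infty$.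 (v) Uniformly on $[T_-,T_+]$ the following tend to $0$: $Q_0=\int_{t_0}^t\int_{\partial\Omega_n}\bar{\mathbf n}_iT^{ij}d\sigma dt'$ (sum over $i$); $Q_{01}=\int_{t_0}^t\int_{\partial\Omega_n}\mathbf P\,\hat{\mathbf v}\cdot\bar{\mathbf n}\,d\sigma dt'$; $Q_{20}=-\int_{\partial\Omega_n}(\mathbf x-\mathbf r)\hat{\mathbf v}\cdot\bar{\mathbf n}\,\rho\,d\sigma$; $Q_{22}=\int_{\partial\Omega_n}(\mathbf x-\mathbf r)\bar{\mathbf n}\cdot\mathbf J\,d\sigma$; $Q_{23}=\int_{t_0}^t\int_{\partial\Omega_n}\hat{\mathbf v}\cdot\bar{\mathbf n}\,\rho\,d\sigma dt'-\int_{t_0}^t\int_{\partial\Omega_n}\bar{\mathbf n}\cdot\mathbf J\,d\sigma dt'$. (vi) With $Q_{30}=\int_{\Omega_n}(\mathbf E-\mathbf E_\infty)\rho\,d\mathbf x$ and $Q_{31}=\int_{\Omega_n}\frac1{\mathrm c}\mathbf J\times(\mathbf B-\mathbf B_\infty)\,d\mathbf x$, $\int_{t_0}^t(Q_{30}+Q_{31})dt'\to0$ uniformly on $[T_-,T_+]$. *)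

theory Defs
  imports "HOL-Analysis.Analysis"
begin

type_synonym spacetime = "real \<times> (real^3)"

text \<open>
  Functions of time and space are functions on \<^typ>\<open>spacetime\<close>. All derivatives are taken
  within a set \<open>S\<close>, because the sets of interest include closed tubes around a trajectory, where
  derivatives up to the boundary occur. Partial derivatives are values of the total derivative:
  at a lateral boundary point of a tube the line through that point in the time direction may meet
  the tube in no other nearby point, although the total derivative is unique there.
  The definitions are meant for sets on which total derivatives are unique: open sets,
  slabs \<open>{Tm..Tp} \<times> UNIV\<close>, and tubes of positive radius and positive duration.
\<close>

definition C1_on :: "'a::euclidean_space set \<Rightarrow> ('a \<Rightarrow> 'b::real_normed_vector) \<Rightarrow> bool" where
  "C1_on S f \<longleftrightarrow> f differentiable_on S \<and>
     (\<forall>v. continuous_on S (\<lambda>p. frechet_derivative f (at p within S) v))"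

definition C2_on :: "'a::euclidean_space set \<Rightarrow> ('a \<Rightarrow> 'b::real_normed_vector) \<Rightarrow> bool" where
  "C2_on S f \<longleftrightarrow> C1_on S f \<and> (\<forall>v. C1_on S (\<lambda>p. frechet_derivative f (at p within S) v))"

definition pd_t ::
  "spacetime set \<Rightarrow> (spacetime \<Rightarrow> 'b) \<Rightarrow> spacetime \<Rightarrow> 'b::real_normed_vector" where
  "pd_t S f p = frechet_derivative f (at p within S) (1, 0)"

definition pd_x ::
  "spacetime set \<Rightarrow> 3 \<Rightarrow> (spacetime \<Rightarrow> 'b) \<Rightarrow> spacetime \<Rightarrow> 'b::real_normed_vector" where
  "pd_x S j f p = frechet_derivative f (at p within S) (0, axis j 1)"

text \<open>For a vector field, row \<open>i\<close> of the gradient is the partial derivative in direction \<open>i\<close>.\<close>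

definition grad ::
  "spacetime set \<Rightarrow> (spacetime \<Rightarrow> 'b) \<Rightarrow> spacetime \<Rightarrow> 'b::real_normed_vector ^ 3" where
  "grad S f p = (\<chi> i. pd_x S i f p)"

definition curl :: "spacetime set \<Rightarrow> (spacetime \<Rightarrow> real^3) \<Rightarrow> spacetime \<Rightarrow> real^3" where
  "curl S A p = vector
     [pd_x S 2 A p $ 3 - pd_x S 3 A p $ 2,
      pd_x S 3 A p $ 1 - pd_x S 1 A p $ 3,
      pd_x S 1 A p $ 2 - pd_x S 2 A p $ 1]"

text \<open>The affine function \<open>f\<^sub>0 + (x - r) \<cdot> g\<close> of \<open>x\<close>, for scalar- and vector-valued \<open>f\<^sub>0\<close>.\<close>

definition affine_at :: "'b \<Rightarrow> 'b ^ 3 \<Rightarrow> real^3 \<Rightarrow> real^3 \<Rightarrow> 'b::real_normed_vector" where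
  "affine_at f0 g r x = f0 + (\<Sum>i\<in>UNIV. (x - r) $ i *\<^sub>R g $ i)"

text \<open>
  Surface measure on the sphere, from the parametrization by polar angle \<open>\<theta>\<close> and azimuth \<open>\<alpha>\<close>,
  whose area element is \<open>R\<^sup>2 sin \<theta> d\<theta> d\<alpha>\<close>. The measure lives on the sphere itself,
  so integrands need not be measurable away from it.
\<close>

definition sphere_param :: "real^3 \<Rightarrow> real \<Rightarrow> real \<times> real \<Rightarrow> real^3" where
  "sphere_param r R = (\<lambda>(\<theta>, \<alpha>). r + R *\<^sub>R vector [sin \<theta> * cos \<alpha>, sin \<theta> * sin \<alpha>, cos \<theta>])"

definition sphere_measure :: "real^3 \<Rightarrow> real \<Rightarrow> (real^3) measure" where
  "sphere_measure r R =
     distr (density lborel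
              (\<lambda>(\<theta>, \<alpha>). ennreal (R\<^sup>2 * sin \<theta>) * indicator ({0..pi} \<times> {0..2 * pi}) (\<theta>, \<alpha>)))
       (restrict_space borel (sphere r R)) (sphere_param r R)"

definition vanishes_uniformly :: "(nat \<Rightarrow> 'a set) \<Rightarrow> (nat \<Rightarrow> 'a \<Rightarrow> real) \<Rightarrow> bool" where
  "vanishes_uniformly S f \<longleftrightarrow>
     (\<forall>\<epsilon>>0. \<forall>\<^sub>F n in sequentially. \<forall>p\<in>S n. \<bar>f n p\<bar> < \<epsilon>)"

subsection \<open>Trajectories and tubes\<close>

definition velocity :: "real \<Rightarrow> real \<Rightarrow> (real \<Rightarrow> real^3) \<Rightarrow> real \<Rightarrow> real^3" where
  "velocity Tm Tp rhat t = vector_derivative rhat (at t within {Tm..Tp})"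

definition acceleration :: "real \<Rightarrow> real \<Rightarrow> (real \<Rightarrow> real^3) \<Rightarrow> real \<Rightarrow> real^3" where
  "acceleration Tm Tp rhat t = vector_derivative (velocity Tm Tp rhat) (at t within {Tm..Tp})"

definition trajectory :: "real \<Rightarrow> real \<Rightarrow> (real \<Rightarrow> real^3) \<Rightarrow> bool" where
  "trajectory Tm Tp rhat \<longleftrightarrow> Tm < Tp \<and>
     rhat differentiable_on {Tm..Tp} \<and>
     velocity Tm Tp rhat differentiable_on {Tm..Tp} \<and>
     continuous_on {Tm..Tp} (acceleration Tm Tp rhat) \<and>
     bounded (velocity Tm Tp rhat ` {Tm..Tp}) \<and>
     bounded (acceleration Tm Tp rhat ` {Tm..Tp})"

definition tube :: "real \<Rightarrow> real \<Rightarrow> (real \<Rightarrow> real^3) \<Rightarrow> real \<Rightarrow> spacetime set" where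
  "tube Tm Tp rhat R = {(t, x). t \<in> {Tm..Tp} \<and> x \<in> cball (rhat t) R}"

definition slab :: "real \<Rightarrow> real \<Rightarrow> spacetime set" where
  "slab Tm Tp = {Tm..Tp} \<times> UNIV"

subsection \<open>Densities\<close>

definition nabla0 ::
  "real \<Rightarrow> spacetime set \<Rightarrow> (spacetime \<Rightarrow> 'b) \<Rightarrow> spacetime
     \<Rightarrow> 'b::real_normed_vector \<times> ('b ^ 3)" where
  "nabla0 c S f p = ((1 / c) *\<^sub>R pd_t S f p, grad S f p)"

definition electric_field ::
  "real \<Rightarrow> spacetime set \<Rightarrow> (spacetime \<Rightarrow> real) \<Rightarrow> (spacetime \<Rightarrow> real^3)
     \<Rightarrow> spacetime \<Rightarrow> real^3" where
  "electric_field c S \<phi> A p = - grad S \<phi> p - (1 / c) *\<^sub>R pd_t S A p"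

definition Ga' :: "(real \<Rightarrow> real) \<Rightarrow> real \<Rightarrow> real \<Rightarrow> real" where
  "Ga' G1' a s = G1' (a ^ 3 * s) / a\<^sup>2"

definition Ga :: "(real \<Rightarrow> real) \<Rightarrow> real \<Rightarrow> real \<Rightarrow> real" where
  "Ga G1' a s = integral {0..s} (Ga' G1' a)"

text \<open>The values of \<open>G1'\<close> at arguments \<open>s \<le> 0\<close> are irrelevant here and below.\<close>

definition nonlinearity_condition :: "(real \<Rightarrow> real) \<Rightarrow> bool" where
  "nonlinearity_condition G1' \<longleftrightarrow>
     (let G1 = Ga G1' 1;
          g = (\<lambda>z::complex. if z = 0 then 0 else complex_of_real (G1' ((cmod z)\<^sup>2)) * z)
      in continuous_on {0<..} G1' \<and>
         (\<forall>s>0. (G1 has_real_derivative G1' s) (at s)) \<and>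
         continuous_on {0..} G1 \<and>
         (\<forall>z. ((\<lambda>w. complex_of_real (G1 ((cmod w)\<^sup>2)))
                 has_derivative (\<lambda>h. g z * cnj h + cnj (g z) * h)) (at z)) \<and>
         continuous_on UNIV g)"

locale nls =
  fixes m q chi c :: real
    and G1' :: "real \<Rightarrow> real"
    and Tm Tp :: real
    and rhat :: "real \<Rightarrow> real^3"
begin

text \<open>
  \<open>Dts\<close> and \<open>Dxs\<close> are the covariant derivatives with the opposite sign of the charge. The quantities
  below of type \<^typ>\<open>real\<close> are written as real parts of expressions whose values are real.
\<close>

definition Dt where
  "Dt S \<phi> f p = pd_t S f p + \<i> * complex_of_real (q / chi * \<phi> p) * f p"
  for \<phi> :: "spacetime \<Rightarrow> real" and f :: "spacetime \<Rightarrow> complex"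

definition Dts where
  "Dts S \<phi> f p = pd_t S f p - \<i> * complex_of_real (q / chi * \<phi> p) * f p"
  for \<phi> :: "spacetime \<Rightarrow> real" and f :: "spacetime \<Rightarrow> complex"

definition Dx where
  "Dx S A j f p = pd_x S j f p - \<i> * complex_of_real (q / (chi * c) * A p $ j) * f p"
  for A :: "spacetime \<Rightarrow> real^3" and f :: "spacetime \<Rightarrow> complex"

definition Dxs where
  "Dxs S A j f p = pd_x S j f p + \<i> * complex_of_real (q / (chi * c) * A p $ j) * f p"
  for A :: "spacetime \<Rightarrow> real^3" and f :: "spacetime \<Rightarrow> complex"

definition nls_solution where
  "nls_solution S a \<phi> A \<psi> \<longleftrightarrow>
     (\<forall>p\<in>S. \<i> * Dt S \<phi> \<psi> p =
        complex_of_real (chi / (2 * m)) *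
          (- (\<Sum>j\<in>UNIV. Dx S A j (Dx S A j \<psi>) p)
           + complex_of_real (Ga' G1' a ((cmod (\<psi> p))\<^sup>2)) * \<psi> p))"

definition rho :: "(spacetime \<Rightarrow> complex) \<Rightarrow> spacetime \<Rightarrow> real" where
  "rho \<psi> p = q * Re (\<psi> p * cnj (\<psi> p))"

definition J :: "_ \<Rightarrow> _ \<Rightarrow> _ \<Rightarrow> _ \<Rightarrow> real^3" where
  "J S A \<psi> p = (\<chi> j. Re (- (\<i> * complex_of_real (q * chi / (2 * m))) *
      (cnj (\<psi> p) * Dx S A j \<psi> p - \<psi> p * Dxs S A j (\<lambda>p. cnj (\<psi> p)) p)))"

definition P :: "_ \<Rightarrow> _ \<Rightarrow> _ \<Rightarrow> _ \<Rightarrow> real^3" where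
  "P S A \<psi> p = (\<chi> j. Re (\<i> * complex_of_real (chi / 2) *
      (\<psi> p * Dxs S A j (\<lambda>p. cnj (\<psi> p)) p - cnj (\<psi> p) * Dx S A j \<psi> p)))"

definition u :: "_ \<Rightarrow> _ \<Rightarrow> _ \<Rightarrow> _ \<Rightarrow> _ \<Rightarrow> real" where
  "u S a A \<psi> p = chi\<^sup>2 / (2 * m) *
      ((\<Sum>j\<in>UNIV. (cmod (Dx S A j \<psi> p))\<^sup>2) + Ga G1' a ((cmod (\<psi> p))\<^sup>2))"

definition T :: "_ \<Rightarrow> _ \<Rightarrow> _ \<Rightarrow> _ \<Rightarrow> _ \<Rightarrow> _ \<Rightarrow> 3 \<Rightarrow> 3 \<Rightarrow> real" where
  "T S a \<phi> A \<psi> p i j =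
     (let \<psi>s = (\<lambda>p. cnj (\<psi> p)) in
      if i \<noteq> j then
        Re (complex_of_real (chi\<^sup>2 / (2 * m)) *
          (Dx S A i \<psi> p * Dxs S A j \<psi>s p + Dx S A j \<psi> p * Dxs S A i \<psi>s p))
      else
        - u S a A \<psi> p
        + Re (complex_of_real (chi\<^sup>2 / m) * Dx S A i \<psi> p * Dxs S A i \<psi>s p
              + \<i> * complex_of_real (chi / 2) *
                  (\<psi>s p * Dt S \<phi> \<psi> p - \<psi> p * Dts S \<phi> \<psi>s p)))"

subsection \<open>Integrals over the moving ball and its boundary\<close>

abbreviation "vhat \<equiv> velocity Tm Tp rhat"

definition normal :: "real \<Rightarrow> real \<Rightarrow> real^3 \<Rightarrow> real^3" where
  "normal R t x = (1 / R) *\<^sub>R (x - rhat t)"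

definition rhobar :: "real \<Rightarrow> _ \<Rightarrow> real \<Rightarrow> real" where
  "rhobar R \<psi> t = (LINT x:cball (rhat t) R|lborel. rho \<psi> (t, x))"

definition center :: "real \<Rightarrow> _ \<Rightarrow> real \<Rightarrow> real^3" where
  "center R \<psi> t =
     (1 / rhobar R \<psi> t) *\<^sub>R (LINT x:cball (rhat t) R|lborel. (rho \<psi> (t, x) *\<^sub>R x))"

definition Q0 :: "_ \<Rightarrow> _ \<Rightarrow> _ \<Rightarrow> _ \<Rightarrow> _ \<Rightarrow> real \<Rightarrow> real \<Rightarrow> real^3" where
  "Q0 R a \<phi> A \<psi> t0 t =
     (LBINT s=ereal t0..ereal t. (LINT x|sphere_measure (rhat s) R.
        (\<chi> j. \<Sum>i\<in>UNIV. normal R s x $ i * T (tube Tm Tp rhat R) a \<phi> A \<psi> (s, x) i j)))"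

definition Q01 :: "_ \<Rightarrow> _ \<Rightarrow> _ \<Rightarrow> real \<Rightarrow> real \<Rightarrow> real^3" where
  "Q01 R A \<psi> t0 t =
     (LBINT s=ereal t0..ereal t. (LINT x|sphere_measure (rhat s) R.
        ((vhat s \<bullet> normal R s x) *\<^sub>R P (tube Tm Tp rhat R) A \<psi> (s, x))))"

definition Q20 :: "_ \<Rightarrow> _ \<Rightarrow> real \<Rightarrow> real^3" where
  "Q20 R \<psi> t =
     - (LINT x|sphere_measure (rhat t) R.
          (((vhat t \<bullet> normal R t x) * rho \<psi> (t, x)) *\<^sub>R (x - center R \<psi> t)))"

definition Q22 :: "_ \<Rightarrow> _ \<Rightarrow> _ \<Rightarrow> real \<Rightarrow> real^3" where
  "Q22 R A \<psi> t =
     (LINT x|sphere_measure (rhat t) R.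
        ((normal R t x \<bullet> J (tube Tm Tp rhat R) A \<psi> (t, x)) *\<^sub>R (x - center R \<psi> t)))"

definition Q23 :: "_ \<Rightarrow> _ \<Rightarrow> _ \<Rightarrow> real \<Rightarrow> real \<Rightarrow> real" where
  "Q23 R A \<psi> t0 t =
     (LBINT s=ereal t0..ereal t. (LINT x|sphere_measure (rhat s) R.
        ((vhat s \<bullet> normal R s x) * rho \<psi> (s, x))))
     - (LBINT s=ereal t0..ereal t. (LINT x|sphere_measure (rhat s) R.
          (normal R s x \<bullet> J (tube Tm Tp rhat R) A \<psi> (s, x))))"

definition E_inf :: "_ \<Rightarrow> _ \<Rightarrow> real \<Rightarrow> real^3" where
  "E_inf \<phi>\<^sub>i A\<^sub>i t = electric_field c (slab Tm Tp) \<phi>\<^sub>i A\<^sub>i (t, rhat t)"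

definition B_inf :: "_ \<Rightarrow> real \<Rightarrow> real^3" where
  "B_inf A\<^sub>i t = curl (slab Tm Tp) A\<^sub>i (t, rhat t)"

definition Q30 :: "_ \<Rightarrow> _ \<Rightarrow> _ \<Rightarrow> _ \<Rightarrow> _ \<Rightarrow> _ \<Rightarrow> real \<Rightarrow> real^3" where
  "Q30 \<phi>\<^sub>i A\<^sub>i R \<phi> A \<psi> t =
     (LINT x:cball (rhat t) R|lborel.
        (rho \<psi> (t, x) *\<^sub>R (electric_field c (tube Tm Tp rhat R) \<phi> A (t, x) - E_inf \<phi>\<^sub>i A\<^sub>i t)))"

definition Q31 :: "_ \<Rightarrow> _ \<Rightarrow> _ \<Rightarrow> _ \<Rightarrow> real \<Rightarrow> real^3" where
  "Q31 A\<^sub>i R A \<psi> t =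
     (LINT x:cball (rhat t) R|lborel.
        ((1 / c) *\<^sub>R cross3 (J (tube Tm Tp rhat R) A \<psi> (t, x))
                          (curl (tube Tm Tp rhat R) A (t, x) - B_inf A\<^sub>i t)))"

subsection \<open>Concentrating solutions\<close>

text \<open>\<open>f\<close> is linear in \<open>x\<close>, differentiable, and bounded on the trajectory with its derivatives.\<close>

definition limit_potential :: "(spacetime \<Rightarrow> 'b::real_normed_vector) \<Rightarrow> bool" where
  "limit_potential f \<longleftrightarrow>
     (\<exists>f0 g. \<forall>t\<in>{Tm..Tp}. \<forall>x. f (t, x) = affine_at (f0 t) (g t) (rhat t) x) \<and>
     f differentiable_on slab Tm Tp \<and>
     (\<exists>C. \<forall>t\<in>{Tm..Tp}. norm (f (t, rhat t)) \<le> C \<and>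
                        norm (nabla0 c (slab Tm Tp) f (t, rhat t)) \<le> C)"

definition localized ::
  "(nat \<Rightarrow> real) \<Rightarrow> (spacetime \<Rightarrow> 'b::real_normed_vector) \<Rightarrow> (nat \<Rightarrow> spacetime \<Rightarrow> 'b)
     \<Rightarrow> bool" where
  "localized R f\<^sub>i f \<longleftrightarrow>
     (\<forall>n. C2_on (tube Tm Tp rhat (R n)) (f n)) \<and>
     vanishes_uniformly (\<lambda>n. tube Tm Tp rhat (R n))
       (\<lambda>n p. norm (f n p - f\<^sub>i p) +
              norm (nabla0 c (tube Tm Tp rhat (R n)) (f n) p - nabla0 c (slab Tm Tp) f\<^sub>i p)) \<and>
     (\<exists>C. \<forall>n. \<forall>p\<in>tube Tm Tp rhat (R n).
        norm (f n p) \<le> C \<and> norm (nabla0 c (tube Tm Tp rhat (R n)) (f n) p) \<le> C)"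

definition concentrate ::
  "(spacetime \<Rightarrow> real) \<Rightarrow> (spacetime \<Rightarrow> real^3)
     \<Rightarrow> (nat \<Rightarrow> spacetime \<Rightarrow> complex) \<Rightarrow> bool" where
  "concentrate \<phi>\<^sub>i A\<^sub>i \<psi> \<longleftrightarrow>
     nonlinearity_condition G1' \<and> limit_potential \<phi>\<^sub>i \<and> limit_potential A\<^sub>i \<and>
     (\<exists>a R \<phi> A.
        (\<forall>n. 0 < a n \<and> 0 < R n) \<and>
        a \<longlonglongrightarrow> 0 \<and> R \<longlonglongrightarrow> 0 \<and> filterlim (\<lambda>n. R n / a n) at_top sequentially \<and>
        localized R \<phi>\<^sub>i \<phi> \<and> localized R A\<^sub>i A \<and>
        (\<forall>n. C2_on (tube Tm Tp rhat (R n)) (\<psi> n)) \<and>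
        (\<forall>n. nls_solution (tube Tm Tp rhat (R n)) (a n) (\<phi> n) (A n) (\<psi> n)) \<and>
        (\<exists>C. \<forall>n. \<forall>t\<in>{Tm..Tp}.
           norm (LINT x:cball (rhat t) (R n)|lborel.
                   P (tube Tm Tp rhat (R n)) (A n) (\<psi> n) (t, x)) \<le> C) \<and>
        (\<exists>C c0 n0. 0 < c0 \<and>
           (\<forall>n\<ge>n0. \<forall>t\<in>{Tm..Tp}. c0 \<le> rhobar (R n) (\<psi> n) t \<and> rhobar (R n) (\<psi> n) t \<le> C)) \<and>
        (\<exists>t0\<in>{Tm..Tp}.
           (\<exists>rho_inf. (\<lambda>n. rhobar (R n) (\<psi> n) t0) \<longlonglongrightarrow> rho_inf) \<and>
           uniform_limit {Tm..Tp} (\<lambda>n. Q0 (R n) (a n) (\<phi> n) (A n) (\<psi> n) t0) (\<lambda>_. 0) sequentially \<and>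
           uniform_limit {Tm..Tp} (\<lambda>n. Q01 (R n) (A n) (\<psi> n) t0) (\<lambda>_. 0) sequentially \<and>
           uniform_limit {Tm..Tp} (\<lambda>n. Q20 (R n) (\<psi> n)) (\<lambda>_. 0) sequentially \<and>
           uniform_limit {Tm..Tp} (\<lambda>n. Q22 (R n) (A n) (\<psi> n)) (\<lambda>_. 0) sequentially \<and>
           uniform_limit {Tm..Tp} (\<lambda>n. Q23 (R n) (A n) (\<psi> n) t0) (\<lambda>_. 0) sequentially \<and>
           uniform_limit {Tm..Tp}
             (\<lambda>n t. LBINT s=ereal t0..ereal t.
                 (Q30 \<phi>\<^sub>i A\<^sub>i (R n) (\<phi> n) (A n) (\<psi> n) s + Q31 A\<^sub>i (R n) (A n) (\<psi> n) s))
             (\<lambda>_. 0) sequentially))"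

end

end

theory Submission
  imports Defs
begin

text \<open>
  Integrating the conservation laws of the NLS equation over the small moving ball turns the field
  equations into ordinary differential equations for the total charge, the center of charge and the
  total momentum, up to surface terms that are assumed to vanish. Write \<open>rb\<close>, \<open>r\<close>, \<open>pb\<close> for the
  charge, the center and the integrated momentum density in the ball of radius \<open>R\<close> around \<open>rhat t\<close>.

  Pointwise, the NLS equation gives charge conservation \<open>\<partial>\<^sub>t \<rho> + div J = 0\<close> and the momentum law
  \<open>\<partial>\<^sub>t P + div T = \<rho> E + J \<times> B / c\<close> (\<open>continuity_equation\<close>, \<open>momentum_balance\<close>). Both are computed
  with covariant derivatives, which obey a Leibniz rule for the real inner product of two complex
  fields; the Lorentz force density is what their commutators contribute.

  A ball transported along the trajectory satisfies Reynolds' formula, and the divergence theorem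
  turns divergences into fluxes through the sphere (\<open>ball_integral_derivative\<close>,
  \<open>divergence_theorem_ball\<close>). This yields, for each index of the sequence,
  \<open>rb t - rb t0 = Q23\<close>, \<open>rb r' = (q/m) pb - Q20 - Q22\<close>, and
  \<open>pb t - pb t0 = Q01 - Q0 + \<integral> (rb E\<^sub>\<infinity> + (q/(mc)) pb \<times> B\<^sub>\<infinity>) + \<integral> (Q30 + Q31)\<close>
  (\<open>charge_balance\<close>, \<open>center_derivative\<close>, \<open>momentum_balance_integrated\<close>, \<open>lorentz_decomposition\<close>).

  In the limit (\<open>newton_limit\<close>) \<open>rb\<close> tends to a positive constant \<open>\<rho>\<close>, and \<open>r\<close> tends to \<open>rhat\<close> because
  the center lies in the ball. The derivatives of \<open>r\<close> are only known to be bounded, but \<open>B\<^sub>\<infinity>\<close> is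
  continuously differentiable in time, so \<open>\<integral> r' \<times> B\<^sub>\<infinity>\<close> converges after an integration by parts. Hence
  \<open>pb - pb t0\<close> converges uniformly, then so does \<open>pb t0\<close> since \<open>\<integral> pb\<close> is proportional to a
  displacement of the center, and the limit of the two balance laws is Newton's law. No compactness
  argument or passage to subsequences is needed.
\<close>

section \<open>Spherical coordinates\<close>

text \<open>The outward unit normal of a sphere at polar angle \<open>\<theta>\<close> and azimuth \<open>\<alpha>\<close>.\<close>

definition sph_normal :: "real \<Rightarrow> real \<Rightarrow> real^3" where
  "sph_normal \<theta> \<alpha> = vector [sin \<theta> * cos \<alpha>, sin \<theta> * sin \<alpha>, cos \<theta>]"

lemma vector3_eq_axis_sum:
  "(vector [a, b, c] :: real^3) = a *\<^sub>R axis 1 1 + b *\<^sub>R axis 2 1 + c *\<^sub>R axis 3 1"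
  by (simp add: vec_eq_iff forall_3 axis_def)

lemma continuous_on_sph_normal [continuous_intros]:
  fixes S :: "'a::metric_space set"
  assumes "continuous_on S f" "continuous_on S g"
  shows "continuous_on S (\<lambda>x. sph_normal (f x) (g x))"
  unfolding sph_normal_def vector3_eq_axis_sum by (intro continuous_intros assms)

lemma norm_vec3: "norm (x :: real^3) = sqrt ((x$1)\<^sup>2 + (x$2)\<^sup>2 + (x$3)\<^sup>2)"
  by (simp add: norm_vec_def L2_set_def sum_3)

lemma norm_sph_normal [simp]: "norm (sph_normal \<theta> \<alpha>) = 1"
proof -
  have "(sin \<theta> * cos \<alpha>)\<^sup>2 + (sin \<theta> * sin \<alpha>)\<^sup>2 + (cos \<theta>)\<^sup>2
      = (sin \<theta>)\<^sup>2 * ((cos \<alpha>)\<^sup>2 + (sin \<alpha>)\<^sup>2) + (cos \<theta>)\<^sup>2"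
    by algebra
  then show ?thesis by (simp add: norm_vec3 sph_normal_def)
qed

lemma sphere_param_eq: "sphere_param r R (\<theta>, \<alpha>) = r + R *\<^sub>R sph_normal \<theta> \<alpha>"
  by (simp add: sphere_param_def sph_normal_def)

lemma set_integrable_compact:
  fixes f :: "'a::euclidean_space \<Rightarrow> 'b::euclidean_space"
  assumes "compact S" "continuous_on S f"
  shows "set_integrable lborel S f"
  using borel_integrable_compact[OF assms] by (simp add: set_integrable_def)

lemma set_integral_compact_eq_integral:
  fixes f :: "'a::euclidean_space \<Rightarrow> 'b::euclidean_space"
  assumes "compact S" "continuous_on S f"
  shows "(LINT x:S|lborel. f x) = integral S f"
  using set_borel_integral_eq_integral(2)[OF set_integrable_compact[OF assms]] .

lemma
  fixes h :: "real^3 \<Rightarrow> 'b::euclidean_space"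
  assumes "0 \<le> R" and h: "continuous_on (sphere r R) h"
  shows sphere_integrable: "integrable (sphere_measure r R) h"
    and sphere_integral_eq: "(LINT x|sphere_measure r R. h x) =
    integral (cbox (0, 0) (pi, 2 * pi)) (\<lambda>(\<theta>, \<alpha>). (R\<^sup>2 * sin \<theta>) *\<^sub>R h (r + R *\<^sub>R sph_normal \<theta> \<alpha>))"
proof -
  let ?B = "{0..pi} \<times> {0..2 * pi}"
  let ?w = "\<lambda>(\<theta>, \<alpha>). (R\<^sup>2 * sin \<theta>) * indicator ?B (\<theta>, \<alpha>) :: real"
  have B: "cbox (0, 0) (pi, 2 * pi) = ?B"
    by (simp add: cbox_Pair_eq)
  have on_sphere: "sphere_param r R p \<in> sphere r R" for p
    using assms(1) by (cases p) (simp add: sphere_param_eq dist_norm)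
  have cont: "continuous_on UNIV (sphere_param r R)"
  proof -
    have "sphere_param r R = (\<lambda>p. r + R *\<^sub>R sph_normal (fst p) (snd p))"
      by (auto simp: sphere_param_eq)
    then show ?thesis
      by (simp only:) (intro continuous_intros)
  qed
  then have "sphere_param r R \<in> borel_measurable borel"
    by (rule borel_measurable_continuous_onI)
  then have meas: "sphere_param r R \<in> measurable borel (restrict_space borel (sphere r R))"
    by (intro measurable_restrict_space2) (use on_sphere in auto)
  have hm: "h \<in> borel_measurable (restrict_space borel (sphere r R))"
    using h by (rule borel_measurable_continuous_on_restrict)
  have wm: "?w \<in> borel_measurable borel"
  proof -
    have "(\<lambda>p::real \<times> real. R\<^sup>2 * sin (fst p)) \<in> borel_measurable borel"
      by (intro borel_measurable_continuous_onI continuous_intros)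
    moreover have "(indicator ?B :: _ \<Rightarrow> real) \<in> borel_measurable borel"
      by (intro borel_measurable_indicator borel_closed closed_Times closed_atLeastAtMost)
    ultimately show ?thesis
      by (simp add: case_prod_unfold borel_measurable_times)
  qed
  have w_nonneg: "0 \<le> ?w p" for p
    by (cases p) (auto simp: indicator_def sin_ge_zero)
  have dens: "density lborel (\<lambda>(\<theta>, \<alpha>). ennreal (R\<^sup>2 * sin \<theta>) * indicator ?B (\<theta>, \<alpha>))
      = density lborel (\<lambda>p. ennreal (?w p))"
    by (intro arg_cong[where f="density lborel"] ext) (auto simp: indicator_def)
  have sm: "sphere_measure r R =
      distr (density lborel (\<lambda>p. ennreal (?w p))) (restrict_space borel (sphere r R)) (sphere_param r R)"
    unfolding sphere_measure_def dens ..
  have hp: "(\<lambda>p. h (sphere_param r R p)) \<in> borel_measurable lborel"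
    using measurable_compose[OF meas hm] by simp
  let ?k = "\<lambda>p. (R\<^sup>2 * sin (fst p)) *\<^sub>R h (sphere_param r R p)"
  have ck: "continuous_on ?B ?k"
  proof (intro continuous_intros)
    show "continuous_on ?B (\<lambda>x. h (sphere_param r R x))"
      using on_sphere by (intro continuous_on_compose2[OF h] continuous_on_subset[OF cont]) auto
  qed
  have wk: "(\<lambda>p. ?w p *\<^sub>R h (sphere_param r R p)) = (\<lambda>p. indicator ?B p *\<^sub>R ?k p)"
    by (auto simp: fun_eq_iff indicator_def)
  have cB: "compact ?B"
    by (intro compact_Times compact_Icc)
  have meas': "sphere_param r R \<in> measurable (density lborel (\<lambda>p. ennreal (?w p))) (restrict_space borel (sphere r R))"
    using meas by simp
  have w_meas: "?w \<in> borel_measurable lborel" and w_AE: "AE p in lborel. 0 \<le> ?w p"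
    using wm w_nonneg by auto
  show "integrable (sphere_measure r R) h"
    unfolding sm integrable_distr_eq[OF meas' hm] integrable_density[OF hp w_meas w_AE] wk
    by (rule borel_integrable_compact[OF cB ck])
  have "(LINT x|sphere_measure r R. h x) = (LINT p|lborel. ?w p *\<^sub>R h (sphere_param r R p))"
    unfolding sm integral_distr[OF meas' hm] integral_density[OF hp w_meas w_AE] ..
  also have "\<dots> = (LINT p:?B|lborel. ?k p)"
    unfolding set_lebesgue_integral_def wk ..
  also have "\<dots> = integral ?B ?k"
    by (rule set_integral_compact_eq_integral[OF cB ck])
  also have "\<dots> = integral ?B (\<lambda>(\<theta>, \<alpha>). (R\<^sup>2 * sin \<theta>) *\<^sub>R h (r + R *\<^sub>R sph_normal \<theta> \<alpha>))"
    by (simp add: case_prod_unfold sphere_param_eq[symmetric])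
  finally show "(LINT x|sphere_measure r R. h x) =
    integral (cbox (0, 0) (pi, 2 * pi)) (\<lambda>(\<theta>, \<alpha>). (R\<^sup>2 * sin \<theta>) *\<^sub>R h (r + R *\<^sub>R sph_normal \<theta> \<alpha>))"
    by (simp add: B)
qed

text \<open>Spherical coordinates around \<open>r\<close>: the components of \<open>v\<close> are radius, polar angle and azimuth.\<close>

definition spherical :: "real^3 \<Rightarrow> real^3 \<Rightarrow> real^3" where
  "spherical r v = r + v$1 *\<^sub>R sph_normal (v$2) (v$3)"

text \<open>The total derivative of \<^term>\<open>spherical r\<close> at \<open>v\<close>, which does not depend on \<open>r\<close>.\<close>

definition spherical_deriv :: "real^3 \<Rightarrow> real^3 \<Rightarrow> real^3" where
  "spherical_deriv v h = vector
    [h$1 * (sin (v$2) * cos (v$3)) + h$2 * (v$1 * cos (v$2) * cos (v$3)) - h$3 * (v$1 * sin (v$2) * sin (v$3)),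
     h$1 * (sin (v$2) * sin (v$3)) + h$2 * (v$1 * cos (v$2) * sin (v$3)) + h$3 * (v$1 * sin (v$2) * cos (v$3)),
     h$1 * cos (v$2) - h$2 * (v$1 * sin (v$2))]"

lemma has_derivative_nth [derivative_intros]:
  assumes "(f has_derivative f') F"
  shows "((\<lambda>x. f x $ i) has_derivative (\<lambda>h. f' h $ i)) F"
  by (rule bounded_linear.has_derivative[OF bounded_linear_vec_nth assms])

lemma has_derivative_spherical:
  "(spherical r has_derivative spherical_deriv v) (at v within S)"
  unfolding spherical_def spherical_deriv_def sph_normal_def vector3_eq_axis_sum
  by (rule derivative_eq_intros refl | simp)+
     (auto simp: fun_eq_iff vec_eq_iff forall_3 axis_def algebra_simps)

lemma det_spherical_deriv:
  "det (matrix (spherical_deriv v)) = (v$1)\<^sup>2 * sin (v$2)"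
proof -
  have a: "sin (v$2) * sin (v$2) + cos (v$2) * cos (v$2) = 1"
    and b: "sin (v$3) * sin (v$3) + cos (v$3) * cos (v$3) = 1"
    by (simp_all flip: power2_eq_square)
  show ?thesis
    by (simp add: det_3 matrix_def spherical_deriv_def axis_def power2_eq_square)
       (use a b in algebra)
qed

text \<open>The open coordinate box. Its image is the open ball without the half-plane of azimuth \<open>0\<close>,
  hence the closed ball up to a negligible set.\<close>

definition spherical_box :: "real \<Rightarrow> (real^3) set" where
  "spherical_box R = box 0 (vector [R, pi, 2 * pi])"

lemma mem_spherical_box:
  "v \<in> spherical_box R \<longleftrightarrow> 0 < v$1 \<and> v$1 < R \<and> 0 < v$2 \<and> v$2 < pi \<and> 0 < v$3 \<and> v$3 < 2 * pi"
  by (auto simp: spherical_box_def mem_box_cart forall_3)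

lemma inj_on_spherical: "inj_on (spherical r) (spherical_box R)"
proof (rule inj_onI)
  fix v w assume v: "v \<in> spherical_box R" and w: "w \<in> spherical_box R"
    and eq: "spherical r v = spherical r w"
  have eq': "v$1 *\<^sub>R sph_normal (v$2) (v$3) = w$1 *\<^sub>R sph_normal (w$2) (w$3)"
    using eq by (simp add: spherical_def)
  then have "norm (v$1 *\<^sub>R sph_normal (v$2) (v$3)) = norm (w$1 *\<^sub>R sph_normal (w$2) (w$3))"
    by simp
  moreover have pos: "0 < v$1" "0 < w$1"
    using v w by (simp_all add: mem_spherical_box)
  ultimately have 1: "v$1 = w$1"
    by simp
  have "v$1 *\<^sub>R sph_normal (v$2) (v$3) = v$1 *\<^sub>R sph_normal (w$2) (w$3)"
    using eq' 1 by metis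
  then have n: "sph_normal (v$2) (v$3) = sph_normal (w$2) (w$3)"
    using pos by simp
  have "cos (v$2) = cos (w$2)"
    using arg_cong[OF n, of "\<lambda>x. x$3"] by (simp only: sph_normal_def vector_3)
  then have 2: "v$2 = w$2"
    using v w unfolding mem_spherical_box by (meson cos_inj_pi less_imp_le)
  have "sin (v$2) > 0"
    using v by (simp add: mem_spherical_box sin_gt_zero)
  then have "cos (v$3) = cos (w$3)" "sin (v$3) = sin (w$3)"
    using arg_cong[OF n, of "\<lambda>x. x$1"] arg_cong[OF n, of "\<lambda>x. x$2"]
    unfolding sph_normal_def vector_3 2 by simp_all
  then obtain k where k: "v$3 = w$3 + 2 * pi * of_int k"
    using sin_cos_eq_iff[of "v$3" "w$3"] by metis
  have "0 < v$3" "v$3 < 2 * pi" "0 < w$3" "w$3 < 2 * pi"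
    using v w by (simp_all add: mem_spherical_box)
  then have "\<bar>2 * pi * real_of_int k\<bar> < 2 * pi"
    using k by linarith
  then have "2 * pi * \<bar>real_of_int k\<bar> < 2 * pi * 1"
    by (simp only: abs_mult) simp
  then have "\<bar>real_of_int k\<bar> < 1"
    by (simp only: mult_less_cancel_left_pos[of "2 * pi"] pi_gt_zero zero_less_mult_iff zero_less_numeral simp_thms)
  then have "k = 0" by linarith
  then have 3: "v$3 = w$3" using k by simp
  show "v = w" using 1 2 3 by (simp add: vec_eq_iff forall_3)
qed

lemma spherical_image_sub: "spherical r ` spherical_box R \<subseteq> cball r R"
  by (auto simp: spherical_def mem_spherical_box dist_norm)

lemma cball_sub_spherical_image:
  "cball r R - spherical r ` spherical_box R \<subseteq> sphere r R \<union> {x. x$2 = r$2}"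
proof
  fix x assume x: "x \<in> cball r R - spherical r ` spherical_box R"
  show "x \<in> sphere r R \<union> {x. x$2 = r$2}"
  proof (rule ccontr)
    assume "\<not> ?thesis"
    then have y2: "x$2 - r$2 \<noteq> 0" and lt: "dist r x < R"
      using x by auto
    define y where "y = x - r"
    define \<rho> where "\<rho> = norm y"
    have \<rho>R: "\<rho> < R" using lt by (simp add: \<rho>_def y_def dist_norm norm_minus_commute)
    have y2': "y$2 \<noteq> 0" using y2 by (simp add: y_def)
    then have \<rho>0: "\<rho> > 0" by (auto simp: \<rho>_def)
    have \<rho>sq: "\<rho>\<^sup>2 = (y$1)\<^sup>2 + (y$2)\<^sup>2 + (y$3)\<^sup>2"
      by (simp add: \<rho>_def norm_vec3)
    have "0 < (y$2)\<^sup>2" using y2' by simp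
    then have "\<bar>y$3\<bar>\<^sup>2 < \<rho>\<^sup>2"
      unfolding \<rho>sq power2_abs using zero_le_power2[of "y$1"] by linarith
    then have "\<bar>y$3\<bar> < \<rho>"
      using \<rho>0 by (rule power2_less_imp_less[OF _ less_imp_le])
    then have "\<bar>y$3 / \<rho>\<bar> < 1"
      using \<rho>0 by (simp add: abs_divide)
    then have c: "-1 < y$3 / \<rho>" "y$3 / \<rho> < 1"
      by linarith+
    define \<theta> where "\<theta> = arccos (y$3 / \<rho>)"
    have \<theta>: "0 < \<theta>" "\<theta> < pi" and cos: "cos \<theta> = y$3 / \<rho>"
      using c arccos_lt_bounded[of "y$3 / \<rho>"] by (auto simp: \<theta>_def)
    have s: "sin \<theta> > 0" using \<theta> by (simp add: sin_gt_zero)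
    have y3: "y$3 = \<rho> * cos \<theta>"
      using \<rho>0 by (simp add: cos)
    have "(\<rho> * sin \<theta>)\<^sup>2 = \<rho>\<^sup>2 - (y$3)\<^sup>2"
      unfolding y3 power_mult_distrib sin_squared_eq by (simp add: algebra_simps)
    then have sq: "(\<rho> * sin \<theta>)\<^sup>2 = (y$1)\<^sup>2 + (y$2)\<^sup>2" by (simp add: \<rho>sq)
    have pos: "\<rho> * sin \<theta> > 0" using s \<rho>0 by simp
    have "(y$1 / (\<rho> * sin \<theta>))\<^sup>2 + (y$2 / (\<rho> * sin \<theta>))\<^sup>2 = ((y$1)\<^sup>2 + (y$2)\<^sup>2) / (\<rho> * sin \<theta>)\<^sup>2"
      by (simp add: power_divide add_divide_distrib)
    also have "\<dots> = 1" using pos unfolding sq[symmetric] by (metis divide_self less_irrefl zero_less_power)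
    finally obtain \<alpha> where \<alpha>: "0 \<le> \<alpha>" "\<alpha> < 2 * pi"
      and ca: "y$1 / (\<rho> * sin \<theta>) = cos \<alpha>" and sa: "y$2 / (\<rho> * sin \<theta>) = sin \<alpha>"
      by (rule sincos_total_2pi)
    have y12: "y$1 = \<rho> * sin \<theta> * cos \<alpha>" "y$2 = \<rho> * sin \<theta> * sin \<alpha>"
      unfolding ca[symmetric] sa[symmetric] using \<rho>0 s by simp_all
    have \<alpha>0: "\<alpha> \<noteq> 0" using y2' y12(2) by (metis mult_zero_right sin_zero)
    define v where "v = (vector [\<rho>, \<theta>, \<alpha>] :: real^3)"
    have "v \<in> spherical_box R"
      using \<rho>0 \<rho>R \<theta> \<alpha> \<alpha>0 by (auto simp: v_def mem_spherical_box)
    moreover have "spherical r v = x"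
    proof -
      have "y = \<rho> *\<^sub>R sph_normal \<theta> \<alpha>"
        unfolding vec_eq_iff forall_3 y12 y3 by (simp add: sph_normal_def)
      then show ?thesis by (simp add: spherical_def v_def y_def algebra_simps)
    qed
    ultimately show False using x by blast
  qed
qed

text \<open>The next lemmas move the integral over a box of \<^typ>\<open>real^3\<close> to a product, where Fubini applies.\<close>

lemma mem_cbox_vec3: "v \<in> cbox p q \<longleftrightarrow>
    p$1 \<le> v$1 \<and> v$1 \<le> q$1 \<and> p$2 \<le> v$2 \<and> v$2 \<le> q$2 \<and> p$3 \<le> v$3 \<and> v$3 \<le> q$3"
  for v :: "real^3"
  by (auto simp: mem_box_cart forall_3)

lemma vec3_collapse: "(vector [v$1, v$2, v$3] :: real^3) = v"
  by (simp add: vec_eq_iff forall_3)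

lemma triple_image_cbox:
  "(\<lambda>(a, b, c). vector [a, b, c] :: real^3) ` cbox p q =
    cbox ((\<lambda>(a, b, c). vector [a, b, c]) p) ((\<lambda>(a, b, c). vector [a, b, c]) q)"
  (is "?g ` _ = _")
proof
  obtain a b c where p: "p = (a, b, c)" by (cases p)
  obtain a' b' c' where q: "q = (a', b', c')" by (cases q)
  show "?g ` cbox p q \<subseteq> cbox (?g p) (?g q)"
    by (auto simp: p q mem_cbox_vec3 cbox_Pair_eq)
  show "cbox (?g p) (?g q) \<subseteq> ?g ` cbox p q"
  proof
    fix v assume v: "v \<in> cbox (?g p) (?g q)"
    show "v \<in> ?g ` cbox p q"
    proof
      show "v = ?g (v$1, v$2, v$3)" by (simp add: vec3_collapse)
      show "(v$1, v$2, v$3) \<in> cbox p q"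
        using v by (simp add: p q mem_cbox_vec3 cbox_Pair_eq)
    qed
  qed
qed

lemma vec3_image_cbox:
  "(\<lambda>v::real^3. (v$1, v$2, v$3)) ` cbox p q = cbox (p$1, p$2, p$3) (q$1, q$2, q$3)"
  (is "?h ` _ = _")
proof
  show "?h ` cbox p q \<subseteq> cbox (?h p) (?h q)"
    by (auto simp: mem_cbox_vec3 cbox_Pair_eq)
  show "cbox (?h p) (?h q) \<subseteq> ?h ` cbox p q"
  proof
    fix x assume x: "x \<in> cbox (?h p) (?h q)"
    obtain a b c where abc: "x = (a, b, c)" by (cases x)
    show "x \<in> ?h ` cbox p q"
    proof
      show "x = ?h (vector [a, b, c])" by (simp add: abc)
      show "vector [a, b, c] \<in> cbox p q"
        using x by (simp add: abc mem_cbox_vec3 cbox_Pair_eq)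
    qed
  qed
qed

lemma content_triple_image:
  "measure lborel ((\<lambda>(a, b, c). vector [a, b, c] :: real^3) ` cbox p q) = measure lborel (cbox p q)"
proof -
  obtain a b c where p: "p = (a, b, c)" by (cases p)
  obtain a' b' c' where q: "q = (a', b', c')" by (cases q)
  have "cbox (vector [a, b, c] :: real^3) (vector [a', b', c']) \<noteq> {} \<longleftrightarrow> a \<le> a' \<and> b \<le> b' \<and> c \<le> c'"
    by (simp add: interval_ne_empty_cart forall_3)
  then have "cbox (vector [a, b, c] :: real^3) (vector [a', b', c']) = {} \<longleftrightarrow> \<not> (a \<le> a' \<and> b \<le> b' \<and> c \<le> c')"
    by blast
  then have "measure lborel (cbox (vector [a, b, c] :: real^3) (vector [a', b', c'])) =
      (if a \<le> a' \<and> b \<le> b' \<and> c \<le> c' then (a' - a) * ((b' - b) * (c' - c)) else 0)"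
    unfolding content_cbox_if_cart UNIV_3 by (simp add: prod.insert_if)
  moreover have "measure lborel (cbox p q) =
      (if a \<le> a' \<and> b \<le> b' \<and> c \<le> c' then (a' - a) * ((b' - b) * (c' - c)) else 0)"
    by (simp add: p q content_Pair)
  ultimately show ?thesis
    by (simp only: triple_image_cbox p q prod.case)
qed

lemma has_integral_triple_of_vec3:
  fixes u :: "real^3 \<Rightarrow> real"
  assumes "(u has_integral I) (cbox p q)"
  shows "((\<lambda>x. u ((\<lambda>(a, b, c). vector [a, b, c]) x)) has_integral I)
    (cbox (p$1, p$2, p$3) (q$1, q$2, q$3))"
proof -
  let ?g = "\<lambda>(a, b, c). vector [a, b, c] :: real^3"
  let ?h = "\<lambda>v::real^3. (v$1, v$2, v$3)"
  have "continuous_on UNIV (\<lambda>p::real \<times> real \<times> real.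
      fst p *\<^sub>R axis 1 1 + fst (snd p) *\<^sub>R axis 2 1 + snd (snd p) *\<^sub>R axis 3 1 :: real^3)"
    by (intro continuous_intros)
  moreover have "(\<lambda>p. fst p *\<^sub>R axis 1 1 + fst (snd p) *\<^sub>R axis 2 1 + snd (snd p) *\<^sub>R axis 3 1) = ?g"
    by (simp add: fun_eq_iff vector3_eq_axis_sum)
  ultimately have "continuous_on UNIV ?g"
    by (simp only:)
  then have 1: "continuous (at x) ?g" for x
    using continuous_on_eq_continuous_at[OF open_UNIV] by blast
  have 2: "?h (?g x) = x" for x by (cases x) simp
  have 3: "?g (?h x) = x" for x by (simp add: vec3_collapse)
  have 4: "\<exists>w z. ?g ` cbox p q = cbox w z" for p q by (intro exI, rule triple_image_cbox)
  have 5: "\<exists>w z. ?h ` cbox p q = cbox w z" for p q by (intro exI, rule vec3_image_cbox)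
  have 6: "measure lborel (?g ` cbox p q) = 1 * measure lborel (cbox p q)" for p q
    by (simp only: content_triple_image mult_1)
  have "((\<lambda>x. u (?g x)) has_integral (1 / 1) *\<^sub>R I) (?h ` cbox p q)"
    by (rule has_integral_twiddle[where g="?g" and h="?h" and r=1 and f=u and i=I and a=p and b=q,
          OF zero_less_one 2 3 1 4 5 6 assms])
  then show ?thesis
    by (simp add: vec3_image_cbox)
qed

text \<open>Integration over a ball in spherical coordinates.\<close>

lemma ball_integral_eq:
  fixes f :: "real^3 \<Rightarrow> real"
  assumes "0 < R" and f: "continuous_on (cball r R) f"
  shows "(LINT x:cball r R|lborel. f x) = integral (cbox (0, 0, 0) (R, pi, 2 * pi))
    (\<lambda>(\<rho>, \<theta>, \<alpha>). \<rho>\<^sup>2 * sin \<theta> * f (r + \<rho> *\<^sub>R sph_normal \<theta> \<alpha>))"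
proof -
  define S where "S = spherical_box R"
  define W where "W = spherical r ` S"
  \<comment> \<open>the change of variables formula takes integrands with values in a vector type\<close>
  define F where "F x = (vec (f x) :: real^1)" for x
  define K where "K = cbox 0 (vector [R, pi, 2 * pi] :: real^3)"
  define u where "u = (\<lambda>v::real^3. (v$1)\<^sup>2 * sin (v$2) * f (spherical r v))"
  have W_sub: "W \<subseteq> cball r R"
    unfolding W_def S_def by (rule spherical_image_sub)
  have neg: "negligible (cball r R - W)"
  proof (rule negligible_subset)
    show "cball r R - W \<subseteq> sphere r R \<union> {x. x$2 = r$2}"
      unfolding W_def S_def by (rule cball_sub_spherical_image)
    show "negligible (sphere r R \<union> {x. x$2 = r$2})"
      using negligible_standard_hyperplane[of "axis 2 1 :: real^3" "r$2"]
      by (intro negligible_Un negligible_sphere) (simp_all add: inner_axis)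
  qed
  have spherical_mem: "spherical r v \<in> cball r R" if "v \<in> K" for v
    using that by (auto simp: K_def mem_box_cart forall_3 spherical_def dist_norm)
  have cu: "continuous_on K u"
    unfolding u_def
    by (intro continuous_intros continuous_on_compose2[OF f])
       (auto simp: spherical_mem[unfolded mem_cball] intro!: has_derivative_continuous_on[where f'="spherical_deriv"]
         has_derivative_spherical)
  have abs: "u absolutely_integrable_on K"
    using cu unfolding K_def by (rule absolutely_integrable_continuous)
  have SK: "S \<subseteq> K" by (simp add: S_def K_def spherical_box_def box_subset_cbox)
  have nonneg: "0 \<le> (v$1)\<^sup>2 * sin (v$2)" if "v \<in> S" for v
    using that by (auto simp: S_def mem_spherical_box intro!: mult_nonneg_nonneg sin_ge_zero)
  have S_meas: "S \<in> sets lebesgue" by (auto simp: S_def spherical_box_def)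
  have eqK: "integral S u = integral K u"
    unfolding S_def spherical_box_def K_def by (rule integral_open_interval)
  have int_S: "(\<lambda>v. \<bar>det (matrix (spherical_deriv v))\<bar> *\<^sub>R F (spherical r v)) absolutely_integrable_on S \<and>
      integral S (\<lambda>v. \<bar>det (matrix (spherical_deriv v))\<bar> *\<^sub>R F (spherical r v)) = vec (integral K u)"
  proof -
    have e: "\<bar>det (matrix (spherical_deriv v))\<bar> *\<^sub>R F (spherical r v) = vec (u v)" if "v \<in> S" for v
      using nonneg[OF that] by (simp add: det_spherical_deriv F_def u_def vec_eq_iff)
    have u_S: "u absolutely_integrable_on S"
      by (rule set_integrable_subset[OF abs S_meas SK])
    have blv: "bounded_linear (vec :: real \<Rightarrow> real^1)"
      by (intro bounded_linear_intro[where K=1]) (auto simp: vec_eq_iff norm_vec_def L2_set_def)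
    have "(\<lambda>v. vec (u v) :: real^1) absolutely_integrable_on S"
      using absolutely_integrable_linear[OF u_S blv] by (simp add: o_def)
    moreover have "integral S (\<lambda>v. vec (u v) :: real^1) = vec (integral S u)"
      using integral_linear[OF _ blv, of u S] u_S
      by (simp add: o_def absolutely_integrable_on_def)
    moreover have "(\<lambda>v. \<bar>det (matrix (spherical_deriv v))\<bar> *\<^sub>R F (spherical r v)) absolutely_integrable_on S
        \<longleftrightarrow> (\<lambda>v. vec (u v) :: real^1) absolutely_integrable_on S"
      by (rule set_integrable_cong[OF refl refl e])
    moreover have "integral S (\<lambda>v. \<bar>det (matrix (spherical_deriv v))\<bar> *\<^sub>R F (spherical r v))
        = integral S (\<lambda>v. vec (u v) :: real^1)"
      by (rule integral_cong[OF e])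
    ultimately show ?thesis
      by (simp add: eqK)
  qed
  have "F absolutely_integrable_on W \<and> integral W F = vec (integral K u)"
    using has_absolute_integral_change_of_variables[of S "spherical r" spherical_deriv F "vec (integral K u)"]
      S_meas has_derivative_spherical inj_on_spherical int_S
    unfolding W_def S_def by blast
  then have WF: "F integrable_on W" "integral W F = vec (integral K u)"
    by (auto simp: absolutely_integrable_on_def)
  have "integral W f = integral K u"
  proof -
    have "integral W (\<lambda>x. F x $ 1) = integral W F $ 1"
      using integral_linear[OF WF(1) bounded_linear_vec_nth[of 1]] by (simp add: o_def)
    then show ?thesis using WF by (simp add: F_def)
  qed
  moreover have "integral (cball r R) f = integral W f"
  proof (rule integral_spike_set)
    show "negligible {x \<in> cball r R - W. f x \<noteq> 0}"
      by (rule negligible_subset[OF neg]) auto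
    have "{x \<in> W - cball r R. f x \<noteq> 0} = {}" using W_sub by blast
    then show "negligible {x \<in> W - cball r R. f x \<noteq> 0}" by (simp only: negligible_empty)
  qed
  moreover have "integral K u = integral (cbox (0, 0, 0) (R, pi, 2 * pi))
    (\<lambda>(\<rho>, \<theta>, \<alpha>). \<rho>\<^sup>2 * sin \<theta> * f (r + \<rho> *\<^sub>R sph_normal \<theta> \<alpha>))"
  proof -
    let ?g = "\<lambda>(a, b, c). vector [a, b, c] :: real^3"
    have "(u has_integral integral K u) (cbox 0 (vector [R, pi, 2 * pi]))"
      using cu unfolding K_def by (intro integrable_integral integrable_continuous)
    then have "((\<lambda>x. u (?g x)) has_integral integral K u) (cbox (0, 0, 0) (R, pi, 2 * pi))"
      using has_integral_triple_of_vec3[of u "integral K u" 0 "vector [R, pi, 2 * pi]"]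
      by (simp only: vector_3 zero_index)
    then have "integral K u = integral (cbox (0, 0, 0) (R, pi, 2 * pi)) (\<lambda>x. u (?g x))"
      by (rule integral_unique[THEN sym])
    also have "(\<lambda>x. u (?g x)) = (\<lambda>(\<rho>, \<theta>, \<alpha>). \<rho>\<^sup>2 * sin \<theta> * f (r + \<rho> *\<^sub>R sph_normal \<theta> \<alpha>))"
      by (auto simp: u_def spherical_def)
    finally show ?thesis .
  qed
  ultimately show ?thesis
    using set_integral_compact_eq_integral[OF compact_cball f] by simp
qed

section \<open>The divergence theorem on a ball\<close>

text \<open>The unit vectors in direction of growing \<open>\<theta>\<close> and of growing \<open>\<alpha>\<close>, and the horizontal radial
  unit vector, which is minus the derivative of the second one.\<close>

definition polar_tangent :: "real \<Rightarrow> real \<Rightarrow> real^3" where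
  "polar_tangent \<theta> \<alpha> = vector [cos \<theta> * cos \<alpha>, cos \<theta> * sin \<alpha>, - sin \<theta>]"

definition azimuth_tangent :: "real \<Rightarrow> real^3" where
  "azimuth_tangent \<alpha> = vector [- sin \<alpha>, cos \<alpha>, 0]"

definition azimuth_radial :: "real \<Rightarrow> real^3" where
  "azimuth_radial \<alpha> = vector [cos \<alpha>, sin \<alpha>, 0]"

lemma continuous_on_tangents [continuous_intros]:
  fixes S :: "'a::metric_space set"
  assumes "continuous_on S f" "continuous_on S g"
  shows "continuous_on S (\<lambda>x. polar_tangent (f x) (g x))"
    and "continuous_on S (\<lambda>x. azimuth_tangent (g x))"
    and "continuous_on S (\<lambda>x. azimuth_radial (g x))"
  unfolding polar_tangent_def azimuth_tangent_def azimuth_radial_def vector3_eq_axis_sum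
  by (intro continuous_intros assms)+

lemma has_vector_derivative_vec3:
  assumes "(f has_real_derivative f') F" "(g has_real_derivative g') F" "(h has_real_derivative h') F"
  shows "((\<lambda>x. vector [f x, g x, h x] :: real^3) has_vector_derivative vector [f', g', h']) F"
proof -
  have "((\<lambda>x. f x *\<^sub>R axis 1 1 + g x *\<^sub>R axis 2 1 + h x *\<^sub>R axis 3 1 :: real^3)
      has_vector_derivative f' *\<^sub>R axis 1 1 + g' *\<^sub>R axis 2 1 + h' *\<^sub>R axis 3 1) F"
    using assms[unfolded has_real_derivative_iff_has_vector_derivative]
    by (intro has_vector_derivative_add
        bounded_linear.has_vector_derivative[OF bounded_linear_scaleR_left])
  then show ?thesis
    by (simp only: vector3_eq_axis_sum)
qed

lemma sph_normal_polar_derivative: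
  "((\<lambda>\<theta>. sph_normal \<theta> \<alpha>) has_vector_derivative polar_tangent \<theta> \<alpha>) (at \<theta> within S)"
  unfolding sph_normal_def polar_tangent_def
  by (auto intro!: has_vector_derivative_vec3 derivative_eq_intros)

lemma polar_tangent_polar_derivative:
  "((\<lambda>\<theta>. polar_tangent \<theta> \<alpha>) has_vector_derivative - sph_normal \<theta> \<alpha>) (at \<theta> within S)"
proof -
  have "((\<lambda>\<theta>. polar_tangent \<theta> \<alpha>) has_vector_derivative
      vector [- sin \<theta> * cos \<alpha>, - sin \<theta> * sin \<alpha>, - cos \<theta>]) (at \<theta> within S)"
    unfolding polar_tangent_def
    by (auto intro!: has_vector_derivative_vec3 derivative_eq_intros)
  moreover have "(vector [- sin \<theta> * cos \<alpha>, - sin \<theta> * sin \<alpha>, - cos \<theta>] :: real^3) = - sph_normal \<theta> \<alpha>"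
    by (simp add: sph_normal_def vec_eq_iff forall_3)
  ultimately show ?thesis by simp
qed

lemma sph_normal_azimuth_derivative:
  "((\<lambda>\<alpha>. sph_normal \<theta> \<alpha>) has_vector_derivative sin \<theta> *\<^sub>R azimuth_tangent \<alpha>) (at \<alpha> within S)"
proof -
  have "((\<lambda>\<alpha>. sph_normal \<theta> \<alpha>) has_vector_derivative
      vector [sin \<theta> * - sin \<alpha>, sin \<theta> * cos \<alpha>, 0]) (at \<alpha> within S)"
    unfolding sph_normal_def
    by (auto intro!: has_vector_derivative_vec3 derivative_eq_intros)
  moreover have "(vector [sin \<theta> * - sin \<alpha>, sin \<theta> * cos \<alpha>, 0] :: real^3) = sin \<theta> *\<^sub>R azimuth_tangent \<alpha>"
    by (simp add: azimuth_tangent_def vec_eq_iff forall_3)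
  ultimately show ?thesis by simp
qed

lemma azimuth_tangent_derivative:
  "(azimuth_tangent has_vector_derivative - azimuth_radial \<alpha>) (at \<alpha> within S)"
proof -
  have "((\<lambda>\<alpha>. azimuth_tangent \<alpha>) has_vector_derivative vector [- cos \<alpha>, - sin \<alpha>, 0]) (at \<alpha> within S)"
    unfolding azimuth_tangent_def
    by (auto intro!: has_vector_derivative_vec3 derivative_eq_intros)
  moreover have "(vector [- cos \<alpha>, - sin \<alpha>, 0] :: real^3) = - azimuth_radial \<alpha>"
    by (simp add: azimuth_radial_def vec_eq_iff forall_3)
  ultimately show ?thesis by simp
qed

lemma has_vector_derivative_nth:
  fixes f :: "real \<Rightarrow> real^'n"
  assumes "(f has_vector_derivative f') F"
  shows "((\<lambda>x. f x $ i) has_real_derivative f' $ i) F"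
  using bounded_linear.has_vector_derivative[OF bounded_linear_vec_nth assms]
  by (simp add: has_real_derivative_iff_has_vector_derivative)

lemma has_real_derivative_along_curve:
  fixes f :: "'a::real_inner \<Rightarrow> real"
  assumes "(f has_derivative (\<lambda>h. d \<bullet> h)) (at (\<gamma> s))"
    and "(\<gamma> has_vector_derivative w) (at s within S)"
  shows "((\<lambda>s. f (\<gamma> s)) has_real_derivative d \<bullet> w) (at s within S)"
proof -
  have "((\<lambda>s. f (\<gamma> s)) has_derivative (\<lambda>x. d \<bullet> (x *\<^sub>R w))) (at s within S)"
    using assms(2) unfolding has_vector_derivative_def
    by (rule has_derivative_compose[where f=\<gamma> and x=s and g=f and g'="\<lambda>h. d \<bullet> h", OF _ assms(1)])
  then show ?thesis
    by (simp add: has_field_derivative_def mult_commute_abs)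
qed

text \<open>The component \<open>d $ i\<close> of a gradient, times the Jacobian, as the sum of the derivatives by radius, polar
  angle and azimuth of the three functions that are differentiated in the next proof. Here \<open>f\<close> and \<open>d\<close>
  stand for the values of a function and of its gradient. The terms with \<open>f\<close> cancel, and those with
  \<open>d\<close> combine since the three unit vectors are orthonormal.\<close>

lemma spherical_divergence_identity:
  fixes d :: "real^3"
  shows "\<rho>\<^sup>2 * sin \<theta> * d $ i =
     (2 * \<rho> * sin \<theta> * sph_normal \<theta> \<alpha> $ i * f + \<rho>\<^sup>2 * sin \<theta> * sph_normal \<theta> \<alpha> $ i * (d \<bullet> sph_normal \<theta> \<alpha>))
   + (\<rho> * (cos \<theta> * polar_tangent \<theta> \<alpha> $ i - sin \<theta> * sph_normal \<theta> \<alpha> $ i) * f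
        + \<rho> * (sin \<theta> * polar_tangent \<theta> \<alpha> $ i) * (d \<bullet> (\<rho> *\<^sub>R polar_tangent \<theta> \<alpha>)))
   + (- \<rho> * azimuth_radial \<alpha> $ i * f
        + \<rho> * azimuth_tangent \<alpha> $ i * (d \<bullet> (\<rho> *\<^sub>R sin \<theta> *\<^sub>R azimuth_tangent \<alpha>)))"
proof -
  have a: "sin \<theta> * sin \<theta> + cos \<theta> * cos \<theta> = 1" and b: "sin \<alpha> * sin \<alpha> + cos \<alpha> * cos \<alpha> = 1"
    by (simp_all flip: power2_eq_square)
  consider "i = 1" | "i = 2" | "i = 3" using exhaust_3 by blast
  then show ?thesis
  proof cases
    case 1
    show ?thesis
      unfolding 1 sph_normal_def polar_tangent_def azimuth_tangent_def azimuth_radial_def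
        inner_vec_def sum_3 vector_3 vector_scaleR_component inner_real_def power2_eq_square real_scaleR_def
      using a b by algebra
  next
    case 2
    show ?thesis
      unfolding 2 sph_normal_def polar_tangent_def azimuth_tangent_def azimuth_radial_def
        inner_vec_def sum_3 vector_3 vector_scaleR_component inner_real_def power2_eq_square real_scaleR_def
      using a b by algebra
  next
    case 3
    show ?thesis
      unfolding 3 sph_normal_def polar_tangent_def azimuth_tangent_def azimuth_radial_def
        inner_vec_def sum_3 vector_3 vector_scaleR_component inner_real_def power2_eq_square real_scaleR_def
      using a b by algebra
  qed
qed


text \<open>In spherical coordinates the integrand is a sum of three derivatives. By Fubini and the fundamental
  theorem of calculus the one by radius leaves the integral over the sphere, the one by polar angle
  vanishes because of the factor \<open>sin \<theta>\<close>, the one by azimuth by periodicity.\<close>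

lemma divergence_theorem_ball_component:
  fixes f :: "real^3 \<Rightarrow> real" and D :: "real^3 \<Rightarrow> real^3"
  assumes R: "0 < R" and f: "continuous_on (cball r R) f" and D: "continuous_on (cball r R) D"
    and der: "\<And>x. x \<in> ball r R \<Longrightarrow> (f has_derivative (\<lambda>h. D x \<bullet> h)) (at x)"
  shows "(LINT x:cball r R|lborel. D x $ i) = (LINT x|sphere_measure r R. ((1 / R) *\<^sub>R (x - r)) $ i * f x)"
proof -
  let ?N = sph_normal and ?P = polar_tangent and ?A = azimuth_tangent and ?E = azimuth_radial
  define g where "g \<rho> \<theta> \<alpha> = r + \<rho> *\<^sub>R ?N \<theta> \<alpha>" for \<rho> \<theta> \<alpha>
  define u where "u \<rho> \<theta> \<alpha> = 2 * \<rho> * sin \<theta> * ?N \<theta> \<alpha> $ i * f (g \<rho> \<theta> \<alpha>)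
      + \<rho>\<^sup>2 * sin \<theta> * ?N \<theta> \<alpha> $ i * (D (g \<rho> \<theta> \<alpha>) \<bullet> ?N \<theta> \<alpha>)" for \<rho> \<theta> \<alpha>
  define v where "v \<rho> \<theta> \<alpha> = \<rho> * (cos \<theta> * ?P \<theta> \<alpha> $ i - sin \<theta> * ?N \<theta> \<alpha> $ i) * f (g \<rho> \<theta> \<alpha>)
      + \<rho> * (sin \<theta> * ?P \<theta> \<alpha> $ i) * (D (g \<rho> \<theta> \<alpha>) \<bullet> (\<rho> *\<^sub>R ?P \<theta> \<alpha>))" for \<rho> \<theta> \<alpha>
  define w where "w \<rho> \<theta> \<alpha> = - \<rho> * ?E \<alpha> $ i * f (g \<rho> \<theta> \<alpha>)
      + \<rho> * ?A \<alpha> $ i * (D (g \<rho> \<theta> \<alpha>) \<bullet> (\<rho> *\<^sub>R sin \<theta> *\<^sub>R ?A \<alpha>))" for \<rho> \<theta> \<alpha>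
  let ?Q = "cbox (0, 0) (pi, 2 * pi) :: (real \<times> real) set"
  let ?K = "cbox (0, 0, 0) (R, pi, 2 * pi) :: (real \<times> real \<times> real) set"
  let ?c3 = "\<lambda>h (p :: real \<times> real \<times> real). h (fst p) (fst (snd p)) (snd (snd p)) :: real"
  have g_cball: "g \<rho> \<theta> \<alpha> \<in> cball r R" if "0 \<le> \<rho>" "\<rho> \<le> R" for \<rho> \<theta> \<alpha>
    using that by (simp add: g_def dist_norm)
  have g_ball: "g \<rho> \<theta> \<alpha> \<in> ball r R" if "0 \<le> \<rho>" "\<rho> < R" for \<rho> \<theta> \<alpha>
    using that by (simp add: g_def dist_norm)
  have cg: "continuous_on S (\<lambda>x. g (a x) (b x) (c x))"
    if "continuous_on S a" "continuous_on S b" "continuous_on S c" for S :: "'z::metric_space set" and a b c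
    unfolding g_def by (intro continuous_intros that)
  have cf: "continuous_on S (\<lambda>x. f (g (a x) (b x) (c x)))"
    if "continuous_on S a" "continuous_on S b" "continuous_on S c" "\<And>x. x \<in> S \<Longrightarrow> 0 \<le> a x \<and> a x \<le> R"
    for S :: "'z::metric_space set" and a b c
    using that g_cball by (intro continuous_on_compose2[OF f] cg) auto
  have cD: "continuous_on S (\<lambda>x. D (g (a x) (b x) (c x)))"
    if "continuous_on S a" "continuous_on S b" "continuous_on S c" "\<And>x. x \<in> S \<Longrightarrow> 0 \<le> a x \<and> a x \<le> R"
    for S :: "'z::metric_space set" and a b c
    using that g_cball by (intro continuous_on_compose2[OF D] cg) auto
  have cuvw: "continuous_on S (\<lambda>x. u (a x) (b x) (c x))" "continuous_on S (\<lambda>x. v (a x) (b x) (c x))"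
      "continuous_on S (\<lambda>x. w (a x) (b x) (c x))"
    if "continuous_on S a" "continuous_on S b" "continuous_on S c" "\<And>x. x \<in> S \<Longrightarrow> 0 \<le> a x \<and> a x \<le> R"
    for S :: "'z::metric_space set" and a b c
  proof -
    show "continuous_on S (\<lambda>x. u (a x) (b x) (c x))"
      unfolding u_def by (intro continuous_intros cf cD that(1-3)) (use that(4) in auto)
    show "continuous_on S (\<lambda>x. v (a x) (b x) (c x))"
      unfolding v_def by (intro continuous_intros cf cD that(1-3)) (use that(4) in auto)
    show "continuous_on S (\<lambda>x. w (a x) (b x) (c x))"
      unfolding w_def by (intro continuous_intros cf cD that(1-3)) (use that(4) in auto)
  qed
  note c3 = cuvw[of ?K fst "\<lambda>p. fst (snd p)" "\<lambda>p. snd (snd p)"]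
  have K_bd: "0 \<le> fst p \<and> fst p \<le> R" if "p \<in> ?K" for p
    using that by (cases p) (auto simp: cbox_Pair_eq)
  have cu3: "continuous_on ?K (?c3 u)"
   and cv3: "continuous_on ?K (?c3 v)"
   and cw3: "continuous_on ?K (?c3 w)"
    using K_bd by (auto intro!: c3 continuous_intros)
  have dg: "(f has_derivative (\<lambda>h. D (g \<rho> \<theta> \<alpha>) \<bullet> h)) (at (g \<rho> \<theta> \<alpha>))"
    if "0 \<le> \<rho>" "\<rho> < R" for \<rho> \<theta> \<alpha>
    using der g_ball[OF that] by blast
  have LHS: "(LINT x:cball r R|lborel. D x $ i) = integral ?K (?c3 u)
      + integral ?K (?c3 v)
      + integral ?K (?c3 w)"
  proof -
    have "(LINT x:cball r R|lborel. D x $ i) =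
        integral ?K (\<lambda>(\<rho>, \<theta>, \<alpha>). \<rho>\<^sup>2 * sin \<theta> * D (r + \<rho> *\<^sub>R ?N \<theta> \<alpha>) $ i)"
      by (intro ball_integral_eq R continuous_on_component D)
    also have "\<dots> = integral ?K (\<lambda>p. u (fst p) (fst (snd p)) (snd (snd p))
        + v (fst p) (fst (snd p)) (snd (snd p)) + w (fst p) (fst (snd p)) (snd (snd p)))"
    proof -
      have "\<rho>\<^sup>2 * sin \<theta> * D (r + \<rho> *\<^sub>R ?N \<theta> \<alpha>) $ i = u \<rho> \<theta> \<alpha> + v \<rho> \<theta> \<alpha> + w \<rho> \<theta> \<alpha>" for \<rho> \<theta> \<alpha>
        unfolding u_def v_def w_def g_def by (rule spherical_divergence_identity)
      then show ?thesis
        by (simp only: case_prod_unfold)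
    qed
    also have "\<dots> = integral ?K (?c3 u)
      + integral ?K (?c3 v)
      + integral ?K (?c3 w)"
      using cu3 cv3 cw3
      by (simp only: Henstock_Kurzweil_Integration.integral_add integrable_continuous integrable_add)
    finally show ?thesis .
  qed
  have U: "integral ?K (?c3 u) =
      integral ?Q (\<lambda>q. R\<^sup>2 * sin (fst q) * ?N (fst q) (snd q) $ i * f (g R (fst q) (snd q)))"
  proof -
    have "integral ?K (?c3 u) =
        integral (cbox 0 R) (\<lambda>\<rho>. integral ?Q (\<lambda>q. u \<rho> (fst q) (snd q)))"
      using integral_prod_continuous[OF cu3] by simp
    also have "\<dots> = integral ?Q (\<lambda>q. integral (cbox 0 R) (\<lambda>\<rho>. u \<rho> (fst q) (snd q)))"
      using cu3 by (intro integral_swap_continuous) (simp add: case_prod_unfold)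
    also have "\<dots> = integral ?Q (\<lambda>q. R\<^sup>2 * sin (fst q) * ?N (fst q) (snd q) $ i * f (g R (fst q) (snd q)))"
    proof (rule integral_cong)
      fix q :: "real \<times> real"
      define \<theta> \<alpha> where "\<theta> = fst q" and "\<alpha> = snd q"
      define F where "F \<rho> = \<rho>\<^sup>2 * (sin \<theta> * ?N \<theta> \<alpha> $ i) * f (g \<rho> \<theta> \<alpha>)" for \<rho>
      have "((\<lambda>\<rho>. u \<rho> \<theta> \<alpha>) has_integral (F R - F 0)) {0..R}"
      proof (rule fundamental_theorem_of_calculus_interior)
        show "continuous_on {0..R} F"
          unfolding F_def by (intro continuous_intros cf) auto
        fix \<rho> assume \<rho>: "\<rho> \<in> {0<..<R}"
        have "((\<lambda>\<rho>. g \<rho> \<theta> \<alpha>) has_vector_derivative ?N \<theta> \<alpha>) (at \<rho>)"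
          unfolding g_def has_vector_derivative_def by (auto intro!: derivative_eq_intros)
        then have "((\<lambda>\<rho>. f (g \<rho> \<theta> \<alpha>)) has_real_derivative D (g \<rho> \<theta> \<alpha>) \<bullet> ?N \<theta> \<alpha>) (at \<rho>)"
          using \<rho> dg by (intro has_real_derivative_along_curve) auto
        then have "(F has_real_derivative u \<rho> \<theta> \<alpha>) (at \<rho>)"
          unfolding F_def u_def by (auto intro!: derivative_eq_intros simp: power2_eq_square algebra_simps)
        then show "(F has_vector_derivative u \<rho> \<theta> \<alpha>) (at \<rho>)"
          by (simp add: has_real_derivative_iff_has_vector_derivative)
      qed (use R in simp)
      then show "integral (cbox 0 R) (\<lambda>\<rho>. u \<rho> (fst q) (snd q)) =
          R\<^sup>2 * sin (fst q) * ?N (fst q) (snd q) $ i * f (g R (fst q) (snd q))"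
        by (simp add: \<theta>_def \<alpha>_def F_def integral_unique)
    qed
    finally show ?thesis .
  qed
  have zero_if: "integral ?K (?c3 h) = 0"
    if "continuous_on ?K (?c3 h)"
      and z: "\<And>\<rho>. 0 \<le> \<rho> \<Longrightarrow> \<rho> < R \<Longrightarrow> integral ?Q (\<lambda>q. h \<rho> (fst q) (snd q)) = 0"
    for h :: "real \<Rightarrow> real \<Rightarrow> real \<Rightarrow> real"
  proof -
    have "integral ?K (?c3 h) =
        integral (cbox 0 R) (\<lambda>\<rho>. integral ?Q (\<lambda>q. h \<rho> (fst q) (snd q)))"
      using integral_prod_continuous[OF that(1)] by simp
    \<comment> \<open>the premise leaves out radius \<open>R\<close>, but a single radius does not matter\<close>
    also have "\<dots> = integral (cbox 0 R) (\<lambda>\<rho>. 0)"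
      by (rule integral_spike[of "{R}"]) (auto simp: z)
    finally show ?thesis by simp
  qed
  have V: "integral ?K (?c3 v) = 0"
  proof (rule zero_if[OF cv3])
    fix \<rho> assume \<rho>: "0 \<le> \<rho>" "\<rho> < R"
    have c: "continuous_on ?Q (\<lambda>q. v \<rho> (fst q) (snd q))"
      by (intro cuvw continuous_intros) (use \<rho> in auto)
    have "integral ?Q (\<lambda>q. v \<rho> (fst q) (snd q)) =
        integral (cbox 0 pi) (\<lambda>\<theta>. integral (cbox 0 (2 * pi)) (\<lambda>\<alpha>. v \<rho> \<theta> \<alpha>))"
      using integral_prod_continuous[OF c] by simp
    also have "\<dots> = integral (cbox 0 (2 * pi)) (\<lambda>\<alpha>. integral (cbox 0 pi) (\<lambda>\<theta>. v \<rho> \<theta> \<alpha>))"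
      using c by (intro integral_swap_continuous) (simp add: case_prod_unfold)
    also have "\<dots> = integral (cbox 0 (2 * pi)) (\<lambda>\<alpha>. 0)"
    proof (rule integral_cong)
      fix \<alpha>
      define F where "F \<theta> = \<rho> * (sin \<theta> * ?P \<theta> \<alpha> $ i) * f (g \<rho> \<theta> \<alpha>)" for \<theta>
      have "((\<lambda>\<theta>. v \<rho> \<theta> \<alpha>) has_integral (F pi - F 0)) {0..pi}"
      proof (rule fundamental_theorem_of_calculus)
        fix \<theta>
        have "((\<lambda>\<theta>. g \<rho> \<theta> \<alpha>) has_vector_derivative \<rho> *\<^sub>R ?P \<theta> \<alpha>) (at \<theta> within {0..pi})"
          using has_vector_derivative_add[OF has_vector_derivative_const
            bounded_linear.has_vector_derivative[OF bounded_linear_scaleR_right sph_normal_polar_derivative], of r]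
          unfolding g_def add_0_left .
        then have *: "((\<lambda>\<theta>. f (g \<rho> \<theta> \<alpha>)) has_real_derivative D (g \<rho> \<theta> \<alpha>) \<bullet> (\<rho> *\<^sub>R ?P \<theta> \<alpha>)) (at \<theta> within {0..pi})"
          by (rule has_real_derivative_along_curve[where \<gamma>="\<lambda>\<theta>. g \<rho> \<theta> \<alpha>", OF dg[OF \<rho>]])
        have "(F has_real_derivative v \<rho> \<theta> \<alpha>) (at \<theta> within {0..pi})"
          unfolding F_def v_def
          by (rule derivative_eq_intros * has_vector_derivative_nth[OF polar_tangent_polar_derivative] refl | simp add: algebra_simps)+
        then show "(F has_vector_derivative v \<rho> \<theta> \<alpha>) (at \<theta> within {0..pi})"
          by (simp add: has_real_derivative_iff_has_vector_derivative)
      qed simp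
      then show "integral (cbox 0 pi) (\<lambda>\<theta>. v \<rho> \<theta> \<alpha>) = 0"
        by (simp add: F_def integral_unique)
    qed
    finally show "integral ?Q (\<lambda>q. v \<rho> (fst q) (snd q)) = 0" by simp
  qed
  have W: "integral ?K (?c3 w) = 0"
  proof (rule zero_if[OF cw3])
    fix \<rho> assume \<rho>: "0 \<le> \<rho>" "\<rho> < R"
    have c: "continuous_on ?Q (\<lambda>q. w \<rho> (fst q) (snd q))"
      by (intro cuvw continuous_intros) (use \<rho> in auto)
    have "integral ?Q (\<lambda>q. w \<rho> (fst q) (snd q)) =
        integral (cbox 0 pi) (\<lambda>\<theta>. integral (cbox 0 (2 * pi)) (\<lambda>\<alpha>. w \<rho> \<theta> \<alpha>))"
      using integral_prod_continuous[OF c] by simp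
    also have "\<dots> = integral (cbox 0 pi) (\<lambda>\<theta>. 0)"
    proof (rule integral_cong)
      fix \<theta>
      define F where "F \<alpha> = \<rho> * ?A \<alpha> $ i * f (g \<rho> \<theta> \<alpha>)" for \<alpha>
      have "((\<lambda>\<alpha>. w \<rho> \<theta> \<alpha>) has_integral (F (2 * pi) - F 0)) {0..2 * pi}"
      proof (rule fundamental_theorem_of_calculus)
        fix \<alpha>
        have "((\<lambda>\<alpha>. g \<rho> \<theta> \<alpha>) has_vector_derivative \<rho> *\<^sub>R sin \<theta> *\<^sub>R ?A \<alpha>) (at \<alpha> within {0..2 * pi})"
          using has_vector_derivative_add[OF has_vector_derivative_const
            bounded_linear.has_vector_derivative[OF bounded_linear_scaleR_right sph_normal_azimuth_derivative], of r]
          unfolding g_def add_0_left .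
        then have *: "((\<lambda>\<alpha>. f (g \<rho> \<theta> \<alpha>)) has_real_derivative D (g \<rho> \<theta> \<alpha>) \<bullet> (\<rho> *\<^sub>R sin \<theta> *\<^sub>R ?A \<alpha>)) (at \<alpha> within {0..2 * pi})"
          by (rule has_real_derivative_along_curve[where \<gamma>="\<lambda>\<alpha>. g \<rho> \<theta> \<alpha>", OF dg[OF \<rho>]])
        have "(F has_real_derivative w \<rho> \<theta> \<alpha>) (at \<alpha> within {0..2 * pi})"
          unfolding F_def w_def
          by (rule derivative_eq_intros * has_vector_derivative_nth[OF azimuth_tangent_derivative] refl | simp add: algebra_simps)+
        then show "(F has_vector_derivative w \<rho> \<theta> \<alpha>) (at \<alpha> within {0..2 * pi})"
          by (simp add: has_real_derivative_iff_has_vector_derivative)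
      qed simp
      moreover have "F (2 * pi) = F 0"
        by (simp add: F_def g_def sph_normal_def azimuth_tangent_def)
      ultimately show "integral (cbox 0 (2 * pi)) (\<lambda>\<alpha>. w \<rho> \<theta> \<alpha>) = 0"
        by (simp add: integral_unique)
    qed
    finally show "integral ?Q (\<lambda>q. w \<rho> (fst q) (snd q)) = 0" by simp
  qed
  have "(LINT x|sphere_measure r R. ((1 / R) *\<^sub>R (x - r)) $ i * f x) =
      integral ?Q (\<lambda>(\<theta>, \<alpha>). (R\<^sup>2 * sin \<theta>) *\<^sub>R (((1 / R) *\<^sub>R (r + R *\<^sub>R ?N \<theta> \<alpha> - r)) $ i * f (r + R *\<^sub>R ?N \<theta> \<alpha>)))"
    using R by (intro sphere_integral_eq continuous_intros continuous_on_subset[OF f]) auto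
  also have "\<dots> = integral ?Q (\<lambda>q. R\<^sup>2 * sin (fst q) * ?N (fst q) (snd q) $ i * f (g R (fst q) (snd q)))"
    using R by (simp add: case_prod_unfold g_def mult.assoc)
  finally show ?thesis
    using LHS U V W by simp
qed

text \<open>The vector-valued version for a family \<open>f i\<close> in place of a vector field. Derivatives are required
  inside the ball only, but \<open>D i\<close> has to be continuous up to the sphere.\<close>

lemma divergence_theorem_ball:
  fixes f :: "3 \<Rightarrow> real^3 \<Rightarrow> 'b::euclidean_space" and D :: "3 \<Rightarrow> real^3 \<Rightarrow> real^3 \<Rightarrow> 'b"
  assumes R: "0 < R" and f: "\<And>i. continuous_on (cball r R) (f i)"
    and D: "\<And>i h. continuous_on (cball r R) (\<lambda>x. D i x h)"
    and der: "\<And>i x. x \<in> ball r R \<Longrightarrow> (f i has_derivative D i x) (at x)"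
    and lin: "\<And>i x. x \<in> cball r R \<Longrightarrow> linear (D i x)"
  shows "(LINT x:cball r R|lborel. (\<Sum>i\<in>UNIV. D i x (axis i 1))) =
    (LINT x|sphere_measure r R. (\<Sum>i\<in>UNIV. ((1 / R) *\<^sub>R (x - r)) $ i *\<^sub>R f i x))"
proof (rule euclidean_eqI)
  fix b :: 'b assume b: "b \<in> Basis"
  have comp: "(LINT x:cball r R|lborel. D i x (axis i 1) \<bullet> b) =
     (LINT x|sphere_measure r R. ((1 / R) *\<^sub>R (x - r)) $ i * (f i x \<bullet> b))" for i
  proof -
    define G where "G x = (\<chi> k. D i x (axis k 1) \<bullet> b)" for x
    have "D i x h \<bullet> b = G x \<bullet> h" if "x \<in> cball r R" for x h
    proof -
      have "D i x h = D i x (\<Sum>k\<in>UNIV. h $ k *\<^sub>R axis k 1)"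
        by (simp add: basis_expansion flip: scalar_mult_eq_scaleR)
      also have "\<dots> = (\<Sum>k\<in>UNIV. h $ k *\<^sub>R D i x (axis k 1))"
        by (simp add: linear_sum[OF lin[OF that]] linear_scale[OF lin[OF that]])
      finally show ?thesis
        by (simp add: G_def inner_vec_def inner_sum_left mult.commute)
    qed
    then have d: "((\<lambda>x. f i x \<bullet> b) has_derivative (\<lambda>h. G x \<bullet> h)) (at x)" if "x \<in> ball r R" for x
      using has_derivative_inner_left[OF der[OF that, of i], of b] that by auto
    have "continuous_on (cball r R) G"
      unfolding G_def by (intro continuous_intros D)
    then have "(LINT x:cball r R|lborel. G x $ i) =
       (LINT x|sphere_measure r R. ((1 / R) *\<^sub>R (x - r)) $ i * (f i x \<bullet> b))"
      by (intro divergence_theorem_ball_component R continuous_on_inner f continuous_on_const d)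
    then show ?thesis by (simp add: G_def)
  qed
  have cD: "continuous_on (cball r R) (\<lambda>x. D i x (axis i 1) \<bullet> b)" for i
    by (intro continuous_intros D)
  have cS: "continuous_on (sphere r R) (\<lambda>x. ((1 / R) *\<^sub>R (x - r)) $ i *\<^sub>R f i x)" for i
    using sphere_cball by (intro continuous_intros continuous_on_subset[OF f])
  have "(LINT x:cball r R|lborel. (\<Sum>i\<in>UNIV. D i x (axis i 1))) \<bullet> b =
      (LINT x:cball r R|lborel. (\<Sum>i\<in>UNIV. D i x (axis i 1)) \<bullet> b)"
  proof -
    have "continuous_on (cball r R) (\<lambda>x. \<Sum>i\<in>UNIV. D i x (axis i 1))"
      by (intro continuous_on_sum D)
    from set_integrable_compact[OF compact_cball this] show ?thesis
      unfolding set_lebesgue_integral_def set_integrable_def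
      by (subst integral_inner_left[symmetric]) simp_all
  qed
  also have "\<dots> = (\<Sum>i\<in>UNIV. LINT x:cball r R|lborel. D i x (axis i 1) \<bullet> b)"
    using set_integrable_compact[OF compact_cball cD]
    unfolding set_lebesgue_integral_def set_integrable_def inner_sum_left scaleR_sum_right
    by (intro Bochner_Integration.integral_sum) auto
  also have "\<dots> = (\<Sum>i\<in>UNIV. LINT x|sphere_measure r R. ((1 / R) *\<^sub>R (x - r)) $ i * (f i x \<bullet> b))"
    by (simp only: comp)
  also have "\<dots> = (\<Sum>i\<in>UNIV. (LINT x|sphere_measure r R. ((1 / R) *\<^sub>R (x - r)) $ i *\<^sub>R f i x) \<bullet> b)"
    using R sphere_integrable[OF _ cS]
    by (intro sum.cong refl) (simp flip: integral_inner_left)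
  also have "\<dots> = (LINT x|sphere_measure r R. (\<Sum>i\<in>UNIV. ((1 / R) *\<^sub>R (x - r)) $ i *\<^sub>R f i x)) \<bullet> b"
    using R sphere_integrable[OF _ cS]
    by (subst Bochner_Integration.integral_sum) (auto simp: inner_sum_left)
  finally show "(LINT x:cball r R|lborel. (\<Sum>i\<in>UNIV. D i x (axis i 1))) \<bullet> b =
      (LINT x|sphere_measure r R. (\<Sum>i\<in>UNIV. ((1 / R) *\<^sub>R (x - r)) $ i *\<^sub>R f i x)) \<bullet> b" .
qed

section \<open>Differential calculus on a tube\<close>

lemma has_derivative_const_zero_curve:
  fixes L :: "'a::real_normed_vector \<Rightarrow> 'b::real_normed_vector"
  assumes "((\<lambda>_. 0) has_derivative L) (at p within S)"
    and "(\<gamma> has_vector_derivative w) (at s within I)" "\<gamma> s = p" "\<gamma> ` I \<subseteq> S"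
    and "at s within I \<noteq> bot"
  shows "L w = 0"
proof -
  have "((\<lambda>_. 0) has_derivative L) (at (\<gamma> s) within \<gamma> ` I)"
    using assms by (blast intro: has_derivative_subset)
  then have "((\<lambda>_. 0) has_derivative (\<lambda>x. L (x *\<^sub>R w))) (at s within I)"
    using assms(2) has_derivative_in_compose[of \<gamma> "\<lambda>x. x *\<^sub>R w" s I "\<lambda>_. 0" L]
    by (simp add: has_vector_derivative_def)
  moreover have "L (x *\<^sub>R w) = x *\<^sub>R L w" for x
    using assms(1) by (simp add: has_derivative_bounded_linear linear_scale bounded_linear.linear)
  ultimately have "((\<lambda>_. 0) has_vector_derivative L w) (at s within I)"
    by (simp add: has_vector_derivative_def)
  then show ?thesis
    using vector_derivative_unique_within[OF assms(5)] has_vector_derivative_const by blast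
qed

text \<open>A tube of positive radius around a trajectory, with derivatives taken within the tube.\<close>

locale ball_tube =
  fixes Tm Tp :: real and rhat :: "real \<Rightarrow> real^3" and R :: real
  assumes traj: "trajectory Tm Tp rhat" and R_pos: "0 < R"
begin

abbreviation "S \<equiv> tube Tm Tp rhat R"
abbreviation "v \<equiv> velocity Tm Tp rhat"
abbreviation D :: "(spacetime \<Rightarrow> 'b::real_normed_vector) \<Rightarrow> spacetime \<Rightarrow> spacetime \<Rightarrow> 'b"
  where "D f p \<equiv> frechet_derivative f (at p within S)"

lemma Tm_less_Tp: "Tm < Tp"
  using traj by (simp add: trajectory_def)

lemma rhat_derivative:
  "t \<in> {Tm..Tp} \<Longrightarrow> (rhat has_vector_derivative v t) (at t within {Tm..Tp})"
  using traj unfolding trajectory_def velocity_def differentiable_on_def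
  by (metis vector_derivative_works)

lemma continuous_rhat: "continuous_on {Tm..Tp} rhat"
  using traj by (simp add: trajectory_def differentiable_imp_continuous_on)

lemma continuous_velocity: "continuous_on {Tm..Tp} v"
  using traj by (simp add: trajectory_def differentiable_imp_continuous_on)

lemma mem_tube: "(t, x) \<in> S \<longleftrightarrow> t \<in> {Tm..Tp} \<and> x \<in> cball (rhat t) R"
  by (simp add: tube_def)

lemma trivial_limit_time: "t \<in> {Tm..Tp} \<Longrightarrow> at t within {Tm..Tp} \<noteq> bot"
  using Tm_less_Tp by (simp add: trivial_limit_within islimpt_Icc)

text \<open>Derivatives within the tube are unique, also at its boundary: a derivative of the zero function
  vanishes on all velocities of curves that stay in the tube. Segments inside a time slice provide all
  spatial directions, and the translate of the trajectory provides a direction with time component \<open>1\<close>.\<close>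

lemma zero_derivative_tube:
  fixes L :: "spacetime \<Rightarrow> 'b::real_normed_vector"
  assumes L: "((\<lambda>_. 0) has_derivative L) (at p within S)" and p: "p \<in> S"
  shows "L = (\<lambda>_. 0)"
proof -
  obtain t x where tx: "p = (t, x)" by (cases p)
  have t: "t \<in> {Tm..Tp}" and x: "x \<in> cball (rhat t) R"
    using p by (auto simp: tx mem_tube)
  have lin: "linear L"
    using L by (simp add: has_derivative_bounded_linear bounded_linear.linear)
  have to_ball: "L (0, y - x) = 0" if y: "y \<in> cball (rhat t) R" for y
  proof (rule has_derivative_const_zero_curve[OF L, where \<gamma>="\<lambda>s. (t, x + s *\<^sub>R (y - x))" and I="{0..1}" and s=0])
    show "((\<lambda>s. (t, x + s *\<^sub>R (y - x))) has_vector_derivative (0, y - x)) (at 0 within {0..1})"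
      unfolding has_vector_derivative_def by (auto intro!: derivative_eq_intros)
    have "x + s *\<^sub>R (y - x) \<in> cball (rhat t) R" if "s \<in> {0..1}" for s
      using convexD_alt[OF convex_cball x y, of s] that by (simp add: algebra_simps)
    then show "(\<lambda>s. (t, x + s *\<^sub>R (y - x))) ` {0..1} \<subseteq> S"
      using t by (auto simp: mem_tube simp del: mem_cball)
    show "at (0::real) within {0..1} \<noteq> bot"
      by (simp add: trivial_limit_within islimpt_Icc)
  qed (simp add: tx)
  have Lx: "L (0, h) = 0" for h
  proof (cases "h = 0")
    case True
    then show ?thesis using linear_0[OF lin] by (simp add: zero_prod_def)
  next
    case False
    \<comment> \<open>two points of the ball that differ by a multiple of \<open>h\<close>\<close>
    let ?e = "R / norm h"
    have "rhat t + ?e *\<^sub>R h \<in> cball (rhat t) R" "rhat t \<in> cball (rhat t) R"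
      using R_pos False by (auto simp: dist_norm)
    then have "L (0, rhat t + ?e *\<^sub>R h - x) - L (0, rhat t - x) = 0"
      using to_ball by simp
    then have "L (?e *\<^sub>R (0, h)) = 0"
      by (simp flip: linear_diff[OF lin])
    then show ?thesis
      using R_pos False unfolding linear_scale[OF lin] by simp
  qed
  have Lt: "L (1, v t) = 0"
  proof (rule has_derivative_const_zero_curve[OF L, where \<gamma>="\<lambda>s. (s, x + (rhat s - rhat t))" and I="{Tm..Tp}" and s=t])
    show "((\<lambda>s. (s, x + (rhat s - rhat t))) has_vector_derivative (1, v t)) (at t within {Tm..Tp})"
      using rhat_derivative[OF t] unfolding has_vector_derivative_def
      by (auto intro!: derivative_eq_intros)
    show "(\<lambda>s. (s, x + (rhat s - rhat t))) ` {Tm..Tp} \<subseteq> S"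
      using x by (auto simp: mem_tube dist_norm algebra_simps norm_minus_commute)
  qed (use trivial_limit_time t in \<open>auto simp: tx\<close>)
  show ?thesis
  proof
    fix h :: spacetime
    have "h = fst h *\<^sub>R (1, v t) + (0, snd h - fst h *\<^sub>R v t)"
      by (simp add: prod_eq_iff)
    then show "L h = 0"
      using Lx Lt by (metis add.right_neutral linear_add[OF lin] linear_scale[OF lin] scaleR_zero_right)
  qed
qed

lemma derivative_tube_eq:
  assumes f: "(f has_derivative f') (at p within S)" and p: "p \<in> S"
  shows "D f p = f'"
proof -
  have "(f has_derivative D f p) (at p within S)"
    using f frechet_derivative_works differentiable_def by blast
  from has_derivative_diff[OF this f] have "(\<lambda>h. D f p h - f' h) = (\<lambda>_. 0)"
    by (intro zero_derivative_tube[OF _ p]) simp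
  then show ?thesis by (auto simp: fun_eq_iff)
qed

lemma C1_onI:
  assumes "\<And>p. p \<in> S \<Longrightarrow> (f has_derivative f' p) (at p within S)"
    and "\<And>h. continuous_on S (\<lambda>p. f' p h)"
  shows "C1_on S f"
proof -
  have "D f p = f' p" if "p \<in> S" for p
    using derivative_tube_eq assms(1) that by blast
  then have "continuous_on S (\<lambda>p. D f p h)" for h
    using assms(2)[of h] continuous_on_cong[OF refl, of S "\<lambda>p. D f p h" "\<lambda>p. f' p h"] by simp
  moreover have "f differentiable_on S"
    using assms(1) by (auto simp: differentiable_on_def differentiable_def)
  ultimately show ?thesis
    by (simp add: C1_on_def)
qed

lemma C1_on_has_derivative: "C1_on S f \<Longrightarrow> p \<in> S \<Longrightarrow> (f has_derivative D f p) (at p within S)"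
  unfolding C1_on_def differentiable_on_def using frechet_derivative_works by blast

lemma C1_on_continuous: "C1_on S f \<Longrightarrow> continuous_on S f"
  by (simp add: C1_on_def differentiable_imp_continuous_on)

lemma C1_on_continuous_derivative: "C1_on S f \<Longrightarrow> continuous_on S (\<lambda>p. D f p h)"
  unfolding C1_on_def by blast

lemma C1_on_linear_derivative: "C1_on S f \<Longrightarrow> p \<in> S \<Longrightarrow> linear (D f p)"
  using has_derivative_linear C1_on_has_derivative by blast

lemma
  assumes "C1_on S f" "C1_on S g"
  shows C1_on_add: "C1_on S (\<lambda>p. f p + g p)"
    and D_add: "p \<in> S \<Longrightarrow> D (\<lambda>p. f p + g p) p h = D f p h + D g p h"
proof -
  have d: "((\<lambda>p. f p + g p) has_derivative (\<lambda>h. D f p h + D g p h)) (at p within S)" if "p \<in> S" for p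
    by (intro has_derivative_add C1_on_has_derivative assms that)
  show "C1_on S (\<lambda>p. f p + g p)"
    by (rule C1_onI[OF d], assumption) (intro continuous_intros C1_on_continuous_derivative assms)+
  show "D (\<lambda>p. f p + g p) p h = D f p h + D g p h" if "p \<in> S"
    by (simp add: derivative_tube_eq[OF d[OF that] that])
qed

lemma
  assumes "bounded_linear k" "C1_on S f"
  shows C1_on_linear: "C1_on S (\<lambda>p. k (f p))"
    and D_linear: "p \<in> S \<Longrightarrow> D (\<lambda>p. k (f p)) p h = k (D f p h)"
proof -
  have d: "((\<lambda>p. k (f p)) has_derivative (\<lambda>h. k (D f p h))) (at p within S)" if "p \<in> S" for p
    by (intro bounded_linear.has_derivative[OF assms(1)] C1_on_has_derivative assms that)
  show "C1_on S (\<lambda>p. k (f p))"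
    by (rule C1_onI[OF d], assumption)
       (intro bounded_linear.continuous_on[OF assms(1)] C1_on_continuous_derivative assms)+
  show "D (\<lambda>p. k (f p)) p h = k (D f p h)" if "p \<in> S"
    by (simp add: derivative_tube_eq[OF d[OF that] that])
qed

lemma
  assumes "bounded_bilinear k" "C1_on S f" "C1_on S g"
  shows C1_on_bilinear: "C1_on S (\<lambda>p. k (f p) (g p))"
    and D_bilinear: "p \<in> S \<Longrightarrow> D (\<lambda>p. k (f p) (g p)) p h = k (f p) (D g p h) + k (D f p h) (g p)"
proof -
  have d: "((\<lambda>p. k (f p) (g p)) has_derivative (\<lambda>h. k (f p) (D g p h) + k (D f p h) (g p))) (at p within S)"
    if "p \<in> S" for p
    by (intro bounded_bilinear.FDERIV[OF assms(1)] C1_on_has_derivative assms that)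
  show "C1_on S (\<lambda>p. k (f p) (g p))"
    by (rule C1_onI[OF d], assumption)
       (intro continuous_on_add bounded_bilinear.continuous_on[OF assms(1)]
          C1_on_continuous C1_on_continuous_derivative assms)+
  show "D (\<lambda>p. k (f p) (g p)) p h = k (f p) (D g p h) + k (D f p h) (g p)" if "p \<in> S"
    by (simp add: derivative_tube_eq[OF d[OF that] that])
qed

lemma
  assumes f: "C1_on S f" and k: "\<And>z. (k has_derivative k' z) (at z)"
    and c: "\<And>h. continuous_on S (\<lambda>p. k' (f p) (D f p h))"
  shows C1_on_compose: "C1_on S (\<lambda>p. k (f p))"
    and D_compose: "p \<in> S \<Longrightarrow> D (\<lambda>p. k (f p)) p h = k' (f p) (D f p h)"
proof -
  have d: "((\<lambda>p. k (f p)) has_derivative (\<lambda>h. k' (f p) (D f p h))) (at p within S)"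
    if "p \<in> S" for p
    by (rule has_derivative_compose[where f=f and x=p and g=k and g'="k' (f p)"])
       (use C1_on_has_derivative[OF f that] k in auto)
  show "C1_on S (\<lambda>p. k (f p))"
    by (rule C1_onI[OF d c])
  show "D (\<lambda>p. k (f p)) p h = k' (f p) (D f p h)" if "p \<in> S"
    by (simp add: derivative_tube_eq[OF d[OF that] that])
qed

lemma
  assumes "finite I" "\<And>i. i \<in> I \<Longrightarrow> C1_on S (f i)"
  shows C1_on_sum: "C1_on S (\<lambda>p. \<Sum>i\<in>I. f i p)"
    and D_sum: "p \<in> S \<Longrightarrow> D (\<lambda>p. \<Sum>i\<in>I. f i p) p h = (\<Sum>i\<in>I. D (f i) p h)"
proof -
  have d: "((\<lambda>p. \<Sum>i\<in>I. f i p) has_derivative (\<lambda>h. \<Sum>i\<in>I. D (f i) p h)) (at p within S)" if "p \<in> S" for p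
    by (intro has_derivative_sum C1_on_has_derivative assms that)
  show "C1_on S (\<lambda>p. \<Sum>i\<in>I. f i p)"
    by (rule C1_onI[OF d], assumption) (intro continuous_intros C1_on_continuous_derivative assms; assumption)+
  show "D (\<lambda>p. \<Sum>i\<in>I. f i p) p h = (\<Sum>i\<in>I. D (f i) p h)" if "p \<in> S"
    by (simp add: derivative_tube_eq[OF d[OF that] that])
qed

lemma
  fixes f :: "3 \<Rightarrow> spacetime \<Rightarrow> real"
  assumes "\<And>i. C1_on S (f i)"
  shows C1_on_vec: "C1_on S (\<lambda>p. \<chi> i. f i p)"
    and D_vec: "p \<in> S \<Longrightarrow> D (\<lambda>p. \<chi> i. f i p) p h = (\<chi> i. D (f i) p h)"
proof -
  have e: "(\<lambda>p. \<chi> i. f i p) = (\<lambda>p. \<Sum>i\<in>UNIV. f i p *\<^sub>R axis i 1)"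
    by (simp add: fun_eq_iff vec_eq_iff axis_def if_distrib[of "\<lambda>x. _ * x"] cong: if_cong)
  have c: "C1_on S (\<lambda>p. f i p *\<^sub>R (axis i 1 :: real^3))" for i
    by (intro C1_on_linear[OF bounded_linear_scaleR_left] assms)
  show "C1_on S (\<lambda>p. \<chi> i. f i p)"
    unfolding e by (intro C1_on_sum c) simp
  show "D (\<lambda>p. \<chi> i. f i p) p h = (\<chi> i. D (f i) p h)" if "p \<in> S"
    unfolding e D_sum[OF finite c that] D_linear[OF bounded_linear_scaleR_left assms that]
    by (simp add: vec_eq_iff axis_def if_distrib[of "\<lambda>x. _ * x"] cong: if_cong)
qed

text \<open>The derivative in the direction of a motion with velocity \<open>w\<close>.\<close>

lemma D_direction_sum:
  assumes "C1_on S f" "p \<in> S"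
  shows "D f p (1, w) = pd_t S f p + (\<Sum>i\<in>UNIV. w $ i *\<^sub>R pd_x S i f p)"
proof -
  note lin = C1_on_linear_derivative[OF assms]
  have "(1, w) = (1, 0) + (\<Sum>i\<in>UNIV. w $ i *\<^sub>R (0 :: real, axis i 1 :: real^3))"
    by (simp add: prod_eq_iff fst_sum snd_sum basis_expansion flip: scalar_mult_eq_scaleR)
  then show ?thesis
    unfolding pd_t_def pd_x_def
    by (simp only: linear_add[OF lin] linear_sum[OF lin] linear_scale[OF lin])
qed

end

section \<open>Integrals over the moving ball\<close>

lemma norm_set_integral_compact_le:
  fixes f :: "'a::euclidean_space \<Rightarrow> 'b::euclidean_space"
  assumes "compact B" "continuous_on B f" "\<And>x. x \<in> B \<Longrightarrow> norm (f x) \<le> e"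
  shows "norm (LINT x:B|lborel. f x) \<le> e * measure lborel B"
proof -
  have B: "B \<in> sets lborel" "emeasure lborel B < \<infinity>"
    using assms(1) emeasure_compact_finite borel_compact by auto
  have "norm (LINT x:B|lborel. f x) \<le> (LINT x:B|lborel. norm (f x))"
    by (rule set_integral_norm_bound) (rule set_integrable_compact[OF assms(1,2)])
  also have "\<dots> \<le> (LINT x:B|lborel. e)"
    by (intro set_integral_mono set_integrable_compact assms continuous_intros) auto
  also have "\<dots> = e * measure lborel B"
    using B by (simp add: set_integral_const)
  finally show ?thesis .
qed

lemma set_integral_compact_diff:
  fixes f :: "'a::euclidean_space \<Rightarrow> 'b::euclidean_space"
  assumes "compact B" "continuous_on B f" "continuous_on B g"
  shows "(LINT x:B|lborel. f x) - (LINT x:B|lborel. g x) = (LINT x:B|lborel. f x - g x)"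
  using set_integral_diff(2)[OF set_integrable_compact[OF assms(1,2)] set_integrable_compact[OF assms(1,3)]]
  by (rule sym)

lemma continuous_on_compact_integral:
  fixes k :: "'a::euclidean_space \<Rightarrow> 'c::euclidean_space \<Rightarrow> 'b::euclidean_space"
  assumes A: "compact A" and B: "compact B" and k: "continuous_on (A \<times> B) (\<lambda>(s, y). k s y)"
  shows "continuous_on A (\<lambda>s. LINT y:B|lborel. k s y)"
proof (rule uniformly_continuous_imp_continuous, unfold uniformly_continuous_on_def, intro allI impI)
  fix e :: real assume e: "0 < e"
  let ?m = "measure lborel B + 1"
  have m: "0 < ?m" by (simp add: add_nonneg_pos)
  have ck: "continuous_on B (k s)" if "s \<in> A" for s
    using that by (intro continuous_on_compose2[OF k, of B "\<lambda>y. (s, y)", simplified] continuous_intros) auto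
  have "uniformly_continuous_on (A \<times> B) (\<lambda>(s, y). k s y)"
    by (intro compact_uniformly_continuous k compact_Times A B)
  then obtain d where d: "0 < d" and
    dd: "\<And>p p'. p \<in> A \<times> B \<Longrightarrow> p' \<in> A \<times> B \<Longrightarrow> dist p' p < d \<Longrightarrow>
      dist ((\<lambda>(s, y). k s y) p') ((\<lambda>(s, y). k s y) p) < e / ?m"
    using e m unfolding uniformly_continuous_on_def by (metis divide_pos_pos)
  show "\<exists>d>0. \<forall>x\<in>A. \<forall>x'\<in>A. dist x' x < d \<longrightarrow> dist (LINT y:B|lborel. k x' y) (LINT y:B|lborel. k x y) < e"
  proof (rule exI[of _ d], intro conjI ballI impI)
    show "0 < d" by (rule d)
  next
    fix s s' assume s: "s \<in> A" "s' \<in> A" "dist s' s < d"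
    have "norm (k s' y - k s y) \<le> e / ?m" if "y \<in> B" for y
      using dd[of "(s, y)" "(s', y)"] s that by (simp add: dist_norm dist_Pair_Pair less_imp_le)
    then have "norm (LINT y:B|lborel. k s' y - k s y) \<le> e / ?m * measure lborel B"
      by (intro norm_set_integral_compact_le B continuous_intros ck s) auto
    also have "\<dots> < e"
      using e m by (simp add: field_simps)
    finally show "dist (LINT y:B|lborel. k s' y) (LINT y:B|lborel. k s y) < e"
      using set_integral_compact_diff[OF B ck ck] s by (simp add: dist_norm)
  qed
qed

lemma has_vector_derivative_compact_integral:
  fixes k :: "real \<Rightarrow> 'c::euclidean_space \<Rightarrow> 'b::euclidean_space"
  assumes B: "compact B"
    and k: "\<And>s. s \<in> {a..b} \<Longrightarrow> continuous_on B (k s)"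
    and k': "continuous_on ({a..b} \<times> B) (\<lambda>(s, y). k' s y)"
    and der: "\<And>s y. s \<in> {a..b} \<Longrightarrow> y \<in> B \<Longrightarrow> ((\<lambda>s. k s y) has_vector_derivative k' s y) (at s within {a..b})"
    and t: "t \<in> {a..b}"
  shows "((\<lambda>s. LINT y:B|lborel. k s y) has_vector_derivative (LINT y:B|lborel. k' t y)) (at t within {a..b})"
  unfolding has_vector_derivative_def has_derivative_within_alt
proof (intro conjI allI impI)
  show "bounded_linear (\<lambda>x. x *\<^sub>R (LINT y:B|lborel. k' t y))"
    by (rule bounded_linear_scaleR_left)
  fix e :: real assume e: "0 < e"
  let ?m = "measure lborel B + 1"
  have m: "0 < ?m" by (simp add: add_nonneg_pos)
  have ck': "continuous_on B (k' s)" if "s \<in> {a..b}" for s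
    using that by (intro continuous_on_compose2[OF k', of B "\<lambda>y. (s, y)", simplified] continuous_intros) auto
  have "uniformly_continuous_on ({a..b} \<times> B) (\<lambda>(s, y). k' s y)"
    by (intro compact_uniformly_continuous k' compact_Times compact_Icc B)
  then obtain d where d: "0 < d" and
    dd: "\<And>p p'. p \<in> {a..b} \<times> B \<Longrightarrow> p' \<in> {a..b} \<times> B \<Longrightarrow> dist p' p < d \<Longrightarrow>
      dist ((\<lambda>(s, y). k' s y) p') ((\<lambda>(s, y). k' s y) p) < e / ?m"
    using e m unfolding uniformly_continuous_on_def by (metis divide_pos_pos)
  show "\<exists>d>0. \<forall>s\<in>{a..b}. norm (s - t) < d \<longrightarrow>
      norm ((LINT y:B|lborel. k s y) - (LINT y:B|lborel. k t y) - (s - t) *\<^sub>R (LINT y:B|lborel. k' t y)) \<le> e * norm (s - t)"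
  proof (rule exI[of _ d], intro conjI ballI impI)
    show "0 < d" by (rule d)
  next
    fix s assume s: "s \<in> {a..b}" and st: "norm (s - t) < d"
    have pw: "norm (k s y - k t y - (s - t) *\<^sub>R k' t y) \<le> e / ?m * norm (s - t)" if y: "y \<in> B" for y
    proof -
      define I where "I = {a..b} \<inter> {min s t..max s t}"
      have I: "closed_segment t s \<subseteq> I"
        using s t by (auto simp: I_def closed_segment_eq_real_ivl)
      have "norm (k s y - k t y - (s - t) *\<^sub>R k' t y) \<le> norm (s - t) * (e / ?m)"
      proof (rule differentiable_bound_linearization[where S=I and f="\<lambda>s. k s y" and f'="\<lambda>s h. h *\<^sub>R k' s y"])
        show "t + u *\<^sub>R (s - t) \<in> I" if "u \<in> {0..1}" for u
          using I that by (force simp: closed_segment_def algebra_simps)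
        show "((\<lambda>s. k s y) has_derivative (\<lambda>h. h *\<^sub>R k' x y)) (at x within I)" if "x \<in> I" for x
          using der[of x y] that y unfolding has_vector_derivative_def I_def
          by (blast intro: has_derivative_subset)
        show "t \<in> I" using t by (simp add: I_def)
        show "onorm ((\<lambda>h. h *\<^sub>R k' x y) - (\<lambda>h. h *\<^sub>R k' t y)) \<le> e / ?m" if "x \<in> I" for x
        proof (rule onorm_le)
          fix h
          have "dist x t < d" using that st by (auto simp: I_def dist_real_def)
          then have "norm (k' x y - k' t y) \<le> e / ?m"
            using dd[of "(t, y)" "(x, y)"] that t y by (simp add: I_def dist_Pair_Pair dist_norm less_imp_le)
          then have "\<bar>h\<bar> * norm (k' x y - k' t y) \<le> \<bar>h\<bar> * (e / ?m)"
            by (rule mult_left_mono) simp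
          then show "norm (((\<lambda>h. h *\<^sub>R k' x y) - (\<lambda>h. h *\<^sub>R k' t y)) h) \<le> e / ?m * norm h"
            unfolding minus_apply scaleR_diff_right[symmetric] norm_scaleR real_norm_def by (simp only: mult.commute)
        qed
      qed
      then show ?thesis by (simp add: mult.commute)
    qed
    have c: "continuous_on B (k s)" "continuous_on B (k t)" "continuous_on B (\<lambda>y. (s - t) *\<^sub>R k' t y)"
      "continuous_on B (\<lambda>y. k s y - k t y)"
      using k[OF s] k[OF t] ck'[OF t] by (auto intro!: continuous_intros)
    have "norm (LINT y:B|lborel. k s y - k t y - (s - t) *\<^sub>R k' t y) \<le> e / ?m * norm (s - t) * measure lborel B"
      by (intro norm_set_integral_compact_le B pw continuous_intros c)
    also have "\<dots> = norm (s - t) * e * (measure lborel B / ?m)"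
      by simp
    also have "\<dots> \<le> norm (s - t) * e * 1"
      using e m by (intro mult_left_mono) (auto simp: field_simps)
    finally show "norm ((LINT y:B|lborel. k s y) - (LINT y:B|lborel. k t y) - (s - t) *\<^sub>R (LINT y:B|lborel. k' t y)) \<le> e * norm (s - t)"
      using set_integral_compact_diff[OF B c(1,2)] set_integral_compact_diff[OF B c(4,3)]
      by (simp add: set_integral_scaleR_right mult.commute)
  qed
qed

lemma set_integral_cball_shift:
  fixes h :: "'a::euclidean_space \<Rightarrow> 'b::euclidean_space"
  assumes "continuous_on (cball c R) h"
  shows "(LINT x:cball c R|lborel. h x) = (LINT y:cball 0 R|lborel. h (c + y))"
proof -
  have m: "(\<lambda>x. indicator (cball c R) x *\<^sub>R h x) \<in> borel_measurable borel"
    by (intro borel_measurable_continuous_on_indicator assms) simp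
  have "(LINT x:cball c R|lborel. h x) =
      (LINT x|distr lborel borel ((+) c). indicator (cball c R) x *\<^sub>R h x)"
    by (simp add: lborel_distr_plus set_lebesgue_integral_def)
  also have "\<dots> = (LINT y|lborel. indicator (cball c R) (c + y) *\<^sub>R h (c + y))"
    by (intro integral_distr m) simp
  also have "\<dots> = (LINT y:cball 0 R|lborel. h (c + y))"
    unfolding set_lebesgue_integral_def
    by (intro Bochner_Integration.integral_cong) (auto simp: indicator_def dist_norm)
  finally show ?thesis .
qed

context ball_tube
begin

lemma comoving_mem: "s \<in> {Tm..Tp} \<Longrightarrow> y \<in> cball 0 R \<Longrightarrow> (s, rhat s + y) \<in> S"
  by (simp add: mem_tube dist_norm)

text \<open>In comoving coordinates \<open>(s, y)\<close>, with \<open>y = x - rhat s\<close>, the tube becomes the compact product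
  of the time interval and a fixed ball.\<close>

lemma continuous_on_comoving:
  assumes "continuous_on S f"
  shows "continuous_on ({Tm..Tp} \<times> cball 0 R) (\<lambda>(s, y). f (s, rhat s + y))"
proof -
  have "continuous_on ({Tm..Tp} \<times> cball 0 R) (\<lambda>p. rhat (fst p))"
    by (intro continuous_on_compose2[OF continuous_rhat] continuous_intros) auto
  then show ?thesis
    unfolding case_prod_unfold
    by (intro continuous_on_compose2[OF assms] continuous_intros) (use comoving_mem in auto)
qed

lemma continuous_on_slice:
  assumes "continuous_on S f" "t \<in> {Tm..Tp}"
  shows "continuous_on (cball (rhat t) R) (\<lambda>x. f (t, x))"
  by (intro continuous_on_compose2[OF assms(1)] continuous_intros) (use assms(2) in \<open>auto simp: mem_tube\<close>)

lemma continuous_ball_integral: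
  fixes f :: "spacetime \<Rightarrow> 'b::euclidean_space"
  assumes "continuous_on S f"
  shows "continuous_on {Tm..Tp} (\<lambda>t. LINT x:cball (rhat t) R|lborel. f (t, x))"
proof -
  have "continuous_on {Tm..Tp} (\<lambda>t. LINT y:cball 0 R|lborel. f (t, rhat t + y))"
    by (intro continuous_on_compact_integral continuous_on_comoving assms) auto
  then show ?thesis
    by (rule continuous_on_eq) (simp add: set_integral_cball_shift[OF continuous_on_slice[OF assms]])
qed

lemma continuous_on_D_moving:
  assumes f: "C1_on S f"
  shows "continuous_on S (\<lambda>p. D f p (1, v (fst p)))"
proof -
  have "continuous_on S (\<lambda>p. v (fst p))"
    by (intro continuous_on_compose2[OF continuous_velocity] continuous_intros) (auto simp: tube_def)
  then have "continuous_on S (\<lambda>p. pd_t S f p + (\<Sum>i\<in>UNIV. v (fst p) $ i *\<^sub>R pd_x S i f p))"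
    unfolding pd_t_def pd_x_def by (intro continuous_intros C1_on_continuous_derivative f)
  then show ?thesis
    by (rule continuous_on_eq) (simp add: D_direction_sum[OF f])
qed

text \<open>In comoving coordinates the domain of integration is fixed, and the integrand is differentiated in
  the direction \<open>(1, v t)\<close>.\<close>

lemma transport_theorem:
  fixes f :: "spacetime \<Rightarrow> 'b::euclidean_space"
  assumes f: "C1_on S f" and t: "t \<in> {Tm..Tp}"
  shows "((\<lambda>t. LINT x:cball (rhat t) R|lborel. f (t, x)) has_vector_derivative
      (LINT x:cball (rhat t) R|lborel. D f (t, x) (1, v t))) (at t within {Tm..Tp})"
proof -
  note c = C1_on_continuous[OF f]
  have "((\<lambda>t. LINT y:cball 0 R|lborel. f (t, rhat t + y)) has_vector_derivative
      (LINT y:cball 0 R|lborel. D f (t, rhat t + y) (1, v t))) (at t within {Tm..Tp})"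
  proof (rule has_vector_derivative_compact_integral[OF compact_cball _ _ _ t])
    show "continuous_on (cball 0 R) (\<lambda>y. f (s, rhat s + y))" if "s \<in> {Tm..Tp}" for s
      using that comoving_mem by (intro continuous_on_compose2[OF c] continuous_intros) auto
    show "continuous_on ({Tm..Tp} \<times> cball 0 R) (\<lambda>(s, y). D f (s, rhat s + y) (1, v s))"
      using continuous_on_comoving[OF continuous_on_D_moving[OF f]] by simp
    show "((\<lambda>s. f (s, rhat s + y)) has_vector_derivative D f (s, rhat s + y) (1, v s)) (at s within {Tm..Tp})"
      if s: "s \<in> {Tm..Tp}" and y: "y \<in> cball 0 R" for s y
    proof -
      have g: "((\<lambda>s. (s, rhat s + y)) has_derivative (\<lambda>h. h *\<^sub>R (1, v s))) (at s within {Tm..Tp})"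
        using rhat_derivative[OF s] unfolding has_vector_derivative_def
        by (auto intro!: derivative_eq_intros)
      have "(f has_derivative D f (s, rhat s + y)) (at (s, rhat s + y) within (\<lambda>s. (s, rhat s + y)) ` {Tm..Tp})"
        by (rule has_derivative_subset[OF C1_on_has_derivative[OF f comoving_mem[OF s y]]])
           (use comoving_mem y in auto)
      from has_derivative_in_compose[OF g this] show ?thesis
        unfolding has_vector_derivative_def
        by (simp only: linear_scale[OF C1_on_linear_derivative[OF f comoving_mem[OF s y]]])
    qed
  qed
  then have "((\<lambda>t. LINT y:cball 0 R|lborel. f (t, rhat t + y)) has_vector_derivative
      (LINT x:cball (rhat t) R|lborel. D f (t, x) (1, v t))) (at t within {Tm..Tp})"
    using set_integral_cball_shift[OF continuous_on_slice[OF continuous_on_D_moving[OF f] t]] by simp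
  then show ?thesis
    by (rule has_vector_derivative_transform[OF t, rotated])
       (simp add: set_integral_cball_shift[OF continuous_on_slice[OF c]])
qed

lemma divergence_theorem_slice:
  fixes f :: "3 \<Rightarrow> spacetime \<Rightarrow> 'b::euclidean_space"
  assumes f: "\<And>i. C1_on S (f i)" and t: "t \<in> {Tm..Tp}"
  shows "(LINT x:cball (rhat t) R|lborel. (\<Sum>i\<in>UNIV. pd_x S i (f i) (t, x))) =
    (LINT x|sphere_measure (rhat t) R. (\<Sum>i\<in>UNIV. ((1 / R) *\<^sub>R (x - rhat t)) $ i *\<^sub>R f i (t, x)))"
  unfolding pd_x_def
proof (rule divergence_theorem_ball[where D="\<lambda>i x h. D (f i) (t, x) (0, h)"])
  show "continuous_on (cball (rhat t) R) (\<lambda>x. f i (t, x))" for i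
    by (intro continuous_on_slice C1_on_continuous f t)
  show "continuous_on (cball (rhat t) R) (\<lambda>x. D (f i) (t, x) (0, h))" for i h
    by (intro continuous_on_slice[where f="\<lambda>p. D (f i) p (0, h)"] C1_on_continuous_derivative f t)
  show "linear (\<lambda>h. D (f i) (t, x) (0, h))" if "x \<in> cball (rhat t) R" for i x
  proof -
    have "linear (D (f i) (t, x))"
      using that t by (intro C1_on_linear_derivative f) (simp add: mem_tube)
    from linear_compose[OF _ this, of "\<lambda>h. (0, h)"] show ?thesis
      by (simp add: o_def linear_iff)
  qed
  show "((\<lambda>x. f i (t, x)) has_derivative (\<lambda>h. D (f i) (t, x) (0, h))) (at x)"
    if x: "x \<in> ball (rhat t) R" for i x
  proof -
    have g: "(Pair t has_derivative Pair 0) (at x within ball (rhat t) R)"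
      by (intro has_derivative_Pair has_derivative_const has_derivative_ident)
    have "(f i has_derivative D (f i) (t, x)) (at (t, x) within Pair t ` ball (rhat t) R)"
      by (rule has_derivative_subset[OF C1_on_has_derivative[OF f]]) (use x t in \<open>auto simp: mem_tube\<close>)
    then have "((\<lambda>x. f i (t, x)) has_derivative (\<lambda>h. D (f i) (t, x) (0, h))) (at x within ball (rhat t) R)"
      by (rule has_derivative_in_compose[where f="Pair t" and g="f i", OF g])
    then show ?thesis
      by (simp only: at_within_open[OF x open_ball])
  qed
qed (rule R_pos)

end

section \<open>Symmetry of second derivatives\<close>

text \<open>Two applications of the mean value theorem to the mixed second difference. Exchanging the roles
  of \<open>a\<close> and \<open>b\<close> does not change the left hand side, whence the symmetry of second derivatives.\<close>

lemma mixed_difference_mean_value: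
  fixes f :: "'a::real_normed_vector \<Rightarrow> real"
  assumes h: "0 < h"
    and U: "\<And>s r. 0 \<le> s \<Longrightarrow> s \<le> h \<Longrightarrow> 0 \<le> r \<Longrightarrow> r \<le> h \<Longrightarrow> p + s *\<^sub>R a + r *\<^sub>R b \<in> U"
    and f: "\<And>x. x \<in> U \<Longrightarrow> (f has_derivative f' x) (at x)"
    and fa: "\<And>x. x \<in> U \<Longrightarrow> ((\<lambda>x. f' x a) has_derivative fa x) (at x)"
  obtains s r where "0 \<le> s" "s \<le> h" "0 \<le> r" "r \<le> h"
    "f (p + h *\<^sub>R a + h *\<^sub>R b) - f (p + h *\<^sub>R a) - f (p + h *\<^sub>R b) + f p
      = h * h * fa (p + s *\<^sub>R a + r *\<^sub>R b) b"
proof -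
  have line: "((\<lambda>s. k (w + s *\<^sub>R d)) has_real_derivative k' d) (at s)"
    if "(k has_derivative k') (at (w + s *\<^sub>R d))" for k :: "'a \<Rightarrow> real" and k' w d s
  proof -
    have "((\<lambda>s. w + s *\<^sub>R d) has_derivative (\<lambda>x. x *\<^sub>R d)) (at s)"
      by (auto intro!: derivative_eq_intros)
    from has_derivative_compose[OF this that]
    have "((\<lambda>s. k (w + s *\<^sub>R d)) has_derivative (\<lambda>x. k' (x *\<^sub>R d))) (at s)" .
    moreover have "k' (x *\<^sub>R d) = k' d * x" for x
      using linear_scale[OF has_derivative_linear[OF that]] by simp
    ultimately show ?thesis
      by (simp add: has_field_derivative_def)
  qed
  define g where "g s = f (p + h *\<^sub>R b + s *\<^sub>R a) - f (p + s *\<^sub>R a)" for s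
  have "DERIV g s :> f' (p + h *\<^sub>R b + s *\<^sub>R a) a - f' (p + s *\<^sub>R a) a" if "0 \<le> s" "s \<le> h" for s
    unfolding g_def
    using U[OF that, of h] U[OF that, of 0] h by (intro DERIV_diff line f) (auto simp: add_ac)
  then obtain s where s: "0 < s" "s < h" and
    gs: "g h - g 0 = (h - 0) * (f' (p + h *\<^sub>R b + s *\<^sub>R a) a - f' (p + s *\<^sub>R a) a)"
    using MVT2[OF h, of g "\<lambda>s. f' (p + h *\<^sub>R b + s *\<^sub>R a) a - f' (p + s *\<^sub>R a) a"] by blast
  define k where "k r = f' (p + s *\<^sub>R a + r *\<^sub>R b) a" for r
  have "DERIV k r :> fa (p + s *\<^sub>R a + r *\<^sub>R b) b" if "0 \<le> r" "r \<le> h" for r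
    unfolding k_def using U[of s r] s that by (intro line[where k="\<lambda>x. f' x a"] fa) auto
  then obtain r where r: "0 < r" "r < h" and
    kr: "k h - k 0 = (h - 0) * fa (p + s *\<^sub>R a + r *\<^sub>R b) b"
    using MVT2[OF h, of k "\<lambda>r. fa (p + s *\<^sub>R a + r *\<^sub>R b) b"] by blast
  have "g h - g 0 = h * (k h - k 0)"
    using gs by (simp add: k_def add_ac)
  then have "f (p + h *\<^sub>R a + h *\<^sub>R b) - f (p + h *\<^sub>R a) - f (p + h *\<^sub>R b) + f p
      = h * h * fa (p + s *\<^sub>R a + r *\<^sub>R b) b"
    unfolding kr by (simp add: g_def add_ac)
  then show ?thesis
    using that[of s r] s r by simp
qed

lemma second_derivative_symmetric_real:
  fixes f :: "'a::real_normed_vector \<Rightarrow> real"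
  assumes U: "open U" "p \<in> U"
    and f: "\<And>x. x \<in> U \<Longrightarrow> (f has_derivative f' x) (at x)"
    and fa: "\<And>x. x \<in> U \<Longrightarrow> ((\<lambda>x. f' x a) has_derivative fa x) (at x)"
    and fb: "\<And>x. x \<in> U \<Longrightarrow> ((\<lambda>x. f' x b) has_derivative fb x) (at x)"
    and ca: "continuous_on U (\<lambda>x. fa x b)" and cb: "continuous_on U (\<lambda>x. fb x a)"
  shows "fa p b = fb p a"
proof (rule ccontr)
  assume "fa p b \<noteq> fb p a"
  define e where "e = \<bar>fa p b - fb p a\<bar> / 2"
  have e: "0 < e" using \<open>fa p b \<noteq> fb p a\<close> by (simp add: e_def)
  have "isCont (\<lambda>x. fa x b) p" "isCont (\<lambda>x. fb x a) p"
    using ca cb U continuous_on_eq_continuous_at by blast+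
  then obtain d1 d2 where d1: "0 < d1" "\<And>x. dist x p < d1 \<Longrightarrow> dist (fa x b) (fa p b) < e"
    and d2: "0 < d2" "\<And>x. dist x p < d2 \<Longrightarrow> dist (fb x a) (fb p a) < e"
    unfolding continuous_at_eps_delta using e by metis
  obtain d3 where d3: "0 < d3" "ball p d3 \<subseteq> U"
    using U open_contains_ball by blast
  define d where "d = min d1 (min d2 d3)"
  have d: "0 < d" using d1 d2 d3 by (simp add: d_def)
  define h where "h = d / (2 * (norm a + norm b + 1))"
  have n: "0 < norm a + norm b + 1" using norm_ge_zero[of a] norm_ge_zero[of b] by linarith
  have h: "0 < h" using d n by (simp add: h_def)
  have near: "dist (p + s *\<^sub>R a + r *\<^sub>R b) p < d"
    if "0 \<le> s" "s \<le> h" "0 \<le> r" "r \<le> h" for s r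
  proof -
    have "dist (p + s *\<^sub>R a + r *\<^sub>R b) p \<le> norm (s *\<^sub>R a) + norm (r *\<^sub>R b)"
      using norm_triangle_ineq[of "s *\<^sub>R a" "r *\<^sub>R b"] by (simp only: dist_norm add.assoc add_diff_cancel_left')
    also have "\<dots> \<le> h * norm a + h * norm b"
      using that by (intro add_mono) (auto intro: mult_right_mono)
    also have "\<dots> \<le> h * (norm a + norm b + 1)"
      using h by (simp add: algebra_simps)
    also have "\<dots> = d / 2" using n unfolding h_def by (simp add: field_simps)
    also have "\<dots> < d" using d by simp
    finally show ?thesis .
  qed
  have near': "dist (p + r *\<^sub>R b + s *\<^sub>R a) p < d"
    if "0 \<le> s" "s \<le> h" "0 \<le> r" "r \<le> h" for s r
    using near[OF that] by (simp add: add_ac)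
  have inU: "x \<in> U" if "dist x p < d" for x
    using that d3 by (auto simp: d_def dist_commute)
  obtain s r where sr: "0 \<le> s" "s \<le> h" "0 \<le> r" "r \<le> h"
    and 1: "f (p + h *\<^sub>R a + h *\<^sub>R b) - f (p + h *\<^sub>R a) - f (p + h *\<^sub>R b) + f p
      = h * h * fa (p + s *\<^sub>R a + r *\<^sub>R b) b"
    by (rule mixed_difference_mean_value[OF h inU[OF near] f fa])
  obtain s' r' where sr': "0 \<le> s'" "s' \<le> h" "0 \<le> r'" "r' \<le> h"
    and 2: "f (p + h *\<^sub>R b + h *\<^sub>R a) - f (p + h *\<^sub>R b) - f (p + h *\<^sub>R a) + f p
      = h * h * fb (p + s' *\<^sub>R b + r' *\<^sub>R a) a"
  proof (rule mixed_difference_mean_value[OF h _ f fb])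
    show "p + s *\<^sub>R b + r *\<^sub>R a \<in> U" if "0 \<le> s" "s \<le> h" "0 \<le> r" "r \<le> h" for s r
      using near'[OF that(3,4,1,2)] by (rule inU)
  qed
  have "h * h * fa (p + s *\<^sub>R a + r *\<^sub>R b) b = h * h * fb (p + s' *\<^sub>R b + r' *\<^sub>R a) a"
  proof -
    have c: "p + h *\<^sub>R b + h *\<^sub>R a = p + h *\<^sub>R a + h *\<^sub>R b" by (simp add: add_ac)
    show ?thesis using 1 2 unfolding c by linarith
  qed
  then have eq: "fa (p + s *\<^sub>R a + r *\<^sub>R b) b = fb (p + s' *\<^sub>R b + r' *\<^sub>R a) a"
    using h by simp
  have "dist (fa (p + s *\<^sub>R a + r *\<^sub>R b) b) (fa p b) < e"
    using near[OF sr] by (intro d1) (simp add: d_def)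
  moreover have "dist (fb (p + s' *\<^sub>R b + r' *\<^sub>R a) a) (fb p a) < e"
    using near'[OF sr'(3,4,1,2)] by (intro d2) (simp add: d_def)
  moreover have "\<bar>fa p b - fb p a\<bar> \<le> \<bar>x - fa p b\<bar> + \<bar>x - fb p a\<bar>" for x
    by arith
  ultimately show False
    unfolding eq e_def dist_real_def by (smt (verit) field_sum_of_halves)
qed

context ball_tube
begin

text \<open>An open set of interior points of the tube.\<close>

definition inner_tube :: "spacetime set" where
  "inner_tube = {(t, x). t \<in> {Tm<..<Tp} \<and> x \<in> ball (rhat t) R}"

lemma inner_tube_subset: "inner_tube \<subseteq> S"
  by (auto simp: inner_tube_def tube_def)

lemma open_inner_tube: "open inner_tube"
proof -
  have "continuous_on ({Tm<..<Tp} \<times> UNIV) (\<lambda>p :: spacetime. dist (rhat (fst p)) (snd p))"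
    by (intro continuous_intros continuous_on_compose2[OF continuous_rhat]) auto
  then have "open (({Tm<..<Tp} \<times> UNIV) \<inter> (\<lambda>p. dist (rhat (fst p)) (snd p)) -` {..<R})"
    by (rule continuous_open_preimage) (auto intro: open_Times)
  moreover have "({Tm<..<Tp} \<times> UNIV) \<inter> (\<lambda>p. dist (rhat (fst p)) (snd p)) -` {..<R} = inner_tube"
    by (auto simp: inner_tube_def)
  ultimately show ?thesis by simp
qed

lemma at_within_inner_tube: "p \<in> inner_tube \<Longrightarrow> at p within S = at p"
  using interior_maximal[OF inner_tube_subset open_inner_tube] by (intro at_within_interior) blast

lemma second_derivative_symmetric:
  fixes f :: "spacetime \<Rightarrow> 'b::euclidean_space"
  assumes f: "C2_on S f" and p: "p \<in> inner_tube"
  shows "D (\<lambda>x. D f x a) p b = D (\<lambda>x. D f x b) p a"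
proof (rule euclidean_eqI)
  fix e :: 'b
  have C: "C1_on S f" "C1_on S (\<lambda>x. D f x h)" for h
    using f unfolding C2_on_def by blast+
  show "D (\<lambda>x. D f x a) p b \<bullet> e = D (\<lambda>x. D f x b) p a \<bullet> e"
  proof (rule second_derivative_symmetric_real[OF open_inner_tube p,
        where f="\<lambda>x. f x \<bullet> e" and f'="\<lambda>x h. D f x h \<bullet> e"
          and fa="\<lambda>x h. D (\<lambda>x. D f x a) x h \<bullet> e" and fb="\<lambda>x h. D (\<lambda>x. D f x b) x h \<bullet> e"])
    fix x assume x: "x \<in> inner_tube"
    then have xS: "x \<in> S" using inner_tube_subset by blast
    show "((\<lambda>x. f x \<bullet> e) has_derivative (\<lambda>h. D f x h \<bullet> e)) (at x)"
      using has_derivative_inner_left[OF C1_on_has_derivative[OF C(1) xS]] at_within_inner_tube[OF x] by simp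
    show "((\<lambda>x. D f x a \<bullet> e) has_derivative (\<lambda>h. D (\<lambda>x. D f x a) x h \<bullet> e)) (at x)"
      "((\<lambda>x. D f x b \<bullet> e) has_derivative (\<lambda>h. D (\<lambda>x. D f x b) x h \<bullet> e)) (at x)"
      using has_derivative_inner_left[OF C1_on_has_derivative[OF C(2) xS]] at_within_inner_tube[OF x] by simp_all
  next
    show "continuous_on inner_tube (\<lambda>x. D (\<lambda>x. D f x a) x b \<bullet> e)"
      "continuous_on inner_tube (\<lambda>x. D (\<lambda>x. D f x b) x a \<bullet> e)"
      by (intro continuous_intros continuous_on_subset[OF C1_on_continuous_derivative[OF C(2)] inner_tube_subset])+
  qed
qed

end

section \<open>The nonlinearity\<close>

text \<open>No integrability is assumed: if one side is not integrable, then neither is the other, and both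
  integrals are \<open>0\<close> by convention.\<close>

lemma integral_scale_atLeast0:
  fixes f :: "real \<Rightarrow> real"
  assumes k: "0 < k" and s: "0 \<le> s"
  shows "integral {0..s} (\<lambda>x. f (k * x)) = integral {0..k * s} f / k"
proof -
  have img: "(\<lambda>x. x / k) ` {0..k * s} = {0..s}"
    using k s by (simp add: image_divide_atLeastAtMost)
  have img': "(\<lambda>x. x * k) ` {0..s} = {0..k * s}"
    using k s image_mult_atLeastAtMost[of k 0 s] by (simp add: mult.commute[of _ k])
  have 1: "((\<lambda>x. f (k * x)) has_integral i / k) {0..s}" if "(f has_integral i) {0..k * s}" for i
    using has_integral_stretch_real[OF that, of k] k img by (simp add: divide_inverse mult.commute)
  show ?thesis
  proof (cases "f integrable_on {0..k * s}")
    case True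
    then show ?thesis using 1[OF integrable_integral] by (intro integral_unique) auto
  next
    case False
    have "\<not> (\<lambda>x. f (k * x)) integrable_on {0..s}"
    proof
      assume "(\<lambda>x. f (k * x)) integrable_on {0..s}"
      then obtain i where "((\<lambda>x. f (k * x)) has_integral i) {0..s}" by blast
      from has_integral_stretch_real[OF this, of "1 / k"]
      have "((\<lambda>x. f (k * (1 / k * x))) has_integral i / \<bar>1 / k\<bar>) ((\<lambda>x. x / (1 / k)) ` {0..s})"
        using k by (simp add: divide_inverse mult.commute)
      then have "(f has_integral i / \<bar>1 / k\<bar>) {0..k * s}"
        using k img' by simp
      with False show False by blast
    qed
    then show ?thesis
      using False by (simp add: not_integrable_integral)
  qed
qed

lemma Ga_scaling:
  assumes a: "0 < a" and s: "0 \<le> s"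
  shows "Ga G1' a s = Ga G1' 1 (a ^ 3 * s) / a ^ 5"
proof -
  have "Ga G1' a s = integral {0..s} (\<lambda>x. G1' (a ^ 3 * x)) / a\<^sup>2"
    by (simp add: Ga_def Ga'_def[abs_def])
  also have "\<dots> = integral {0..a ^ 3 * s} G1' / a ^ 3 / a\<^sup>2"
    using a s by (subst integral_scale_atLeast0) auto
  also have "\<dots> = Ga G1' 1 (a ^ 3 * s) / a ^ 5"
    using a by (simp add: Ga_def Ga'_def[abs_def] field_simps flip: power_add)
  finally show ?thesis .
qed

lemma
  assumes nl: "nonlinearity_condition G1'" and a: "0 < a"
  shows Ga_cmod_has_derivative:
      "((\<lambda>z. Ga G1' a ((cmod z)\<^sup>2)) has_derivative (\<lambda>h. 2 * (Ga' G1' a ((cmod z)\<^sup>2) *\<^sub>R z \<bullet> h))) (at z)"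
    and continuous_Ga'_cmod:
      "continuous_on UNIV (\<lambda>z. Ga' G1' a ((cmod z)\<^sup>2) *\<^sub>R z)"
proof -
  define g where "g = (\<lambda>z::complex. if z = 0 then 0 else complex_of_real (G1' ((cmod z)\<^sup>2)) * z)"
  have der: "((\<lambda>w. complex_of_real (Ga G1' 1 ((cmod w)\<^sup>2))) has_derivative (\<lambda>h. g z * cnj h + cnj (g z) * h)) (at z)" for z
    using nl unfolding nonlinearity_condition_def Let_def g_def by blast
  have cont: "continuous_on UNIV g"
    using nl unfolding nonlinearity_condition_def Let_def g_def by blast
  \<comment> \<open>\<open>Ga G1' a\<close> at \<open>\<bar>z\<bar>\<^sup>2\<close> is, up to a factor, \<open>Ga G1' 1\<close> at \<open>\<bar>b z\<bar>\<^sup>2\<close>\<close>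
  define b where "b = sqrt (a ^ 3)"
  have b: "0 < b" and b2: "b\<^sup>2 = a ^ 3"
    using a by (simp_all add: b_def)
  have cb: "(cmod (b *\<^sub>R z))\<^sup>2 = a ^ 3 * (cmod z)\<^sup>2" for z
    by (simp add: power_mult_distrib b2)
  have gb: "g (b *\<^sub>R z) = (a\<^sup>2 * b) *\<^sub>R (Ga' G1' a ((cmod z)\<^sup>2) *\<^sub>R z)" for z
    using a b unfolding g_def cb by (simp add: Ga'_def scaleR_conv_of_real)
  have "continuous_on UNIV (\<lambda>z. (1 / (a\<^sup>2 * b)) *\<^sub>R g (b *\<^sub>R z))"
    by (intro continuous_intros continuous_on_compose2[OF cont]) auto
  then show "continuous_on UNIV (\<lambda>z. Ga' G1' a ((cmod z)\<^sup>2) *\<^sub>R z)"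
    unfolding gb using a b by simp
  have r: "((\<lambda>w. Ga G1' 1 ((cmod w)\<^sup>2)) has_derivative (\<lambda>h. 2 * (g z \<bullet> h))) (at z)" for z
  proof -
    have "((\<lambda>w. Re (complex_of_real (Ga G1' 1 ((cmod w)\<^sup>2)))) has_derivative (\<lambda>h. Re (g z * cnj h + cnj (g z) * h))) (at z)"
      by (rule bounded_linear.has_derivative[OF bounded_linear_Re der])
    then show ?thesis
      by (simp add: inner_complex_def algebra_simps)
  qed
  have "((\<lambda>z. b *\<^sub>R z) has_derivative (\<lambda>h. b *\<^sub>R h)) (at z)"
    by (intro bounded_linear_imp_has_derivative bounded_linear_scaleR_right)
  from has_derivative_compose[OF this r]
  have "((\<lambda>z. Ga G1' 1 ((cmod (b *\<^sub>R z))\<^sup>2)) has_derivative (\<lambda>h. 2 * (g (b *\<^sub>R z) \<bullet> (b *\<^sub>R h)))) (at z)" .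
  from bounded_linear.has_derivative[OF bounded_linear_divide this, of "a ^ 5"]
  have "((\<lambda>z. Ga G1' 1 (a ^ 3 * (cmod z)\<^sup>2) / a ^ 5) has_derivative
      (\<lambda>h. 2 * ((a\<^sup>2 * b) *\<^sub>R (Ga' G1' a ((cmod z)\<^sup>2) *\<^sub>R z) \<bullet> (b *\<^sub>R h)) / a ^ 5)) (at z)"
    unfolding cb gb .
  then have d: "((\<lambda>z. Ga G1' a ((cmod z)\<^sup>2)) has_derivative
      (\<lambda>h. 2 * ((a\<^sup>2 * b) *\<^sub>R (Ga' G1' a ((cmod z)\<^sup>2) *\<^sub>R z) \<bullet> (b *\<^sub>R h)) / a ^ 5)) (at z)"
    unfolding Ga_scaling[OF a zero_le_power2] .
  have s: "2 * ((a\<^sup>2 * b) *\<^sub>R w \<bullet> (b *\<^sub>R h)) / a ^ 5 = 2 * (w \<bullet> h)" for w h :: complex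
  proof -
    have "2 * ((a\<^sup>2 * b) *\<^sub>R w \<bullet> (b *\<^sub>R h)) / a ^ 5 = 2 * (w \<bullet> h) * (a\<^sup>2 * b\<^sup>2 / a ^ 5)"
      by (simp add: power2_eq_square)
    also have "a\<^sup>2 * b\<^sup>2 / a ^ 5 = 1"
      using a unfolding b2 by (simp flip: power_add)
    finally show ?thesis by simp
  qed
  show "((\<lambda>z. Ga G1' a ((cmod z)\<^sup>2)) has_derivative (\<lambda>h. 2 * (Ga' G1' a ((cmod z)\<^sup>2) *\<^sub>R z \<bullet> h))) (at z)"
    using d unfolding s .
qed

section \<open>Pointwise conservation laws\<close>

text \<open>On \<^typ>\<open>complex\<close> the inner product is \<open>z \<bullet> w = Re (z * cnj w)\<close>; multiplication by \<open>\<i>\<close> is skew.\<close>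

lemma complex_skew: "(\<i> * z) \<bullet> w = - (z \<bullet> (\<i> * w))"
  by (simp add: inner_complex_def)

lemma inner_ii_self: "z \<bullet> (\<i> * z) = 0"
  by (simp add: inner_complex_def)

text \<open>A solution of the NLS equation on a tube.\<close>

locale nls_tube = nls m q chi c G1' Tm Tp rhat + ball_tube Tm Tp rhat R
  for m q chi c :: real and G1' :: "real \<Rightarrow> real" and Tm Tp :: real
    and rhat :: "real \<Rightarrow> real^3" and R :: real +
  fixes a :: real and \<phi> :: "spacetime \<Rightarrow> real" and A :: "spacetime \<Rightarrow> real^3"
    and \<psi> :: "spacetime \<Rightarrow> complex"
  assumes m_pos: "0 < m" and q_pos: "0 < q" and chi_pos: "0 < chi" and c_pos: "0 < c" and a_pos: "0 < a"
    and nonlin: "nonlinearity_condition G1'"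
    and C1_phi: "C1_on S \<phi>" and C1_A: "C1_on S A" and C2_psi: "C2_on S \<psi>"
    and nls_eq: "nls_solution S a \<phi> A \<psi>"
begin

text \<open>The covariant derivatives of the solution in space and in time.\<close>

definition X :: "3 \<Rightarrow> spacetime \<Rightarrow> complex" where "X j = Dx S A j \<psi>"
definition Y :: "spacetime \<Rightarrow> complex" where "Y = Dt S \<phi> \<psi>"

text \<open>The coupling constants of the vector potential and of the scalar potential.\<close>

abbreviation "\<kappa> \<equiv> q / (chi * c)"
abbreviation "\<mu> \<equiv> q / chi"

lemma Dx_eq: "Dx S A j f p = pd_x S j f p - (\<kappa> * A p $ j) *\<^sub>R (\<i> * f p)"
  by (simp add: Dx_def scaleR_conv_of_real algebra_simps)

lemma Dt_eq: "Dt S \<phi> f p = pd_t S f p + (\<mu> * \<phi> p) *\<^sub>R (\<i> * f p)"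
  by (simp add: Dt_def scaleR_conv_of_real algebra_simps)

lemma C1_psi: "C1_on S \<psi>" and C1_D_psi: "C1_on S (\<lambda>p. D \<psi> p h)"
  using C2_psi unfolding C2_on_def by blast+

lemma C1_A_nth: "C1_on S (\<lambda>p. A p $ j)"
  by (rule C1_on_linear[OF bounded_linear_vec_nth C1_A])

lemma D_A_nth: "p \<in> S \<Longrightarrow> D (\<lambda>p. A p $ j) p h = D A p h $ j"
  by (rule D_linear[OF bounded_linear_vec_nth C1_A])

lemma
  assumes r: "C1_on S r" and f: "C1_on S f"
  shows C1_on_potential: "C1_on S (\<lambda>p. (k * r p) *\<^sub>R (\<i> * f p))"
    and D_potential: "p \<in> S \<Longrightarrow> D (\<lambda>p. (k * r p) *\<^sub>R (\<i> * f p)) p h =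
      (k * r p) *\<^sub>R (\<i> * D f p h) + (k * D r p h) *\<^sub>R (\<i> * f p)"
proof -
  have 1: "C1_on S (\<lambda>p. k * r p)" and 2: "C1_on S (\<lambda>p. \<i> * f p)"
    by (rule C1_on_linear[OF bounded_linear_mult_right r], rule C1_on_linear[OF bounded_linear_mult_right f])
  show "C1_on S (\<lambda>p. (k * r p) *\<^sub>R (\<i> * f p))"
    by (rule C1_on_bilinear[OF bounded_bilinear_scaleR 1 2])
  show "D (\<lambda>p. (k * r p) *\<^sub>R (\<i> * f p)) p h = (k * r p) *\<^sub>R (\<i> * D f p h) + (k * D r p h) *\<^sub>R (\<i> * f p)"
    if "p \<in> S"
    unfolding D_bilinear[OF bounded_bilinear_scaleR 1 2 that]
      D_linear[OF bounded_linear_mult_right r that] D_linear[OF bounded_linear_mult_right f that] ..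
qed

lemma X_eq: "X j = (\<lambda>p. D \<psi> p (0, axis j 1) + (- \<kappa> * A p $ j) *\<^sub>R (\<i> * \<psi> p))"
  by (simp add: fun_eq_iff X_def Dx_eq pd_x_def)

lemma Y_eq: "Y = (\<lambda>p. D \<psi> p (1, 0) + (\<mu> * \<phi> p) *\<^sub>R (\<i> * \<psi> p))"
  by (simp add: fun_eq_iff Y_def Dt_eq pd_t_def)

lemma C1_X: "C1_on S (X j)"
  unfolding X_eq by (rule C1_on_add[OF C1_D_psi C1_on_potential[OF C1_A_nth C1_psi]])

lemma C1_Y: "C1_on S Y"
  unfolding Y_eq by (rule C1_on_add[OF C1_D_psi C1_on_potential[OF C1_phi C1_psi]])

lemma D_X: "p \<in> S \<Longrightarrow> D (X j) p h = D (\<lambda>p. D \<psi> p (0, axis j 1)) p h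
    + (- \<kappa> * A p $ j) *\<^sub>R (\<i> * D \<psi> p h) + (- \<kappa> * D A p h $ j) *\<^sub>R (\<i> * \<psi> p)"
  unfolding X_eq D_add[OF C1_D_psi C1_on_potential[OF C1_A_nth C1_psi]]
    D_potential[OF C1_A_nth C1_psi] D_A_nth by simp

lemma D_Y: "p \<in> S \<Longrightarrow> D Y p h = D (\<lambda>p. D \<psi> p (1, 0)) p h
    + (\<mu> * \<phi> p) *\<^sub>R (\<i> * D \<psi> p h) + (\<mu> * D \<phi> p h) *\<^sub>R (\<i> * \<psi> p)"
  unfolding Y_eq D_add[OF C1_D_psi C1_on_potential[OF C1_phi C1_psi]]
    D_potential[OF C1_phi C1_psi] by simp

text \<open>The potentials drop out, as they enter through skew operators.\<close>

lemma
  fixes f g :: "spacetime \<Rightarrow> complex"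
  assumes f: "C1_on S f" and g: "C1_on S g"
  shows C1_on_inner: "C1_on S (\<lambda>p. f p \<bullet> g p)"
    and covariant_Leibniz_x:
      "p \<in> S \<Longrightarrow> pd_x S k (\<lambda>p. f p \<bullet> g p) p = Dx S A k f p \<bullet> g p + f p \<bullet> Dx S A k g p"
    and covariant_Leibniz_t:
      "p \<in> S \<Longrightarrow> pd_t S (\<lambda>p. f p \<bullet> g p) p = Dt S \<phi> f p \<bullet> g p + f p \<bullet> Dt S \<phi> g p"
proof -
  show "C1_on S (\<lambda>p. f p \<bullet> g p)"
    by (rule C1_on_bilinear[OF bounded_bilinear_inner f g])
  note D = D_bilinear[OF bounded_bilinear_inner f g]
  show "pd_x S k (\<lambda>p. f p \<bullet> g p) p = Dx S A k f p \<bullet> g p + f p \<bullet> Dx S A k g p" if "p \<in> S"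
    unfolding Dx_eq pd_x_def D[OF that] by (simp add: inner_diff complex_skew)
  show "pd_t S (\<lambda>p. f p \<bullet> g p) p = Dt S \<phi> f p \<bullet> g p + f p \<bullet> Dt S \<phi> g p" if "p \<in> S"
    unfolding Dt_eq pd_t_def D[OF that] by (simp add: inner_add complex_skew)
qed

lemma C1_ii: "C1_on S f \<Longrightarrow> C1_on S (\<lambda>p. \<i> * f p)"
  by (rule C1_on_linear[OF bounded_linear_mult_right])

lemma Dx_ii: "C1_on S f \<Longrightarrow> p \<in> S \<Longrightarrow> Dx S A k (\<lambda>p. \<i> * f p) p = \<i> * Dx S A k f p"
  unfolding Dx_def pd_x_def by (simp add: D_linear[OF bounded_linear_mult_right] algebra_simps)

lemma Dt_ii: "C1_on S f \<Longrightarrow> p \<in> S \<Longrightarrow> Dt S \<phi> (\<lambda>p. \<i> * f p) p = \<i> * Dt S \<phi> f p"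
  unfolding Dt_def pd_t_def by (simp add: D_linear[OF bounded_linear_mult_right] algebra_simps)

lemma Dxs_cnj: "p \<in> S \<Longrightarrow> Dxs S A j (\<lambda>p. cnj (\<psi> p)) p = cnj (X j p)"
  unfolding X_def Dxs_def Dx_def pd_x_def by (simp add: D_linear[OF bounded_linear_cnj C1_psi])

lemma Dts_cnj: "p \<in> S \<Longrightarrow> Dts S \<phi> (\<lambda>p. cnj (\<psi> p)) p = cnj (Y p)"
  unfolding Y_def Dts_def Dt_def pd_t_def by (simp add: D_linear[OF bounded_linear_cnj C1_psi])

lemma rho_eq: "rho \<psi> p = q * (\<psi> p \<bullet> \<psi> p)"
  by (simp add: rho_def inner_complex_def power2_eq_square)

lemma P_eq: "p \<in> S \<Longrightarrow> P S A \<psi> p = (\<chi> j. chi * (X j p \<bullet> (\<i> * \<psi> p)))"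
  unfolding P_def X_def[symmetric]
  by (simp add: vec_eq_iff Dxs_cnj inner_complex_def field_simps flip: X_def)

lemma J_eq_P: "J S A \<psi> p = (q / m) *\<^sub>R P S A \<psi> p"
  by (simp add: vec_eq_iff J_def P_def algebra_simps add_divide_distrib diff_divide_distrib)

lemma T_eq:
  assumes p: "p \<in> S"
  shows "T S a \<phi> A \<psi> p i j = chi\<^sup>2 / m * (X i p \<bullet> X j p)
    + (if i = j then - u S a A \<psi> p - chi * (Y p \<bullet> (\<i> * \<psi> p)) else 0)"
  unfolding T_def Let_def Dxs_cnj[OF p] Dts_cnj[OF p] X_def[symmetric] Y_def[symmetric]
  using m_pos by (simp add: inner_complex_def field_simps power2_eq_square)

lemma u_eq: "u S a A \<psi> p = chi\<^sup>2 / (2 * m) * ((\<Sum>j\<in>UNIV. X j p \<bullet> X j p) + Ga G1' a ((cmod (\<psi> p))\<^sup>2))"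
  by (simp add: u_def X_def power2_norm_eq_inner)

text \<open>The factor of \<open>\<psi>\<close> in the nonlinear term.\<close>

definition nl_factor :: "spacetime \<Rightarrow> real" where "nl_factor p = Ga' G1' a ((cmod (\<psi> p))\<^sup>2)"

lemma
  shows C1_Ga: "C1_on S (\<lambda>p. Ga G1' a ((cmod (\<psi> p))\<^sup>2))"
    and D_Ga: "p \<in> S \<Longrightarrow> D (\<lambda>p. Ga G1' a ((cmod (\<psi> p))\<^sup>2)) p h = 2 * (nl_factor p *\<^sub>R \<psi> p \<bullet> D \<psi> p h)"
proof -
  have "continuous_on S (\<lambda>p. Ga' G1' a ((cmod (\<psi> p))\<^sup>2) *\<^sub>R \<psi> p)"
    by (rule continuous_on_compose2[OF continuous_Ga'_cmod[OF nonlin a_pos] C1_on_continuous[OF C1_psi]]) auto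
  then have c: "continuous_on S (\<lambda>p. 2 * (Ga' G1' a ((cmod (\<psi> p))\<^sup>2) *\<^sub>R \<psi> p \<bullet> D \<psi> p h))" for h
    by (intro continuous_on_mult_left continuous_on_inner C1_on_continuous_derivative[OF C1_psi])
  note k = Ga_cmod_has_derivative[OF nonlin a_pos]
  show "C1_on S (\<lambda>p. Ga G1' a ((cmod (\<psi> p))\<^sup>2))"
    by (rule C1_on_compose[OF C1_psi k c])
  show "D (\<lambda>p. Ga G1' a ((cmod (\<psi> p))\<^sup>2)) p h = 2 * (nl_factor p *\<^sub>R \<psi> p \<bullet> D \<psi> p h)" if "p \<in> S"
    unfolding nl_factor_def by (rule D_compose[OF C1_psi k c that])
qed

lemma pd_x_Ga:
  assumes "p \<in> S"
  shows "pd_x S k (\<lambda>p. Ga G1' a ((cmod (\<psi> p))\<^sup>2)) p = 2 * nl_factor p * (\<psi> p \<bullet> X k p)"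
  unfolding pd_x_def D_Ga[OF assms] X_eq by (simp add: inner_add inner_diff inner_ii_self)

text \<open>The NLS equation solved for the covariant Laplacian.\<close>

lemma wave_equation:
  assumes "p \<in> S"
  shows "(\<Sum>j\<in>UNIV. Dx S A j (X j) p) = nl_factor p *\<^sub>R \<psi> p - (2 * m / chi) *\<^sub>R (\<i> * Y p)"
proof -
  have "\<i> * Y p = (chi / (2 * m)) *\<^sub>R (- (\<Sum>j\<in>UNIV. Dx S A j (X j) p) + nl_factor p *\<^sub>R \<psi> p)"
    using nls_eq assms unfolding nls_solution_def X_def Y_def nl_factor_def scaleR_conv_of_real by blast
  then show ?thesis
    using m_pos chi_pos by simp
qed

lemma pd_t_rho:
  assumes p: "p \<in> S"
  shows "pd_t S (rho \<psi>) p = 2 * q * (Y p \<bullet> \<psi> p)"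
proof -
  have e: "rho \<psi> = (\<lambda>p. q * (\<psi> p \<bullet> \<psi> p))"
    by (simp add: fun_eq_iff rho_eq)
  show ?thesis
    unfolding pd_t_def e D_linear[OF bounded_linear_mult_right C1_on_inner[OF C1_psi C1_psi] p]
    using covariant_Leibniz_t[OF C1_psi C1_psi p]
    by (simp add: pd_t_def Y_def inner_commute)
qed

lemma C1_rho: "C1_on S (rho \<psi>)"
proof -
  have e: "rho \<psi> = (\<lambda>p. q * (\<psi> p \<bullet> \<psi> p))"
    by (simp add: fun_eq_iff rho_eq)
  show ?thesis
    unfolding e by (rule C1_on_linear[OF bounded_linear_mult_right C1_on_inner[OF C1_psi C1_psi]])
qed

text \<open>The components of the momentum density \<open>P\<close> on the tube.\<close>

definition P_comp :: "3 \<Rightarrow> spacetime \<Rightarrow> real" where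
  "P_comp j = (\<lambda>z. chi * (X j z \<bullet> (\<i> * \<psi> z)))"

lemma C1_P_comp: "C1_on S (P_comp j)"
  unfolding P_comp_def
  by (rule C1_on_linear[OF bounded_linear_mult_right C1_on_inner[OF C1_X C1_ii[OF C1_psi]]])

lemma pd_x_P_comp:
  assumes z: "z \<in> S"
  shows "pd_x S k (P_comp j) z = chi * (Dx S A k (X j) z \<bullet> (\<i> * \<psi> z) + X j z \<bullet> (\<i> * X k z))"
  using covariant_Leibniz_x[OF C1_X C1_ii[OF C1_psi] z, of k j]
  unfolding pd_x_def P_comp_def D_linear[OF bounded_linear_mult_right C1_on_inner[OF C1_X C1_ii[OF C1_psi]] z]
    Dx_ii[OF C1_psi z] by (simp add: X_def)

lemma pd_t_P_comp:
  assumes z: "z \<in> S"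
  shows "pd_t S (P_comp j) z = chi * (Dt S \<phi> (X j) z \<bullet> (\<i> * \<psi> z) + X j z \<bullet> (\<i> * Y z))"
  using covariant_Leibniz_t[OF C1_X C1_ii[OF C1_psi] z, of j]
  unfolding pd_t_def P_comp_def D_linear[OF bounded_linear_mult_right C1_on_inner[OF C1_X C1_ii[OF C1_psi]] z]
    Dt_ii[OF C1_psi z] by (simp add: Y_def)

text \<open>Charge conservation; the current \<open>J\<close> is \<open>q / m\<close> times the momentum density.\<close>

theorem continuity_equation:
  assumes z: "z \<in> S"
  shows "pd_t S (rho \<psi>) z + (q / m) * (\<Sum>j\<in>UNIV. pd_x S j (P_comp j) z) = 0"
proof -
  have "(\<Sum>j\<in>UNIV. pd_x S j (P_comp j) z) = chi * ((\<Sum>j\<in>UNIV. Dx S A j (X j) z) \<bullet> (\<i> * \<psi> z))"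
    by (simp add: pd_x_P_comp[OF z] inner_ii_self inner_sum_left sum_distrib_left)
  also have "\<dots> = - 2 * m * (Y z \<bullet> \<psi> z)"
    unfolding wave_equation[OF z] using chi_pos
    by (simp add: inner_diff_left inner_ii_self complex_skew)
  finally show ?thesis
    using m_pos by (simp add: pd_t_rho[OF z])
qed

text \<open>The components of the stress tensor \<open>T\<close> on the tube. The sum over \<open>k\<close> and the term with \<open>Ga\<close> form
  the energy density \<open>u\<close>, up to the factor in front of them.\<close>

definition \<tau> :: "3 \<Rightarrow> 3 \<Rightarrow> spacetime \<Rightarrow> real" where
  "\<tau> i j = (\<lambda>z. chi\<^sup>2 / m * (X i z \<bullet> X j z)
    + (if i = j then - (chi\<^sup>2 / (2 * m)) * ((\<Sum>k\<in>UNIV. X k z \<bullet> X k z) + Ga G1' a ((cmod (\<psi> z))\<^sup>2))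
        + - chi * (Y z \<bullet> (\<i> * \<psi> z)) else 0))"

lemma T_eq_tau: "z \<in> S \<Longrightarrow> T S a \<phi> A \<psi> z i j = \<tau> i j z"
  unfolding T_eq u_eq \<tau>_def by simp

lemma
  shows C1_energy: "C1_on S (\<lambda>z. (\<Sum>k\<in>UNIV. X k z \<bullet> X k z) + Ga G1' a ((cmod (\<psi> z))\<^sup>2))"
    and D_energy: "z \<in> S \<Longrightarrow> pd_x S i (\<lambda>z. (\<Sum>k\<in>UNIV. X k z \<bullet> X k z) + Ga G1' a ((cmod (\<psi> z))\<^sup>2)) z
      = 2 * (\<Sum>k\<in>UNIV. X k z \<bullet> Dx S A i (X k) z) + 2 * nl_factor z * (\<psi> z \<bullet> X i z)"
proof -
  have C: "C1_on S (\<lambda>z. X k z \<bullet> X k z)" for k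
    by (rule C1_on_inner[OF C1_X C1_X])
  have 1: "C1_on S (\<lambda>z. \<Sum>k\<in>UNIV. X k z \<bullet> X k z)"
    by (rule C1_on_sum[OF finite C])
  show "C1_on S (\<lambda>z. (\<Sum>k\<in>UNIV. X k z \<bullet> X k z) + Ga G1' a ((cmod (\<psi> z))\<^sup>2))"
    by (rule C1_on_add[OF 1 C1_Ga])
  show "pd_x S i (\<lambda>z. (\<Sum>k\<in>UNIV. X k z \<bullet> X k z) + Ga G1' a ((cmod (\<psi> z))\<^sup>2)) z
      = 2 * (\<Sum>k\<in>UNIV. X k z \<bullet> Dx S A i (X k) z) + 2 * nl_factor z * (\<psi> z \<bullet> X i z)" if z: "z \<in> S"
    unfolding pd_x_def D_add[OF 1 C1_Ga z] D_sum[OF finite C z]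
    unfolding pd_x_def[symmetric] pd_x_Ga[OF z] covariant_Leibniz_x[OF C1_X C1_X z]
    by (simp add: inner_commute sum_distrib_left)
qed

lemma
  shows C1_tau: "C1_on S (\<tau> i j)"
    and pd_x_tau: "z \<in> S \<Longrightarrow> pd_x S k (\<tau> i j) z =
      chi\<^sup>2 / m * (Dx S A k (X i) z \<bullet> X j z + X i z \<bullet> Dx S A k (X j) z)
      + (if i = j then - (chi\<^sup>2 / (2 * m)) * (2 * (\<Sum>l\<in>UNIV. X l z \<bullet> Dx S A k (X l) z) + 2 * nl_factor z * (\<psi> z \<bullet> X k z))
          - chi * (Dx S A k Y z \<bullet> (\<i> * \<psi> z) + Y z \<bullet> (\<i> * X k z)) else 0)"
proof -
  note I = C1_on_inner[OF C1_X C1_X, of i j]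
  note a = C1_on_linear[OF bounded_linear_mult_right[of "chi\<^sup>2 / m"] I]
  note b = C1_on_linear[OF bounded_linear_mult_right[of "- (chi\<^sup>2 / (2 * m))"] C1_energy]
  note YI = C1_on_inner[OF C1_Y C1_ii[OF C1_psi]]
  note d = C1_on_linear[OF bounded_linear_mult_right[of "- chi"] YI]
  note bd = C1_on_add[OF b d]
  show "C1_on S (\<tau> i j)"
  proof (cases "i = j")
    case True
    show ?thesis unfolding \<tau>_def if_P[OF True] by (rule C1_on_add[OF a bd])
  next
    case False
    show ?thesis unfolding \<tau>_def if_not_P[OF False] add_0_right by (rule a)
  qed
  assume z: "z \<in> S"
  have da: "D (\<lambda>z. chi\<^sup>2 / m * (X i z \<bullet> X j z)) z (0, axis k 1) =
      chi\<^sup>2 / m * (Dx S A k (X i) z \<bullet> X j z + X i z \<bullet> Dx S A k (X j) z)"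
    using covariant_Leibniz_x[OF C1_X C1_X z, of k i j]
    unfolding D_linear[OF bounded_linear_mult_right[of "chi\<^sup>2 / m"] I z] pd_x_def by simp
  show "pd_x S k (\<tau> i j) z =
      chi\<^sup>2 / m * (Dx S A k (X i) z \<bullet> X j z + X i z \<bullet> Dx S A k (X j) z)
      + (if i = j then - (chi\<^sup>2 / (2 * m)) * (2 * (\<Sum>l\<in>UNIV. X l z \<bullet> Dx S A k (X l) z) + 2 * nl_factor z * (\<psi> z \<bullet> X k z))
          - chi * (Dx S A k Y z \<bullet> (\<i> * \<psi> z) + Y z \<bullet> (\<i> * X k z)) else 0)"
  proof (cases "i = j")
    case True
    have db: "D (\<lambda>z. - (chi\<^sup>2 / (2 * m)) * ((\<Sum>k\<in>UNIV. X k z \<bullet> X k z) + Ga G1' a ((cmod (\<psi> z))\<^sup>2))) z (0, axis k 1) =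
        - (chi\<^sup>2 / (2 * m)) * (2 * (\<Sum>l\<in>UNIV. X l z \<bullet> Dx S A k (X l) z) + 2 * nl_factor z * (\<psi> z \<bullet> X k z))"
      unfolding D_linear[OF bounded_linear_mult_right[of "- (chi\<^sup>2 / (2 * m))"] C1_energy z]
      using D_energy[OF z, of k] unfolding pd_x_def by (simp only:)
    have dd: "D (\<lambda>z. - chi * (Y z \<bullet> (\<i> * \<psi> z))) z (0, axis k 1) =
        - chi * (Dx S A k Y z \<bullet> (\<i> * \<psi> z) + Y z \<bullet> (\<i> * X k z))"
      unfolding D_linear[OF bounded_linear_mult_right[of "- chi"] YI z]
      using covariant_Leibniz_x[OF C1_Y C1_ii[OF C1_psi] z, of k]
      unfolding pd_x_def Dx_ii[OF C1_psi z] X_def by (simp only:)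
    show ?thesis
      unfolding pd_x_def \<tau>_def if_P[OF True] D_add[OF a bd z] D_add[OF b d z] da db dd by simp
  next
    case False
    show ?thesis
      unfolding pd_x_def \<tau>_def if_not_P[OF False] add_0_right by (rule da)
  qed
qed

text \<open>The commutators of covariant derivatives are multiplication by the components of the
  electric and of the magnetic field, up to imaginary factors. Second derivatives of the solution have to commute, which restricts the statements to interior
  points.\<close>

lemma commutator_tx:
  assumes z: "z \<in> inner_tube"
  shows "Dt S \<phi> (X j) z - Dx S A j Y z = (\<mu> * electric_field c S \<phi> A z $ j) *\<^sub>R (\<i> * \<psi> z)"
proof -
  have zS: "z \<in> S" using z inner_tube_subset by blast
  show ?thesis
    unfolding Dt_eq Dx_eq pd_t_def pd_x_def D_X[OF zS] D_Y[OF zS] second_derivative_symmetric[OF C2_psi z, of "(0, axis j 1)" "(1, 0)"]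
    unfolding electric_field_def grad_def pd_t_def pd_x_def X_eq Y_eq
    by (simp add: complex_eq_iff algebra_simps diff_divide_distrib add_divide_distrib)
qed

lemma commutator_xx:
  assumes z: "z \<in> inner_tube"
  shows "Dx S A i (X j) z - Dx S A j (X i) z =
    - (\<kappa> * (pd_x S i A z $ j - pd_x S j A z $ i)) *\<^sub>R (\<i> * \<psi> z)"
proof -
  have zS: "z \<in> S" using z inner_tube_subset by blast
  show ?thesis
    unfolding Dx_eq pd_x_def D_X[OF zS] second_derivative_symmetric[OF C2_psi z, of "(0, axis j 1)" "(0, axis i 1)"]
    unfolding X_eq
    by (simp add: complex_eq_iff algebra_simps diff_divide_distrib add_divide_distrib)
qed

text \<open>With the NLS equation inserted for the covariant Laplacian, the terms with \<open>nl_factor\<close> and with \<open>Y\<close>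
  cancel, and so do the derivatives of the energy density against those of \<open>X i \<bullet> X j\<close>.
  What remains are the commutators, which form the Lorentz force density.\<close>

theorem momentum_balance:
  assumes z: "z \<in> inner_tube"
  shows "pd_t S (P_comp j) z + (\<Sum>i\<in>UNIV. pd_x S i (\<tau> i j) z) =
    rho \<psi> z * electric_field c S \<phi> A z $ j + (1 / c) * cross3 (J S A \<psi> z) (curl S A z) $ j"
proof -
  have zS: "z \<in> S" using z inner_tube_subset by blast
  let ?Z = "\<lambda>k l. Dx S A k (X l) z" and ?f = "\<lambda>i j. pd_x S i A z $ j - pd_x S j A z $ i"
  have Jn: "J S A \<psi> z $ i = (q / m) * (chi * (X i z \<bullet> (\<i> * \<psi> z)))" for i
    by (simp add: J_eq_P P_eq[OF zS])
  have lorentz: "(1 / c) * cross3 (J S A \<psi> z) (curl S A z) $ j = - (1 / c) * (\<Sum>i\<in>UNIV. ?f i j * J S A \<psi> z $ i)"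
  proof -
    consider "j = 1" | "j = 2" | "j = 3" using exhaust_3 by blast
    then show ?thesis
      by cases (simp_all add: cross3_def curl_def sum_3 algebra_simps diff_divide_distrib add_divide_distrib)
  qed
  have div: "(\<Sum>i\<in>UNIV. pd_x S i (\<tau> i j) z) =
      chi\<^sup>2 / m * ((\<Sum>i\<in>UNIV. ?Z i i) \<bullet> X j z + (\<Sum>i\<in>UNIV. X i z \<bullet> ?Z i j))
      - (chi\<^sup>2 / (2 * m)) * (2 * (\<Sum>l\<in>UNIV. X l z \<bullet> ?Z j l) + 2 * nl_factor z * (\<psi> z \<bullet> X j z))
          - chi * (Dx S A j Y z \<bullet> (\<i> * \<psi> z) + Y z \<bullet> (\<i> * X j z))"
    unfolding pd_x_tau[OF zS] sum.distrib
    by (simp add: sum_distrib_left inner_sum_left sum.distrib sum_negf algebra_simps)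
  have comm: "(\<Sum>i\<in>UNIV. X i z \<bullet> ?Z i j) = (\<Sum>i\<in>UNIV. X i z \<bullet> ?Z j i)
      - \<kappa> * (\<Sum>i\<in>UNIV. ?f i j * (X i z \<bullet> (\<i> * \<psi> z)))"
  proof -
    have "X i z \<bullet> ?Z i j = X i z \<bullet> ?Z j i - \<kappa> * (?f i j * (X i z \<bullet> (\<i> * \<psi> z)))" for i
    proof -
      have "?Z i j = ?Z j i + - (\<kappa> * ?f i j) *\<^sub>R (\<i> * \<psi> z)"
        using commutator_xx[OF z, of i j] by (simp add: algebra_simps)
      then show ?thesis by (simp add: inner_diff_right)
    qed
    then show ?thesis by (simp add: sum_subtractf sum_distrib_left)
  qed
  have tx: "Dt S \<phi> (X j) z = Dx S A j Y z + (\<mu> * electric_field c S \<phi> A z $ j) *\<^sub>R (\<i> * \<psi> z)"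
    using commutator_tx[OF z, of j] by (simp add: algebra_simps)
  have n: "(\<i> * \<psi> z) \<bullet> (\<i> * \<psi> z) = \<psi> z \<bullet> \<psi> z"
    by (simp add: inner_complex_def)
  define W where "W = (\<Sum>i\<in>UNIV. ?f i j * (X i z \<bullet> (\<i> * \<psi> z)))"
  define K where "K = (\<Sum>i\<in>UNIV. X i z \<bullet> ?Z j i)"
  have sk: "Y z \<bullet> (\<i> * X j z) = - (X j z \<bullet> (\<i> * Y z))"
    by (simp add: inner_complex_def)
  have L: "(\<Sum>i\<in>UNIV. ?f i j * J S A \<psi> z $ i) = (q * chi / m) * W"
    by (simp add: Jn W_def sum_distrib_left algebra_simps diff_divide_distrib)
  show ?thesis
    unfolding lorentz L pd_t_P_comp[OF zS] div comm wave_equation[OF zS] tx W_def[symmetric] K_def[symmetric]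
      rho_eq sk inner_add_left inner_diff_left inner_scaleR_left n
    using m_pos chi_pos c_pos
    by (simp add: inner_commute[of "\<psi> z" "X j z"] inner_commute[of "\<i> * Y z" "X j z"] field_simps power2_eq_square)
qed

end

section \<open>Balance laws on the moving ball\<close>

lemma (in ball_tube) time_FTC:
  fixes f :: "real \<Rightarrow> 'b::euclidean_space"
  assumes f: "continuous_on {Tm..Tp} f"
    and F: "\<And>t. t \<in> {Tm..Tp} \<Longrightarrow> (F has_vector_derivative f t) (at t within {Tm..Tp})"
    and t: "t0 \<in> {Tm..Tp}" "t \<in> {Tm..Tp}"
  shows "(LBINT s=ereal t0..ereal t. f s) = F t - F t0"
proof (rule interval_integral_FTC_finite)
  have sub: "{min t0 t..max t0 t} \<subseteq> {Tm..Tp}" using t by auto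
  show "continuous_on {min t0 t..max t0 t} f"
    by (rule continuous_on_subset[OF f sub])
  show "(F has_vector_derivative f s) (at s within {min t0 t..max t0 t})"
    if "min t0 t \<le> s" "s \<le> max t0 t" for s
    by (rule has_vector_derivative_within_subset[OF F sub]) (use that t in auto)
qed

lemma (in ball_tube) antiderivative:
  fixes f :: "real \<Rightarrow> 'b::euclidean_space"
  assumes "continuous_on {Tm..Tp} f" "t0 \<in> {Tm..Tp}"
  shows "t \<in> {Tm..Tp} \<Longrightarrow>
    ((\<lambda>t. LBINT s=ereal t0..ereal t. f s) has_vector_derivative f t) (at t within {Tm..Tp})"
proof -
  define F where "F t = integral {Tm..t} f" for t
  have F: "(F has_vector_derivative f t) (at t within {Tm..Tp})" if "t \<in> {Tm..Tp}" for t
    unfolding F_def by (rule integral_has_vector_derivative[OF assms(1) that])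
  assume t: "t \<in> {Tm..Tp}"
  have "((\<lambda>t. F t - F t0) has_vector_derivative f t) (at t within {Tm..Tp})"
    using has_vector_derivative_diff[OF F[OF t] has_vector_derivative_const] by simp
  then show ?thesis
    by (rule has_vector_derivative_transform[OF t, rotated]) (rule time_FTC[OF assms(1) F assms(2)])
qed

lemma (in ball_tube)
  fixes f g :: "real \<Rightarrow> 'b::euclidean_space"
  assumes f: "continuous_on {Tm..Tp} f" and g: "continuous_on {Tm..Tp} g"
    and t: "t0 \<in> {Tm..Tp}" "t \<in> {Tm..Tp}"
  shows time_integral_add: "(LBINT s=ereal t0..ereal t. f s + g s) =
      (LBINT s=ereal t0..ereal t. f s) + (LBINT s=ereal t0..ereal t. g s)"
    and time_integral_diff: "(LBINT s=ereal t0..ereal t. f s - g s) =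
      (LBINT s=ereal t0..ereal t. f s) - (LBINT s=ereal t0..ereal t. g s)"
proof -
  let ?F = "\<lambda>t. LBINT s=ereal t0..ereal t. f s" and ?G = "\<lambda>t. LBINT s=ereal t0..ereal t. g s"
  note F = antiderivative[OF f t(1)] and G = antiderivative[OF g t(1)]
  have z: "?F t0 = 0" "?G t0 = 0" by simp_all
  have "(LBINT s=ereal t0..ereal t. f s + g s) = (?F t + ?G t) - (?F t0 + ?G t0)"
    by (intro time_FTC[where F="\<lambda>t. ?F t + ?G t"] continuous_intros f g has_vector_derivative_add F G t)
  then show "(LBINT s=ereal t0..ereal t. f s + g s) = ?F t + ?G t" using z by simp
  have "(LBINT s=ereal t0..ereal t. f s - g s) = (?F t - ?G t) - (?F t0 - ?G t0)"
    by (intro time_FTC[where F="\<lambda>t. ?F t - ?G t"] continuous_intros f g has_vector_derivative_diff F G t)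
  then show "(LBINT s=ereal t0..ereal t. f s - g s) = ?F t - ?G t" using z by simp
qed

context nls_tube
begin

text \<open>Integrals over the ball and the sphere at time \<open>t\<close>.\<close>

abbreviation ball_integral :: "(spacetime \<Rightarrow> 'b::euclidean_space) \<Rightarrow> real \<Rightarrow> 'b" where
  "ball_integral f t \<equiv> LINT x:cball (rhat t) R|lborel. f (t, x)"

abbreviation sphere_integral :: "(real \<Rightarrow> real^3 \<Rightarrow> 'b::euclidean_space) \<Rightarrow> real \<Rightarrow> 'b" where
  "sphere_integral h t \<equiv> LINT x|sphere_measure (rhat t) R. h t x"

text \<open>
  The fluxes through the sphere: of charge and of momentum carried by the motion of the ball, of the
  current and of the stress, and the first moments of the two charge fluxes.
\<close>

abbreviation "rho_flux \<equiv> sphere_integral (\<lambda>t x. (v t \<bullet> normal R t x) * rho \<psi> (t, x))"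
abbreviation "J_flux \<equiv> sphere_integral (\<lambda>t x. normal R t x \<bullet> J S A \<psi> (t, x))"
abbreviation "rho_x_flux \<equiv> sphere_integral (\<lambda>t x. ((v t \<bullet> normal R t x) * rho \<psi> (t, x)) *\<^sub>R x)"
abbreviation "J_x_flux \<equiv> sphere_integral (\<lambda>t x. (normal R t x \<bullet> J S A \<psi> (t, x)) *\<^sub>R x)"
abbreviation "P_flux \<equiv> sphere_integral (\<lambda>t x. (v t \<bullet> normal R t x) *\<^sub>R P S A \<psi> (t, x))"
abbreviation "T_flux \<equiv> sphere_integral (\<lambda>t x. \<chi> k. \<Sum>i\<in>UNIV. normal R t x $ i * T S a \<phi> A \<psi> (t, x) i k)"

lemma ball_integral_cong:
  assumes "t \<in> {Tm..Tp}" "\<And>z. z \<in> S \<Longrightarrow> f z = g z"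
  shows "ball_integral f t = ball_integral g t"
  using assms by (intro set_lebesgue_integral_cong) (auto simp: mem_tube)

lemma ball_integral_add:
  assumes "t \<in> {Tm..Tp}" "continuous_on S f" "continuous_on S g"
  shows "ball_integral (\<lambda>z. f z + g z) t = ball_integral f t + ball_integral g t"
  by (intro set_integral_add set_integrable_compact compact_cball continuous_on_slice assms)

lemma ball_integral_diff:
  assumes "t \<in> {Tm..Tp}" "continuous_on S f" "continuous_on S g"
  shows "ball_integral (\<lambda>z. f z - g z) t = ball_integral f t - ball_integral g t"
  by (intro set_integral_diff set_integrable_compact compact_cball continuous_on_slice assms)

lemma ball_integral_linear:
  assumes "bounded_linear k" "t \<in> {Tm..Tp}" "continuous_on S f"
  shows "ball_integral (\<lambda>z. k (f z)) t = k (ball_integral f t)"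
proof -
  have "integrable lborel (\<lambda>x. indicator (cball (rhat t) R) x *\<^sub>R f (t, x))"
    using set_integrable_compact[OF compact_cball continuous_on_slice[OF assms(3,2)]]
    by (simp add: set_integrable_def)
  from integral_bounded_linear[OF assms(1) this] show ?thesis
    unfolding set_lebesgue_integral_def
    by (simp add: linear_scale[OF bounded_linear.linear[OF assms(1)]])
qed

lemma continuous_pd:
  assumes "C1_on S f"
  shows "continuous_on S (pd_t S f)" "continuous_on S (pd_x S i f)"
  using C1_on_continuous_derivative[OF assms] unfolding pd_t_def pd_x_def by auto

lemma continuous_velocity_tube: "continuous_on S (\<lambda>z. v (fst z) $ i)"
  by (intro continuous_on_component continuous_on_compose2[OF continuous_velocity] continuous_intros)
     (auto simp: tube_def)

lemma sphere_slice:
  assumes "continuous_on S f" "t \<in> {Tm..Tp}"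
  shows "continuous_on (sphere (rhat t) R) (\<lambda>x. f (t, x))"
  using continuous_on_slice[OF assms] sphere_cball by (rule continuous_on_subset)

lemma continuous_normal: "continuous_on B (\<lambda>x. normal R t x)"
  unfolding normal_def by (intro continuous_intros)

lemma
  fixes f :: "3 \<Rightarrow> spacetime \<Rightarrow> 'b::euclidean_space"
  assumes f: "\<And>i. C1_on S (f i)"
  shows flux_eq: "t \<in> {Tm..Tp} \<Longrightarrow>
      sphere_integral (\<lambda>t x. \<Sum>i\<in>UNIV. normal R t x $ i *\<^sub>R f i (t, x)) t =
      ball_integral (\<lambda>z. \<Sum>i\<in>UNIV. pd_x S i (f i) z) t"
    and continuous_flux: "continuous_on {Tm..Tp}
      (sphere_integral (\<lambda>t x. \<Sum>i\<in>UNIV. normal R t x $ i *\<^sub>R f i (t, x)))"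
proof -
  show 1: "sphere_integral (\<lambda>t x. \<Sum>i\<in>UNIV. normal R t x $ i *\<^sub>R f i (t, x)) t =
      ball_integral (\<lambda>z. \<Sum>i\<in>UNIV. pd_x S i (f i) z) t" if "t \<in> {Tm..Tp}" for t
    unfolding normal_def by (rule divergence_theorem_slice[OF f that, symmetric])
  have "continuous_on {Tm..Tp} (ball_integral (\<lambda>z. \<Sum>i\<in>UNIV. pd_x S i (f i) z))"
    by (intro continuous_ball_integral continuous_intros continuous_pd f)
  then show "continuous_on {Tm..Tp}
      (sphere_integral (\<lambda>t x. \<Sum>i\<in>UNIV. normal R t x $ i *\<^sub>R f i (t, x)))"
    by (rule continuous_on_eq) (simp add: 1)
qed

text \<open>At a fixed time the velocity of the ball is a constant vector, so it does not contribute to the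
  divergence.\<close>

lemma
  fixes g :: "spacetime \<Rightarrow> 'b::euclidean_space"
  assumes g: "C1_on S g"
  shows moving_flux_eq: "t \<in> {Tm..Tp} \<Longrightarrow>
      sphere_integral (\<lambda>t x. (v t \<bullet> normal R t x) *\<^sub>R g (t, x)) t =
      ball_integral (\<lambda>z. \<Sum>i\<in>UNIV. v (fst z) $ i *\<^sub>R pd_x S i g z) t"
    and continuous_moving_flux: "continuous_on {Tm..Tp}
      (sphere_integral (\<lambda>t x. (v t \<bullet> normal R t x) *\<^sub>R g (t, x)))"
proof -
  show 1: "sphere_integral (\<lambda>t x. (v t \<bullet> normal R t x) *\<^sub>R g (t, x)) t =
      ball_integral (\<lambda>z. \<Sum>i\<in>UNIV. v (fst z) $ i *\<^sub>R pd_x S i g z) t" if t: "t \<in> {Tm..Tp}" for t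
  proof -
    have C: "C1_on S (\<lambda>z. v t $ i *\<^sub>R g z)" for i
      by (rule C1_on_linear[OF bounded_linear_scaleR_right g])
    have "sphere_integral (\<lambda>t x. (v t \<bullet> normal R t x) *\<^sub>R g (t, x)) t =
        (LINT x|sphere_measure (rhat t) R. (\<Sum>i\<in>UNIV. normal R t x $ i *\<^sub>R (v t $ i *\<^sub>R g (t, x))))"
      by (simp add: inner_vec_def mult.commute flip: scaleR_sum_left)
    also have "\<dots> = ball_integral (\<lambda>z. \<Sum>i\<in>UNIV. pd_x S i (\<lambda>z. v t $ i *\<^sub>R g z) z) t"
      by (rule flux_eq[OF C t])
    also have "\<dots> = ball_integral (\<lambda>z. \<Sum>i\<in>UNIV. v t $ i *\<^sub>R pd_x S i g z) t"
      by (rule ball_integral_cong[OF t])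
         (simp add: pd_x_def D_linear[OF bounded_linear_scaleR_right g])
    finally show ?thesis by simp
  qed
  have "continuous_on {Tm..Tp} (ball_integral (\<lambda>z. \<Sum>i\<in>UNIV. v (fst z) $ i *\<^sub>R pd_x S i g z))"
    by (intro continuous_ball_integral continuous_intros continuous_pd continuous_velocity_tube g)
  then show "continuous_on {Tm..Tp} (sphere_integral (\<lambda>t x. (v t \<bullet> normal R t x) *\<^sub>R g (t, x)))"
    by (rule continuous_on_eq) (simp add: 1)
qed

text \<open>Reynolds' transport theorem for the moving ball.\<close>

lemma ball_integral_derivative:
  fixes g :: "spacetime \<Rightarrow> 'b::euclidean_space"
  assumes g: "C1_on S g" and t: "t \<in> {Tm..Tp}"
  shows "(ball_integral g has_vector_derivative
    ball_integral (pd_t S g) t + sphere_integral (\<lambda>t x. (v t \<bullet> normal R t x) *\<^sub>R g (t, x)) t) (at t within {Tm..Tp})"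
proof -
  have "ball_integral (\<lambda>z. D g z (1, v (fst z))) t =
      ball_integral (\<lambda>z. pd_t S g z + (\<Sum>i\<in>UNIV. v (fst z) $ i *\<^sub>R pd_x S i g z)) t"
    by (rule ball_integral_cong[OF t]) (rule D_direction_sum[OF g])
  also have "\<dots> = ball_integral (pd_t S g) t + ball_integral (\<lambda>z. \<Sum>i\<in>UNIV. v (fst z) $ i *\<^sub>R pd_x S i g z) t"
    by (intro ball_integral_add t continuous_intros continuous_pd continuous_velocity_tube g)
  finally show ?thesis
    using transport_theorem[OF g t] by (simp add: moving_flux_eq[OF g t])
qed

text \<open>The components of the current density \<open>J\<close> on the tube.\<close>

definition J_comp :: "3 \<Rightarrow> spacetime \<Rightarrow> real" where "J_comp i = (\<lambda>z. (q / m) * P_comp i z)"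

lemma C1_J_comp: "C1_on S (J_comp i)"
  unfolding J_comp_def by (rule C1_on_linear[OF bounded_linear_mult_right C1_P_comp])

lemma pd_x_J_comp: "z \<in> S \<Longrightarrow> pd_x S k (J_comp i) z = (q / m) * pd_x S k (P_comp i) z"
  unfolding pd_x_def J_comp_def by (rule D_linear[OF bounded_linear_mult_right C1_P_comp])

lemma P_vec: "z \<in> S \<Longrightarrow> P S A \<psi> z = (\<chi> i. P_comp i z)"
  by (simp add: P_eq P_comp_def)

lemma J_vec: "z \<in> S \<Longrightarrow> J S A \<psi> z = (\<chi> i. J_comp i z)"
  by (simp add: J_eq_P P_vec J_comp_def vec_eq_iff)

lemma pd_t_rho_eq_div_J: "z \<in> S \<Longrightarrow> pd_t S (rho \<psi>) z = - (\<Sum>i\<in>UNIV. pd_x S i (J_comp i) z)"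
  using continuity_equation[of z] by (simp add: pd_x_J_comp sum_distrib_left add_eq_0_iff)

lemma sphere_mem: "x \<in> sphere (rhat t) R \<Longrightarrow> t \<in> {Tm..Tp} \<Longrightarrow> (t, x) \<in> S"
  by (simp add: mem_tube)

lemma sphere_cong:
  assumes "\<And>x. x \<in> sphere (rhat t) R \<Longrightarrow> f x = g x"
  shows "(LINT x|sphere_measure (rhat t) R. f x) = (LINT x|sphere_measure (rhat t) R. g x)"
  by (rule Bochner_Integration.integral_cong) (use assms in \<open>auto simp: sphere_measure_def space_restrict_space\<close>)

lemma normal_dot_J:
  "t \<in> {Tm..Tp} \<Longrightarrow> x \<in> sphere (rhat t) R \<Longrightarrow> normal R t x \<bullet> J S A \<psi> (t, x) = (\<Sum>i\<in>UNIV. normal R t x $ i * J_comp i (t, x))"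
  by (simp add: J_vec[OF sphere_mem] inner_vec_def)

lemma J_flux_eq:
  "t \<in> {Tm..Tp} \<Longrightarrow> J_flux t =
    sphere_integral (\<lambda>t x. \<Sum>i\<in>UNIV. normal R t x $ i *\<^sub>R J_comp i (t, x)) t"
  by (rule sphere_cong) (simp add: normal_dot_J)

lemma rhobar_derivative:
  assumes t: "t \<in> {Tm..Tp}"
  shows "(rhobar R \<psi> has_vector_derivative
    rho_flux t
    - J_flux t) (at t within {Tm..Tp})"
proof -
  have "ball_integral (pd_t S (rho \<psi>)) t = ball_integral (\<lambda>z. - (\<Sum>i\<in>UNIV. pd_x S i (J_comp i) z)) t"
    by (rule ball_integral_cong[OF t pd_t_rho_eq_div_J])
  also have "\<dots> = - ball_integral (\<lambda>z. \<Sum>i\<in>UNIV. pd_x S i (J_comp i) z) t"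
    by (intro ball_integral_linear bounded_linear_minus bounded_linear_ident t continuous_intros continuous_pd C1_J_comp)
  finally have e: "ball_integral (pd_t S (rho \<psi>)) t = - J_flux t"
    unfolding J_flux_eq[OF t] flux_eq[OF C1_J_comp t] .
  show ?thesis
    using ball_integral_derivative[OF C1_rho t] unfolding e
    by (simp add: rhobar_def[abs_def])
qed

lemma continuous_rho_flux:
  "continuous_on {Tm..Tp} rho_flux"
  using continuous_moving_flux[OF C1_rho] by simp

lemma continuous_J_flux:
  "continuous_on {Tm..Tp} J_flux"
  by (rule continuous_on_eq[OF continuous_flux[OF C1_J_comp]]) (simp add: J_flux_eq)

theorem charge_balance:
  assumes "t0 \<in> {Tm..Tp}" "t \<in> {Tm..Tp}"
  shows "rhobar R \<psi> t - rhobar R \<psi> t0 = Q23 R A \<psi> t0 t"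
proof -
  have "(LBINT s=ereal t0..ereal t. rho_flux s
      - J_flux s) = rhobar R \<psi> t - rhobar R \<psi> t0"
    by (intro time_FTC continuous_intros continuous_rho_flux continuous_J_flux rhobar_derivative assms)
  then show ?thesis
    unfolding Q23_def by (simp add: time_integral_diff[OF continuous_rho_flux continuous_J_flux assms])
qed

text \<open>The first moment of the charge, and the total momentum, of the ball at time \<open>t\<close>.\<close>

definition moment :: "real \<Rightarrow> real^3" where
  "moment t = ball_integral (\<lambda>z. rho \<psi> z *\<^sub>R snd z) t"

definition pbar :: "real \<Rightarrow> real^3" where
  "pbar t = ball_integral (P S A \<psi>) t"

lemma
  assumes f: "C1_on S f"
  shows C1_times_x: "C1_on S (\<lambda>z. f z *\<^sub>R snd z)"
    and pd_t_times_x: "z \<in> S \<Longrightarrow> pd_t S (\<lambda>z. f z *\<^sub>R snd z) z = pd_t S f z *\<^sub>R snd z"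
    and pd_x_times_x: "z \<in> S \<Longrightarrow> pd_x S i (\<lambda>z. f z *\<^sub>R snd z) z = f z *\<^sub>R axis i 1 + pd_x S i f z *\<^sub>R snd z"
proof -
  have d: "(snd has_derivative snd) (at z within S)" for z
    by (intro bounded_linear_imp_has_derivative bounded_linear_snd)
  have s: "C1_on S snd" by (rule C1_onI[OF d]) auto
  have ds: "D snd z h = snd h" if "z \<in> S" for z h
    by (simp add: derivative_tube_eq[OF d that])
  show "C1_on S (\<lambda>z. f z *\<^sub>R snd z)"
    by (rule C1_on_bilinear[OF bounded_bilinear_scaleR f s])
  show "pd_t S (\<lambda>z. f z *\<^sub>R snd z) z = pd_t S f z *\<^sub>R snd z" if "z \<in> S"
    unfolding pd_t_def D_bilinear[OF bounded_bilinear_scaleR f s that] by (simp add: ds that)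
  show "pd_x S i (\<lambda>z. f z *\<^sub>R snd z) z = f z *\<^sub>R axis i 1 + pd_x S i f z *\<^sub>R snd z" if "z \<in> S"
    unfolding pd_x_def D_bilinear[OF bounded_bilinear_scaleR f s that] by (simp add: ds that)
qed

lemma vec_axis_sum: "(\<Sum>i\<in>UNIV. w i *\<^sub>R (axis i 1 :: real^3)) = (\<chi> i. w i)"
  by (simp add: vec_eq_iff axis_def if_distrib[of "\<lambda>x. _ * x"] cong: if_cong)

lemma continuous_P_comp_vec: "continuous_on S (\<lambda>z. \<chi> i. P_comp i z)"
  by (intro C1_on_continuous C1_on_vec C1_P_comp)

lemma pbar_eq: "t \<in> {Tm..Tp} \<Longrightarrow> pbar t = ball_integral (\<lambda>z. \<chi> i. P_comp i z) t"
  unfolding pbar_def by (rule ball_integral_cong[OF _ P_vec])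

text \<open>Since \<open>div J\<close> times \<open>x\<close> is the divergence of \<open>J \<otimes> x\<close> minus \<open>J\<close>, charge conservation turns the
  change of the first moment into the total current and fluxes.\<close>

lemma moment_derivative:
  assumes t: "t \<in> {Tm..Tp}"
  shows "(moment has_vector_derivative (q / m) *\<^sub>R pbar t
    + rho_x_flux t
    - J_x_flux t) (at t within {Tm..Tp})"
proof -
  have c: "continuous_on S (\<lambda>z. \<Sum>i\<in>UNIV. pd_x S i (\<lambda>z. J_comp i z *\<^sub>R snd z) z)"
    by (intro continuous_intros continuous_pd C1_times_x C1_J_comp)
  have "ball_integral (pd_t S (\<lambda>z. rho \<psi> z *\<^sub>R snd z)) t =
      ball_integral (\<lambda>z. (q / m) *\<^sub>R (\<chi> i. P_comp i z) - (\<Sum>i\<in>UNIV. pd_x S i (\<lambda>z. J_comp i z *\<^sub>R snd z) z)) t"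
  proof (rule ball_integral_cong[OF t])
    fix z assume z: "z \<in> S"
    have "(q / m) *\<^sub>R (\<chi> i. P_comp i z) = (\<Sum>i\<in>UNIV. J_comp i z *\<^sub>R (axis i 1 :: real^3))"
      unfolding vec_axis_sum by (simp add: J_comp_def vec_eq_iff)
    then show "pd_t S (\<lambda>z. rho \<psi> z *\<^sub>R snd z) z =
        (q / m) *\<^sub>R (\<chi> i. P_comp i z) - (\<Sum>i\<in>UNIV. pd_x S i (\<lambda>z. J_comp i z *\<^sub>R snd z) z)"
      by (simp add: pd_t_times_x[OF C1_rho z] pd_x_times_x[OF C1_J_comp z] pd_t_rho_eq_div_J[OF z]
          sum.distrib scaleR_sum_left)
  qed
  also have "\<dots> = ball_integral (\<lambda>z. (q / m) *\<^sub>R (\<chi> i. P_comp i z)) t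
      - ball_integral (\<lambda>z. \<Sum>i\<in>UNIV. pd_x S i (\<lambda>z. J_comp i z *\<^sub>R snd z) z) t"
    by (intro ball_integral_diff t c continuous_on_scaleR continuous_on_const continuous_P_comp_vec)
  also have "ball_integral (\<lambda>z. (q / m) *\<^sub>R (\<chi> i. P_comp i z)) t = (q / m) *\<^sub>R pbar t"
    unfolding pbar_eq[OF t] by (rule ball_integral_linear[OF bounded_linear_scaleR_right t continuous_P_comp_vec])
  also have "ball_integral (\<lambda>z. \<Sum>i\<in>UNIV. pd_x S i (\<lambda>z. J_comp i z *\<^sub>R snd z) z) t =
      sphere_integral (\<lambda>t x. \<Sum>i\<in>UNIV. normal R t x $ i *\<^sub>R (J_comp i (t, x) *\<^sub>R x)) t"
    using flux_eq[where f="\<lambda>i z. J_comp i z *\<^sub>R snd z", OF C1_times_x[OF C1_J_comp] t] by simp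
  also have "\<dots> = J_x_flux t"
    by (rule sphere_cong) (simp add: normal_dot_J[OF t] scaleR_sum_left)
  finally have e: "ball_integral (pd_t S (\<lambda>z. rho \<psi> z *\<^sub>R snd z)) t = (q / m) *\<^sub>R pbar t
      - J_x_flux t" .
  show ?thesis
    using ball_integral_derivative[OF C1_times_x[OF C1_rho] t] unfolding e
    by (simp add: moment_def[abs_def] algebra_simps)
qed

lemma center_eq: "center R \<psi> t = (1 / rhobar R \<psi> t) *\<^sub>R moment t"
  by (simp add: center_def moment_def)

lemma
  assumes t: "t \<in> {Tm..Tp}"
  shows Q20_eq: "Q20 R \<psi> t = rho_flux t *\<^sub>R center R \<psi> t
      - rho_x_flux t"
    and Q22_eq: "Q22 R A \<psi> t = J_x_flux t
      - J_flux t *\<^sub>R center R \<psi> t"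
proof -
  have R0: "0 \<le> R" using R_pos by simp
  have split: "(LINT x|sphere_measure (rhat t) R. f x *\<^sub>R (x - w)) =
      (LINT x|sphere_measure (rhat t) R. f x *\<^sub>R x) - (LINT x|sphere_measure (rhat t) R. f x) *\<^sub>R w"
    if "continuous_on (sphere (rhat t) R) f" for f :: "real^3 \<Rightarrow> real" and w
  proof -
    have 1: "integrable (sphere_measure (rhat t) R) (\<lambda>x. f x *\<^sub>R x)"
      and 2: "integrable (sphere_measure (rhat t) R) f"
      by (intro sphere_integrable R0 that continuous_intros)+
    from 2 have 3: "integrable (sphere_measure (rhat t) R) (\<lambda>x. f x *\<^sub>R w)"
      by simp
    show ?thesis
      unfolding scaleR_diff_right Bochner_Integration.integral_diff[OF 1 3] using 2 by simp
  qed
  have c1: "continuous_on (sphere (rhat t) R) (\<lambda>x. (v t \<bullet> normal R t x) * rho \<psi> (t, x))"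
    by (intro continuous_intros continuous_normal sphere_slice C1_on_continuous C1_rho t)
  have c2: "continuous_on (sphere (rhat t) R) (\<lambda>x. normal R t x \<bullet> J S A \<psi> (t, x))"
  proof (rule continuous_on_eq)
    show "continuous_on (sphere (rhat t) R) (\<lambda>x. \<Sum>i\<in>UNIV. normal R t x $ i * J_comp i (t, x))"
      by (intro continuous_intros continuous_normal sphere_slice C1_on_continuous C1_J_comp t)
  qed (simp add: normal_dot_J[OF t])
  show "Q20 R \<psi> t = rho_flux t *\<^sub>R center R \<psi> t
      - rho_x_flux t"
    unfolding Q20_def split[OF c1] by simp
  show "Q22 R A \<psi> t = J_x_flux t
      - J_flux t *\<^sub>R center R \<psi> t"
    unfolding Q22_def split[OF c2] ..
qed

text \<open>By the quotient rule; the term from the change of the charge moves the fluxes of \<open>x\<close> in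
  the derivative of the moment to fluxes of \<open>x - center\<close>, which are \<open>Q20\<close> and \<open>Q22\<close>.\<close>

theorem center_derivative:
  assumes t: "t \<in> {Tm..Tp}" and pos: "\<And>t. t \<in> {Tm..Tp} \<Longrightarrow> 0 < rhobar R \<psi> t"
  shows "(center R \<psi> has_vector_derivative
    (1 / rhobar R \<psi> t) *\<^sub>R ((q / m) *\<^sub>R pbar t - Q20 R \<psi> t - Q22 R A \<psi> t)) (at t within {Tm..Tp})"
proof -
  let ?r = "rhobar R \<psi>"
  define r' where "r' = rho_flux t
    - J_flux t"
  define M' where "M' = (q / m) *\<^sub>R pbar t
    + rho_x_flux t
    - J_x_flux t"
  have r: "(?r has_real_derivative r') (at t within {Tm..Tp})"
    using rhobar_derivative[OF t] unfolding r'_def[symmetric]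
    by (simp add: has_real_derivative_iff_has_vector_derivative)
  have M: "(moment has_vector_derivative M') (at t within {Tm..Tp})"
    using moment_derivative[OF t] unfolding M'_def[symmetric] .
  have r0: "?r t \<noteq> 0" using pos[OF t] by simp
  have "((\<lambda>t. inverse (?r t)) has_real_derivative - (inverse (?r t) * r' * inverse (?r t))) (at t within {Tm..Tp})"
    using DERIV_inverse'[OF r r0] by simp
  from has_vector_derivative_scaleR[OF this M]
  have "((\<lambda>t. inverse (?r t) *\<^sub>R moment t) has_vector_derivative
      inverse (?r t) *\<^sub>R M' + (- (inverse (?r t) * r' * inverse (?r t))) *\<^sub>R moment t) (at t within {Tm..Tp})" .
  moreover have "inverse (?r t) *\<^sub>R M' + (- (inverse (?r t) * r' * inverse (?r t))) *\<^sub>R moment t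
      = (1 / ?r t) *\<^sub>R (M' - r' *\<^sub>R center R \<psi> t)"
    by (simp add: center_eq scaleR_diff_right divide_inverse mult.commute mult.left_commute)
  moreover have "M' - r' *\<^sub>R center R \<psi> t = (q / m) *\<^sub>R pbar t - Q20 R \<psi> t - Q22 R A \<psi> t"
    unfolding M'_def r'_def Q20_eq[OF t] Q22_eq[OF t] by (simp add: algebra_simps)
  moreover have "center R \<psi> = (\<lambda>t. inverse (?r t) *\<^sub>R moment t)"
    by (simp add: fun_eq_iff center_eq divide_inverse)
  ultimately show ?thesis by simp
qed

lemma C1_P_comp_vec: "C1_on S (\<lambda>z. \<chi> i. P_comp i z)"
  by (rule C1_on_vec[OF C1_P_comp])

lemma C1_tau_vec: "C1_on S (\<lambda>z. \<chi> k. \<tau> i k z)"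
  by (rule C1_on_vec[OF C1_tau])

lemma pd_t_P_comp_vec: "z \<in> S \<Longrightarrow> pd_t S (\<lambda>z. \<chi> i. P_comp i z) z = (\<chi> i. pd_t S (P_comp i) z)"
  unfolding pd_t_def by (rule D_vec[OF C1_P_comp])

lemma pd_x_tau_vec: "z \<in> S \<Longrightarrow> pd_x S k (\<lambda>z. \<chi> l. \<tau> i l z) z = (\<chi> l. pd_x S k (\<tau> i l) z)"
  unfolding pd_x_def by (rule D_vec[OF C1_tau])

text \<open>The Lorentz force density.\<close>

abbreviation lorentz :: "spacetime \<Rightarrow> real^3" where
  "lorentz z \<equiv> rho \<psi> z *\<^sub>R electric_field c S \<phi> A z + (1 / c) *\<^sub>R cross3 (J S A \<psi> z) (curl S A z)"

lemma continuous_electric: "continuous_on S (electric_field c S \<phi> A)"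
proof -
  have "continuous_on S (\<lambda>z. - grad S \<phi> z - (1 / c) *\<^sub>R pd_t S A z)"
    unfolding grad_def by (intro continuous_intros continuous_pd C1_phi C1_A)
  then show ?thesis by (simp add: electric_field_def[abs_def])
qed

lemma continuous_curl: "continuous_on S (curl S A)"
proof -
  have "continuous_on S (\<lambda>z. vector
     [pd_x S 2 A z $ 3 - pd_x S 3 A z $ 2,
      pd_x S 3 A z $ 1 - pd_x S 1 A z $ 3,
      pd_x S 1 A z $ 2 - pd_x S 2 A z $ 1] :: real^3)"
    unfolding vector3_eq_axis_sum by (intro continuous_intros continuous_pd C1_A)
  then show ?thesis by (simp add: curl_def[abs_def])
qed

lemma continuous_J: "continuous_on S (J S A \<psi>)"
  by (rule continuous_on_eq[of _ "\<lambda>z. (\<chi> i. J_comp i z)"])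
     (auto simp: J_vec intro!: C1_on_continuous C1_on_vec C1_J_comp)

lemma continuous_rho: "continuous_on S (rho \<psi>)"
  by (rule C1_on_continuous[OF C1_rho])

lemma continuous_lorentz: "continuous_on S lorentz"
  by (intro continuous_intros continuous_rho continuous_electric continuous_on_cross continuous_J continuous_curl)

abbreviation "div_T \<equiv> \<lambda>z. \<Sum>i\<in>UNIV. pd_x S i (\<lambda>z. \<chi> k. \<tau> i k z) z"

text \<open>The time derivative of the momentum density, integrated over the ball. The momentum balance holds
  in the open ball and at interior times; the sphere is a null set.\<close>

lemma pbar_derivative:
  assumes t: "t \<in> {Tm<..<Tp}"
  shows "ball_integral (pd_t S (\<lambda>z. \<chi> i. P_comp i z)) t =
    ball_integral lorentz t - T_flux t"
proof -
  have t': "t \<in> {Tm..Tp}" using t by simp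
  have c: "continuous_on S div_T"
    by (intro continuous_intros continuous_pd C1_tau_vec)
  have "ball_integral (pd_t S (\<lambda>z. \<chi> i. P_comp i z)) t =
      ball_integral (\<lambda>z. lorentz z - div_T z) t"
  proof -
    have eq: "pd_t S (\<lambda>z. \<chi> i. P_comp i z) (t, x) = lorentz (t, x) - div_T (t, x)"
      if "x \<in> ball (rhat t) R" for x
    proof -
      have z: "(t, x) \<in> inner_tube" using that t by (simp add: inner_tube_def)
      then have zS: "(t, x) \<in> S" using inner_tube_subset by blast
      show ?thesis
        unfolding pd_t_P_comp_vec[OF zS] pd_x_tau_vec[OF zS] using momentum_balance[OF z]
        by (simp add: vec_eq_iff algebra_simps)
    qed
    have c': "continuous_on S (\<lambda>z. lorentz z - div_T z)"
      by (intro continuous_on_diff continuous_lorentz c)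
    show ?thesis
      unfolding set_integral_compact_eq_integral[OF compact_cball continuous_on_slice[OF continuous_pd(1)[OF C1_P_comp_vec] t']]
        set_integral_compact_eq_integral[OF compact_cball continuous_on_slice[OF c' t']]
      by (rule integral_spike[OF negligible_sphere[of "rhat t" R]]) (use eq in auto)
  qed
  also have "\<dots> = ball_integral lorentz t - ball_integral div_T t"
    by (rule ball_integral_diff[OF t' continuous_lorentz c])
  also have "ball_integral div_T t =
      sphere_integral (\<lambda>t x. \<Sum>i\<in>UNIV. normal R t x $ i *\<^sub>R (\<chi> k. \<tau> i k (t, x))) t"
    by (rule flux_eq[OF C1_tau_vec t', symmetric])
  also have "\<dots> = T_flux t"
    by (rule sphere_cong) (simp add: vec_eq_iff T_eq_tau[OF sphere_mem[OF _ t']])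
  finally show ?thesis .
qed

lemma continuous_T_flux: "continuous_on {Tm..Tp}
    T_flux"
  by (rule continuous_on_eq[OF continuous_flux[where f="\<lambda>i z. \<chi> k. \<tau> i k z", OF C1_tau_vec]])
     (rule sphere_cong, simp add: vec_eq_iff T_eq_tau[OF sphere_mem])

lemma continuous_P_flux: "continuous_on {Tm..Tp}
    P_flux"
  by (rule continuous_on_eq[OF continuous_moving_flux[OF C1_P_comp_vec]])
     (rule sphere_cong, simp add: P_vec[OF sphere_mem])

theorem momentum_balance_integrated:
  assumes t: "t0 \<in> {Tm..Tp}" "t \<in> {Tm..Tp}"
  shows "pbar t - pbar t0 = Q01 R A \<psi> t0 t - Q0 R a \<phi> A \<psi> t0 t + (LBINT s=ereal t0..ereal t. ball_integral lorentz s)"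
proof -
  let ?P = "\<lambda>z. \<chi> i. P_comp i z" and ?a = "P_flux"
    and ?b = "T_flux"
  have a: "sphere_integral (\<lambda>t x. (v t \<bullet> normal R t x) *\<^sub>R ?P (t, x)) s = ?a s" if "s \<in> {Tm..Tp}" for s
    by (rule sphere_cong) (simp add: P_vec[OF sphere_mem[OF _ that]])
  have cL: "continuous_on {Tm..Tp} (ball_integral lorentz)"
    by (rule continuous_ball_integral[OF continuous_lorentz])
  have "pbar t - pbar t0 = ball_integral ?P t - ball_integral ?P t0"
    using t by (simp add: pbar_eq)
  also have "\<dots> = (LBINT s=ereal t0..ereal t. ball_integral (pd_t S ?P) s + sphere_integral (\<lambda>t x. (v t \<bullet> normal R t x) *\<^sub>R ?P (t, x)) s)"
    by (rule time_FTC[symmetric, OF _ ball_integral_derivative[OF C1_P_comp_vec] t])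
       (intro continuous_on_add continuous_moving_flux[OF C1_P_comp_vec] continuous_ball_integral continuous_pd[OF C1_P_comp_vec])
  also have "\<dots> = (LBINT s=ereal t0..ereal t. (?a s - ?b s) + ball_integral lorentz s)"
  proof (rule interval_integral_cong)
    fix s assume "s \<in> einterval (min (ereal t0) (ereal t)) (max (ereal t0) (ereal t))"
    then have s: "s \<in> {Tm<..<Tp}"
      using t by (auto simp: einterval_iff min_def max_def split: if_splits)
    then have s': "s \<in> {Tm..Tp}" by simp
    show "ball_integral (pd_t S ?P) s + sphere_integral (\<lambda>t x. (v t \<bullet> normal R t x) *\<^sub>R ?P (t, x)) s
        = (?a s - ?b s) + ball_integral lorentz s"
      unfolding pbar_derivative[OF s] a[OF s'] by simp
  qed
  also have "\<dots> = (LBINT s=ereal t0..ereal t. ?a s) - (LBINT s=ereal t0..ereal t. ?b s)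
      + (LBINT s=ereal t0..ereal t. ball_integral lorentz s)"
    unfolding time_integral_add[OF continuous_on_diff[OF continuous_P_flux continuous_T_flux] cL t]
      time_integral_diff[OF continuous_P_flux continuous_T_flux t] ..
  finally show ?thesis
    unfolding Q01_def Q0_def .
qed

text \<open>The fields split into their limits on the trajectory, for arbitrary limit potentials, and the rest.\<close>

lemma lorentz_decomposition:
  assumes t: "t \<in> {Tm..Tp}"
  shows "ball_integral lorentz t = (rhobar R \<psi> t *\<^sub>R E_inf \<phi>\<^sub>i A\<^sub>i t + (q / (m * c)) *\<^sub>R cross3 (pbar t) (B_inf A\<^sub>i t))
    + (Q30 \<phi>\<^sub>i A\<^sub>i R \<phi> A \<psi> t + Q31 A\<^sub>i R A \<psi> t)"
proof -
  let ?E = "E_inf \<phi>\<^sub>i A\<^sub>i t" and ?B = "B_inf A\<^sub>i t"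
  have bl: "bounded_linear (\<lambda>w. (1 / c) *\<^sub>R cross3 w ?B)"
    by (intro bounded_linear_const_scaleR linear_conv_bounded_linear[THEN iffD1])
       (simp add: linear_iff cross_add_left cross_mult_left)
  have "ball_integral lorentz t =
      ball_integral (\<lambda>z. (rho \<psi> z *\<^sub>R ?E + (1 / c) *\<^sub>R cross3 (J S A \<psi> z) ?B)
        + (rho \<psi> z *\<^sub>R (electric_field c S \<phi> A z - ?E) + (1 / c) *\<^sub>R cross3 (J S A \<psi> z) (curl S A z - ?B))) t"
  proof (rule ball_integral_cong[OF t])
    show "lorentz z = (rho \<psi> z *\<^sub>R ?E + (1 / c) *\<^sub>R cross3 (J S A \<psi> z) ?B)
        + (rho \<psi> z *\<^sub>R (electric_field c S \<phi> A z - ?E) + (1 / c) *\<^sub>R cross3 (J S A \<psi> z) (curl S A z - ?B))" for z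
      by (simp add: Cross3.right_diff_distrib algebra_simps)
  qed
  also have "\<dots> = (ball_integral (\<lambda>z. rho \<psi> z *\<^sub>R ?E) t + ball_integral (\<lambda>z. (1 / c) *\<^sub>R cross3 (J S A \<psi> z) ?B) t)
      + (ball_integral (\<lambda>z. rho \<psi> z *\<^sub>R (electric_field c S \<phi> A z - ?E)) t
       + ball_integral (\<lambda>z. (1 / c) *\<^sub>R cross3 (J S A \<psi> z) (curl S A z - ?B)) t)"
    by (subst ball_integral_add | intro t continuous_intros continuous_rho continuous_electric
        continuous_on_cross continuous_J continuous_curl refl)+
  also have "ball_integral (\<lambda>z. rho \<psi> z *\<^sub>R ?E) t = rhobar R \<psi> t *\<^sub>R ?E"
    unfolding rhobar_def by (rule ball_integral_linear[OF bounded_linear_scaleR_left t continuous_rho])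
  also have "ball_integral (\<lambda>z. (1 / c) *\<^sub>R cross3 (J S A \<psi> z) ?B) t = (1 / c) *\<^sub>R cross3 (ball_integral (J S A \<psi>) t) ?B"
    by (rule ball_integral_linear[OF bl t continuous_J])
  also have "ball_integral (J S A \<psi>) t = (q / m) *\<^sub>R pbar t"
  proof -
    have "ball_integral (J S A \<psi>) t = ball_integral (\<lambda>z. (q / m) *\<^sub>R (\<chi> i. P_comp i z)) t"
      by (rule ball_integral_cong[OF t]) (simp add: J_eq_P P_vec)
    also have "\<dots> = (q / m) *\<^sub>R pbar t"
      unfolding pbar_eq[OF t] by (rule ball_integral_linear[OF bounded_linear_scaleR_right t continuous_P_comp_vec])
    finally show ?thesis .
  qed
  finally show ?thesis
    unfolding Q30_def Q31_def by (simp add: cross_mult_left)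
qed

lemma norm_center_diff_le:
  assumes t: "t \<in> {Tm..Tp}" and pos: "0 < rhobar R \<psi> t"
  shows "norm (center R \<psi> t - rhat t) \<le> R"
proof -
  have rn: "0 \<le> rho \<psi> z" for z
    using q_pos by (simp add: rho_eq)
  have c1: "continuous_on S (\<lambda>z. rho \<psi> z *\<^sub>R snd z)" and c2: "continuous_on S (\<lambda>z. rho \<psi> z *\<^sub>R rhat t)"
    by (intro continuous_intros continuous_rho)+
  have "moment t - rhobar R \<psi> t *\<^sub>R rhat t = ball_integral (\<lambda>z. rho \<psi> z *\<^sub>R snd z - rho \<psi> z *\<^sub>R rhat t) t"
    unfolding ball_integral_diff[OF t c1 c2] ball_integral_linear[OF bounded_linear_scaleR_left t continuous_rho]
      moment_def rhobar_def by simp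
  also have "\<dots> = ball_integral (\<lambda>z. rho \<psi> z *\<^sub>R (snd z - rhat t)) t"
    by (simp add: scaleR_diff_right)
  finally have e: "moment t - rhobar R \<psi> t *\<^sub>R rhat t = ball_integral (\<lambda>z. rho \<psi> z *\<^sub>R (snd z - rhat t)) t" .
  have c3: "continuous_on S (\<lambda>z. rho \<psi> z *\<^sub>R (snd z - rhat t))"
    by (intro continuous_intros continuous_rho)
  have i1: "set_integrable lborel (cball (rhat t) R) (\<lambda>x. (\<lambda>z. rho \<psi> z *\<^sub>R (snd z - rhat t)) (t, x))"
    by (intro set_integrable_compact compact_cball continuous_on_slice c3 t)
  have i2: "set_integrable lborel (cball (rhat t) R) (\<lambda>x. norm (rho \<psi> (t, x) *\<^sub>R (x - rhat t)))"
    using continuous_on_norm[OF continuous_on_slice[OF c3 t]]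
    by (intro set_integrable_compact compact_cball) simp
  have i3: "set_integrable lborel (cball (rhat t) R) (\<lambda>x. R * rho \<psi> (t, x))"
    by (intro set_integrable_compact compact_cball continuous_on_mult_left continuous_on_slice continuous_rho t)
  have "norm (moment t - rhobar R \<psi> t *\<^sub>R rhat t) \<le> (LINT x:cball (rhat t) R|lborel. norm (rho \<psi> (t, x) *\<^sub>R (x - rhat t)))"
    unfolding e using set_integral_norm_bound[OF i1] by simp
  also have "\<dots> \<le> (LINT x:cball (rhat t) R|lborel. R * rho \<psi> (t, x))"
  proof (rule set_integral_mono[OF i2 i3])
    fix x assume "x \<in> cball (rhat t) R"
    then have "norm (x - rhat t) \<le> R" by (simp add: dist_norm norm_minus_commute)
    then show "norm (rho \<psi> (t, x) *\<^sub>R (x - rhat t)) \<le> R * rho \<psi> (t, x)"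
      using mult_left_mono[OF _ rn] rn by (simp add: mult.commute[of R])
  qed
  also have "\<dots> = R * rhobar R \<psi> t"
    by (simp add: rhobar_def)
  finally have "norm (moment t - rhobar R \<psi> t *\<^sub>R rhat t) \<le> R * rhobar R \<psi> t" .
  then have "norm (moment t - rhobar R \<psi> t *\<^sub>R rhat t) / rhobar R \<psi> t \<le> R"
    using pos by (simp only: pos_divide_le_eq)
  moreover have "center R \<psi> t - rhat t = (1 / rhobar R \<psi> t) *\<^sub>R (moment t - rhobar R \<psi> t *\<^sub>R rhat t)"
    using pos by (simp add: center_eq scaleR_diff_right)
  then have "norm (center R \<psi> t - rhat t) = norm (moment t - rhobar R \<psi> t *\<^sub>R rhat t) / rhobar R \<psi> t"
    using pos by (simp only: norm_scaleR) simp
  ultimately show ?thesis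
    by simp
qed

lemma continuous_rhobar: "continuous_on {Tm..Tp} (rhobar R \<psi>)"
  unfolding rhobar_def by (rule continuous_ball_integral[OF continuous_rho])

lemma continuous_pbar: "continuous_on {Tm..Tp} pbar"
  by (rule continuous_on_eq[OF continuous_ball_integral[OF continuous_P_comp_vec]]) (simp add: pbar_eq)

end

section \<open>Passage to the limit\<close>

lemma uniform_limit_null_bilinear:
  assumes h: "bounded_bilinear h" and f: "uniform_limit I f (\<lambda>_. 0) sequentially"
    and g: "\<forall>\<^sub>F n in sequentially. \<forall>t\<in>I. norm (g n t) \<le> C"
  shows "uniform_limit I (\<lambda>n t. h (f n t) (g n t)) (\<lambda>_. 0) sequentially"
proof -
  obtain K where K: "0 \<le> K" "\<And>a b. norm (h a b) \<le> norm a * norm b * K"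
    using bounded_bilinear.nonneg_bounded[OF h] by blast
  have "uniform_limit I (\<lambda>n t. norm (f n t)) (\<lambda>_. 0) sequentially"
    using f by (simp add: uniform_limit_iff dist_norm)
  from bounded_linear.uniform_limit[OF bounded_linear_scaleR_right[of "\<bar>C\<bar> * K"] this]
  have l: "uniform_limit I (\<lambda>n t. (\<bar>C\<bar> * K) *\<^sub>R norm (f n t)) (\<lambda>t. 0) sequentially"
    by simp
  show ?thesis
  proof (rule uniform_limit_null_comparison[OF _ l])
    show "\<forall>\<^sub>F n in sequentially. \<forall>t\<in>I. norm (h (f n t) (g n t)) \<le> (\<bar>C\<bar> * K) *\<^sub>R norm (f n t)"
      using g
    proof eventually_elim
      case (elim n)
      show ?case
      proof
        fix t assume "t \<in> I"
        then have "norm (g n t) \<le> \<bar>C\<bar>" using elim by fastforce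
        then have "norm (f n t) * norm (g n t) * K \<le> norm (f n t) * \<bar>C\<bar> * K"
          using K by (intro mult_right_mono mult_left_mono) auto
        then show "norm (h (f n t) (g n t)) \<le> (\<bar>C\<bar> * K) *\<^sub>R norm (f n t)"
          using K(2)[of "f n t" "g n t"] by (simp add: mult_ac)
      qed
    qed
  qed
qed

lemma uniform_limit_null_from_derivative:
  fixes f :: "nat \<Rightarrow> real \<Rightarrow> 'b::real_normed_vector"
  assumes der: "\<forall>\<^sub>F n in sequentially. \<forall>t\<in>{a..b}. (f n has_vector_derivative f' n t) (at t within {a..b})"
    and f': "uniform_limit {a..b} f' (\<lambda>_. 0) sequentially"
    and f0: "(\<lambda>n. f n t0) \<longlonglongrightarrow> 0" and t0: "t0 \<in> {a..b}"
  shows "uniform_limit {a..b} f (\<lambda>_. 0) sequentially"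
proof (rule uniform_limitI)
  fix e :: real assume e: "0 < e"
  define d where "d = e / 2 / (b - a + 1)"
  have ba: "0 < b - a + 1" using t0 by auto
  have d: "0 < d" using e ba by (simp add: d_def)
  have "\<forall>\<^sub>F n in sequentially. norm (f n t0) < e / 2"
    using tendstoD[OF f0, of "e / 2"] e by (simp add: dist_norm)
  with der uniform_limitD[OF f' d]
  show "\<forall>\<^sub>F n in sequentially. \<forall>t\<in>{a..b}. dist (f n t) 0 < e"
  proof eventually_elim
    case (elim n)
    show ?case
    proof
      fix t assume t: "t \<in> {a..b}"
      have "norm (f n t - f n t0) \<le> d * norm (t - t0)"
      proof (rule differentiable_bound[where S="{a..b}" and f="f n" and f'="\<lambda>t x. x *\<^sub>R f' n t"])
        show "(f n has_derivative (\<lambda>x. x *\<^sub>R f' n s)) (at s within {a..b})" if "s \<in> {a..b}" for s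
          using elim that by (simp add: has_vector_derivative_def)
        show "onorm (\<lambda>x. x *\<^sub>R f' n s) \<le> d" if "s \<in> {a..b}" for s
        proof (rule onorm_le)
          fix x :: real
          have "norm (f' n s) \<le> d" using elim that by (simp add: less_imp_le)
          then show "norm (x *\<^sub>R f' n s) \<le> d * norm x"
            using mult_left_mono[of "norm (f' n s)" d "\<bar>x\<bar>"] by (simp add: mult.commute)
        qed
      qed (use t t0 in auto)
      also have "\<dots> \<le> d * (b - a + 1)"
        using d t t0 by (intro mult_left_mono) auto
      also have "\<dots> = e / 2"
      proof -
        have "x / N * N = x" if "0 < N" for x N :: real using that by simp
        from this[OF ba] show ?thesis by (simp only: d_def)
      qed
      finally have "norm (f n t - f n t0) \<le> e / 2" .
      moreover have "norm (f n t) \<le> norm (f n t - f n t0) + norm (f n t0)"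
        using norm_triangle_ineq[of "f n t - f n t0" "f n t0"] by simp
      ultimately show "dist (f n t) 0 < e"
        using elim by simp
    qed
  qed
qed

lemma bounded_bilinear_cross3: "bounded_bilinear cross3"
  by (rule bilinear_conv_bounded_bilinear[THEN iffD1, OF bilinear_cross])

text \<open>Sequences \<open>r\<close>, \<open>pb\<close>, \<open>rb\<close> of centers, momenta and charges that satisfy the balance laws up to
  errors tending uniformly to \<open>0\<close>, with bounded momenta, centers tending to the trajectory and
  charges tending to a positive constant, force the trajectory to obey Newton's law, with \<open>K\<close> in the
  role of \<open>q / m\<close>.\<close>

lemma (in ball_tube) newton_limit:
  fixes r pb e err :: "nat \<Rightarrow> real \<Rightarrow> real^3" and rb :: "nat \<Rightarrow> real \<Rightarrow> real"
    and E B B' :: "real \<Rightarrow> real^3" and K c \<rho> c0 C :: real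
  assumes t0: "t0 \<in> {Tm..Tp}" and K: "0 < K" and c0: "0 < c0"
    and E: "continuous_on {Tm..Tp} E" and B': "continuous_on {Tm..Tp} B'"
    and B: "\<And>t. t \<in> {Tm..Tp} \<Longrightarrow> (B has_vector_derivative B' t) (at t within {Tm..Tp})"
    and r_der: "\<forall>\<^sub>F n in sequentially. \<forall>t\<in>{Tm..Tp}.
      (r n has_vector_derivative (1 / rb n t) *\<^sub>R (K *\<^sub>R pb n t - e n t)) (at t within {Tm..Tp})"
    and e: "uniform_limit {Tm..Tp} e (\<lambda>_. 0) sequentially"
    and r_lim: "uniform_limit {Tm..Tp} r rhat sequentially"
    and rb_lim: "uniform_limit {Tm..Tp} rb (\<lambda>_. \<rho>) sequentially" and \<rho>: "0 < \<rho>"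
    and rb_low: "\<forall>\<^sub>F n in sequentially. \<forall>t\<in>{Tm..Tp}. c0 \<le> rb n t"
    and pb_bound: "\<forall>\<^sub>F n in sequentially. \<forall>t\<in>{Tm..Tp}. norm (pb n t) \<le> C"
    and cont: "\<forall>\<^sub>F n in sequentially. continuous_on {Tm..Tp} (pb n) \<and> continuous_on {Tm..Tp} (rb n)"
    and pb_eq: "\<forall>\<^sub>F n in sequentially. \<forall>t\<in>{Tm..Tp}. pb n t - pb n t0 = err n t +
      (LBINT s=ereal t0..ereal t. rb n s *\<^sub>R E s + (K / c) *\<^sub>R cross3 (pb n s) (B s))"
    and err: "uniform_limit {Tm..Tp} err (\<lambda>_. 0) sequentially"
    and t: "t \<in> {Tm..Tp}"
  shows "(v has_vector_derivative K *\<^sub>R (E t + (1 / c) *\<^sub>R cross3 (v t) (B t))) (at t within {Tm..Tp})"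
proof -
  let ?I = "{Tm..Tp}"
  have cB: "continuous_on ?I B"
    unfolding continuous_on_eq_continuous_within using B has_vector_derivative_continuous by blast
  have bounded_on: "\<forall>\<^sub>F n in sequentially. \<forall>t\<in>?I. norm (f t) \<le> L"
    if "\<forall>t\<in>?I. norm (f t) \<le> L" for f :: "real \<Rightarrow> real^3" and L
    using that by simp
  have bnd: "\<exists>L. \<forall>t\<in>?I. norm (f t) \<le> L" if "continuous_on ?I f" for f :: "real \<Rightarrow> real^3"
    using compact_imp_bounded[OF compact_continuous_image[OF that compact_Icc]]
    by (auto simp: bounded_iff)
  obtain LE LB LB' where LE: "\<forall>t\<in>?I. norm (E t) \<le> LE" and LB: "\<forall>t\<in>?I. norm (B t) \<le> LB"
    and LB': "\<forall>t\<in>?I. norm (B' t) \<le> LB'"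
    using bnd[OF E] bnd[OF cB] bnd[OF B'] by blast
  note null = uniform_limit_null_bilinear
  \<comment> \<open>\<open>h\<close> is the limit of \<open>pb n t - pb n t0\<close>, and \<open>hh\<close> its integral\<close>
  define h where "h t = (LBINT s=ereal t0..ereal t. \<rho> *\<^sub>R E s + (\<rho> / c) *\<^sub>R cross3 (v s) (B s))" for t
  have h: "(h has_vector_derivative \<rho> *\<^sub>R E t + (\<rho> / c) *\<^sub>R cross3 (v t) (B t)) (at t within ?I)" if "t \<in> ?I" for t
    unfolding h_def
    by (intro antiderivative[OF _ t0 that] continuous_intros E continuous_on_cross continuous_velocity cB)
  have ch: "continuous_on ?I h"
    unfolding continuous_on_eq_continuous_within using h has_vector_derivative_continuous by blast
  define hh where "hh t = (LBINT s=ereal t0..ereal t. h s)" for t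
  have hh: "(hh has_vector_derivative h t) (at t within ?I)" if "t \<in> ?I" for t
    unfolding hh_def by (rule antiderivative[OF ch t0 that])
  have h0: "h t0 = 0" "hh t0 = 0" by (simp_all add: h_def hh_def)
  define rd where "rd n t = (1 / rb n t) *\<^sub>R (K *\<^sub>R pb n t - e n t)" for n t
  \<comment> \<open>\<open>rd n\<close> is the derivative of \<open>r n\<close>; in the limit, momentum is proportional to it\<close>
  define w where "w n t = K *\<^sub>R pb n t - \<rho> *\<^sub>R rd n t" for n t
  have rb0: "uniform_limit ?I (\<lambda>n t. rb n t - \<rho>) (\<lambda>_. 0) sequentially"
  proof -
    have "uniform_limit ?I (\<lambda>n t. rb n t - \<rho>) (\<lambda>_. \<rho> - \<rho>) sequentially"
      by (intro uniform_limit_minus rb_lim uniform_limit_const)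
    then show ?thesis by simp
  qed
  have r0: "uniform_limit ?I (\<lambda>n t. r n t - rhat t) (\<lambda>_. 0) sequentially"
  proof -
    have "uniform_limit ?I (\<lambda>n t. r n t - rhat t) (\<lambda>t. rhat t - rhat t) sequentially"
      by (intro uniform_limit_minus r_lim uniform_limit_const)
    then show ?thesis by simp
  qed
  have rd_bound: "\<forall>\<^sub>F n in sequentially. \<forall>t\<in>?I. norm (rd n t) \<le> (K * C + 1) / c0"
    using rb_low pb_bound uniform_limitD[OF e zero_less_one]
  proof eventually_elim
    case (elim n)
    show ?case
    proof
      fix t assume t: "t \<in> ?I"
      have "norm (K *\<^sub>R pb n t - e n t) \<le> K * C + 1"
        using elim t K by (intro order_trans[OF norm_triangle_ineq4] add_mono) (auto intro: less_imp_le)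
      moreover have "c0 \<le> rb n t" using elim(1) t by blast
      ultimately have "norm (K *\<^sub>R pb n t - e n t) / rb n t \<le> (K * C + 1) / c0"
        using c0 by (intro frac_le) (auto intro: order_trans[OF norm_ge_zero])
      then show "norm (rd n t) \<le> (K * C + 1) / c0"
        using \<open>c0 \<le> rb n t\<close> c0 by (simp add: rd_def)
    qed
  qed
  have w0: "uniform_limit ?I w (\<lambda>_. 0) sequentially"
  proof -
    have "uniform_limit ?I (\<lambda>n t. (rb n t - \<rho>) *\<^sub>R rd n t + e n t) (\<lambda>t. 0 + 0) sequentially"
      by (intro uniform_limit_add null[OF bounded_bilinear_scaleR rb0 rd_bound] e)
    then have l: "uniform_limit ?I (\<lambda>n t. (rb n t - \<rho>) *\<^sub>R rd n t + e n t) (\<lambda>t. 0) sequentially" by simp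
    show ?thesis
    proof (rule uniform_limit_cong[THEN iffD1, OF _ _ l])
      show "\<forall>\<^sub>F n in sequentially. \<forall>t\<in>?I. (rb n t - \<rho>) *\<^sub>R rd n t + e n t = w n t"
        using rb_low
      proof eventually_elim
        case (elim n)
        show ?case
        proof
          fix t assume "t \<in> ?I"
          then have "rb n t \<noteq> 0" using elim c0 by force
          then have "rb n t *\<^sub>R rd n t = K *\<^sub>R pb n t - e n t"
            by (simp add: rd_def)
          then show "(rb n t - \<rho>) *\<^sub>R rd n t + e n t = w n t"
            by (simp add: w_def scaleR_diff_left)
        qed
      qed
    qed simp
  qed
  define H where "H n t = (LBINT s=ereal t0..ereal t. rb n s *\<^sub>R E s + (K / c) *\<^sub>R cross3 (pb n s) (B s))" for n t
  have H: "\<forall>\<^sub>F n in sequentially. \<forall>t\<in>?I.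
      (H n has_vector_derivative rb n t *\<^sub>R E t + (K / c) *\<^sub>R cross3 (pb n t) (B t)) (at t within ?I)"
    using cont
  proof eventually_elim
    case (elim n)
    then have "continuous_on ?I (\<lambda>s. rb n s *\<^sub>R E s + (K / c) *\<^sub>R cross3 (pb n s) (B s))"
      by (intro continuous_intros E continuous_on_cross cB) auto
    from antiderivative[OF this t0] show ?case
      unfolding H_def by blast
  qed
  \<comment> \<open>integration by parts: subtracting \<open>(r n - rhat) \<times> B\<close> removes the derivative of \<open>r n - rhat\<close>, which
    need not tend to \<open>0\<close>\<close>
  define f where "f n t = H n t - h t - (\<rho> / c) *\<^sub>R cross3 (r n t - rhat t) (B t)" for n t
  define f' where "f' n t = (rb n t - \<rho>) *\<^sub>R E t + (1 / c) *\<^sub>R cross3 (w n t) (B t)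
      - (\<rho> / c) *\<^sub>R cross3 (r n t - rhat t) (B' t)" for n t
  note xb = null[OF bounded_bilinear_cross3 r0 bounded_on[OF LB]]
  have f0: "uniform_limit ?I f (\<lambda>_. 0) sequentially"
  proof (rule uniform_limit_null_from_derivative[OF _ _ _ t0])
    show "\<forall>\<^sub>F n in sequentially. \<forall>t\<in>?I. (f n has_vector_derivative f' n t) (at t within ?I)"
      using H r_der
    proof eventually_elim
      case (elim n)
      show ?case
      proof
        fix t assume t: "t \<in> ?I"
        have "((\<lambda>t. r n t - rhat t) has_vector_derivative rd n t - v t) (at t within ?I)"
          using elim t rhat_derivative[OF t] unfolding rd_def by (intro has_vector_derivative_diff) auto
        from bounded_bilinear.has_vector_derivative[OF bounded_bilinear_cross3 this B[OF t]]
        have x: "((\<lambda>t. cross3 (r n t - rhat t) (B t)) has_vector_derivative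
            cross3 (r n t - rhat t) (B' t) + cross3 (rd n t - v t) (B t)) (at t within ?I)" .
        have "(f n has_vector_derivative
            (rb n t *\<^sub>R E t + (K / c) *\<^sub>R cross3 (pb n t) (B t)) - (\<rho> *\<^sub>R E t + (\<rho> / c) *\<^sub>R cross3 (v t) (B t))
            - (\<rho> / c) *\<^sub>R (cross3 (r n t - rhat t) (B' t) + cross3 (rd n t - v t) (B t))) (at t within ?I)"
          unfolding f_def using elim t
          by (intro has_vector_derivative_diff h bounded_linear.has_vector_derivative[OF bounded_linear_scaleR_right] x) auto
        moreover have "(rb n t *\<^sub>R E t + (K / c) *\<^sub>R cross3 (pb n t) (B t)) - (\<rho> *\<^sub>R E t + (\<rho> / c) *\<^sub>R cross3 (v t) (B t))
            - (\<rho> / c) *\<^sub>R (cross3 (r n t - rhat t) (B' t) + cross3 (rd n t - v t) (B t)) = f' n t"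
          unfolding f'_def w_def
          by (simp add: Cross3.left_diff_distrib cross_mult_left algebra_simps)
        ultimately show "(f n has_vector_derivative f' n t) (at t within ?I)" by simp
      qed
    qed
    have "uniform_limit ?I (\<lambda>n t. (rb n t - \<rho>) *\<^sub>R E t + (1 / c) *\<^sub>R cross3 (w n t) (B t)
      - (\<rho> / c) *\<^sub>R cross3 (r n t - rhat t) (B' t)) (\<lambda>t. 0 + (1 / c) *\<^sub>R 0 - (\<rho> / c) *\<^sub>R 0) sequentially"
      by (intro uniform_limit_minus uniform_limit_add
          null[OF bounded_bilinear_scaleR rb0 bounded_on[OF LE]]
          bounded_linear.uniform_limit[OF bounded_linear_scaleR_right]
          null[OF bounded_bilinear_cross3 w0 bounded_on[OF LB]]
          null[OF bounded_bilinear_cross3 r0 bounded_on[OF LB']])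
    then show "uniform_limit ?I f' (\<lambda>_. 0) sequentially"
      unfolding f'_def by simp
    have "(\<lambda>n. - ((\<rho> / c) *\<^sub>R cross3 (r n t0 - rhat t0) (B t0))) \<longlonglongrightarrow> - ((\<rho> / c) *\<^sub>R 0)"
      by (intro tendsto_intros tendsto_uniform_limitI[OF xb t0])
    then show "(\<lambda>n. f n t0) \<longlonglongrightarrow> 0"
      by (simp add: f_def H_def h0)
  qed
  have Hh: "uniform_limit ?I (\<lambda>n t. H n t - h t) (\<lambda>_. 0) sequentially"
  proof -
    have "uniform_limit ?I (\<lambda>n t. f n t + (\<rho> / c) *\<^sub>R cross3 (r n t - rhat t) (B t)) (\<lambda>t. 0 + (\<rho> / c) *\<^sub>R 0) sequentially"
      by (intro uniform_limit_add f0 bounded_linear.uniform_limit[OF bounded_linear_scaleR_right] xb)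
    then show ?thesis by (simp add: f_def)
  qed
  \<comment> \<open>the center compared with the integral of its approximate velocity \<open>(K / \<rho>) (pb n t0 + h)\<close>\<close>
  define k where "k n t = (r n t - r n t0) - (K / \<rho>) *\<^sub>R ((t - t0) *\<^sub>R pb n t0 + hh t)" for n t
  define k' where "k' n t = (1 / \<rho>) *\<^sub>R (K *\<^sub>R (err n t + (H n t - h t)) - w n t)" for n t
  have k0: "uniform_limit ?I k (\<lambda>_. 0) sequentially"
  proof (rule uniform_limit_null_from_derivative[OF _ _ _ t0])
    show "\<forall>\<^sub>F n in sequentially. \<forall>t\<in>?I. (k n has_vector_derivative k' n t) (at t within ?I)"
      using r_der pb_eq
    proof eventually_elim
      case (elim n)
      show ?case
      proof
        fix t assume t: "t \<in> ?I"
        have lin: "((\<lambda>t. (t - t0) *\<^sub>R pb n t0) has_vector_derivative pb n t0) (at t within ?I)"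
          unfolding has_vector_derivative_def by (auto intro!: derivative_eq_intros)
        have rn: "(r n has_vector_derivative rd n t) (at t within ?I)"
          using elim t by (simp add: rd_def)
        have "(k n has_vector_derivative (rd n t - 0) - (K / \<rho>) *\<^sub>R (pb n t0 + h t)) (at t within ?I)"
          unfolding k_def
          by (intro has_vector_derivative_diff has_vector_derivative_const rn has_vector_derivative_add lin hh t
              bounded_linear.has_vector_derivative[OF bounded_linear_scaleR_right])
        moreover have "(rd n t - 0) - (K / \<rho>) *\<^sub>R (pb n t0 + h t) = k' n t"
        proof -
          have "pb n t - pb n t0 = err n t + H n t"
            using elim t by (simp add: H_def)
          then have err_eq: "err n t = pb n t - pb n t0 - H n t"
            by (simp add: algebra_simps)
          have "k' n t = (1 / \<rho>) *\<^sub>R (K *\<^sub>R (pb n t - pb n t0 - h t) - w n t)"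
            unfolding k'_def err_eq by (simp add: algebra_simps)
          also have "\<dots> = (1 / \<rho>) *\<^sub>R (\<rho> *\<^sub>R rd n t - K *\<^sub>R (pb n t0 + h t))"
            unfolding w_def by (simp add: algebra_simps)
          also have "\<dots> = rd n t - (K / \<rho>) *\<^sub>R (pb n t0 + h t)"
            using \<rho> by (simp add: scaleR_diff_right)
          finally show ?thesis by simp
        qed
        ultimately show "(k n has_vector_derivative k' n t) (at t within ?I)" by simp
      qed
    qed
    have "uniform_limit ?I k' (\<lambda>t. (1 / \<rho>) *\<^sub>R (K *\<^sub>R (0 + 0) - 0)) sequentially"
      unfolding k'_def
      by (intro uniform_limit_minus uniform_limit_add err Hh w0
          bounded_linear.uniform_limit[OF bounded_linear_scaleR_right])
    then show "uniform_limit ?I k' (\<lambda>_. 0) sequentially" by simp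
    show "(\<lambda>n. k n t0) \<longlonglongrightarrow> 0" by (simp add: k_def h0)
  qed
  have lim: "(\<lambda>n. (K / \<rho>) *\<^sub>R ((t - t0) *\<^sub>R pb n t0)) \<longlonglongrightarrow> rhat t - rhat t0 - (K / \<rho>) *\<^sub>R hh t"
    if t: "t \<in> ?I" for t
  proof -
    have "(\<lambda>n. r n t - r n t0 - (K / \<rho>) *\<^sub>R hh t - k n t) \<longlonglongrightarrow> rhat t - rhat t0 - (K / \<rho>) *\<^sub>R hh t - 0"
      by (intro tendsto_intros tendsto_uniform_limitI[OF r_lim] tendsto_uniform_limitI[OF k0] t t0)
    then show ?thesis by (simp add: k_def scaleR_add_right)
  qed
  \<comment> \<open>a single time other than \<open>t0\<close> shows that the initial momenta converge\<close>
  obtain t1 where t1: "t1 \<in> ?I" "t1 \<noteq> t0"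
    using Tm_less_Tp by (metis atLeastAtMost_iff less_irrefl less_imp_le order_refl)
  define p0 where "p0 = (\<rho> / (K * (t1 - t0))) *\<^sub>R (rhat t1 - rhat t0 - (K / \<rho>) *\<^sub>R hh t1)"
  have "(\<lambda>n. (\<rho> / (K * (t1 - t0))) *\<^sub>R ((K / \<rho>) *\<^sub>R ((t1 - t0) *\<^sub>R pb n t0))) \<longlonglongrightarrow> p0"
    unfolding p0_def by (intro tendsto_intros lim t1)
  moreover have "(\<rho> / (K * (t1 - t0))) *\<^sub>R ((K / \<rho>) *\<^sub>R ((t1 - t0) *\<^sub>R z)) = z" for z :: "real^3"
  proof -
    have "(\<rho> / (K * x)) *\<^sub>R ((K / \<rho>) *\<^sub>R (x *\<^sub>R z)) = z" if "x \<noteq> 0" for x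
      using K \<rho> that by simp
    from this[of "t1 - t0"] show ?thesis using t1 by simp
  qed
  ultimately have p0: "(\<lambda>n. pb n t0) \<longlonglongrightarrow> p0" by simp
  have rhat_eq: "rhat t = rhat t0 + (K / \<rho>) *\<^sub>R ((t - t0) *\<^sub>R p0 + hh t)" if t: "t \<in> ?I" for t
  proof -
    have "(\<lambda>n. (K / \<rho>) *\<^sub>R ((t - t0) *\<^sub>R pb n t0)) \<longlonglongrightarrow> (K / \<rho>) *\<^sub>R ((t - t0) *\<^sub>R p0)"
      by (intro tendsto_intros p0)
    from LIMSEQ_unique[OF this lim[OF t]] show ?thesis
      by (simp add: algebra_simps)
  qed
  have v_eq: "v t = (K / \<rho>) *\<^sub>R (p0 + h t)" if t: "t \<in> ?I" for t
  proof -
    have lin: "((\<lambda>t. (t - t0) *\<^sub>R p0) has_vector_derivative p0) (at t within ?I)"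
      unfolding has_vector_derivative_def by (auto intro!: derivative_eq_intros)
    have "((\<lambda>t. rhat t0 + (K / \<rho>) *\<^sub>R ((t - t0) *\<^sub>R p0 + hh t)) has_vector_derivative
        0 + (K / \<rho>) *\<^sub>R (p0 + h t)) (at t within ?I)"
      by (intro has_vector_derivative_add has_vector_derivative_const lin hh t
          bounded_linear.has_vector_derivative[OF bounded_linear_scaleR_right])
    then have "((\<lambda>t. rhat t0 + (K / \<rho>) *\<^sub>R ((t - t0) *\<^sub>R p0 + hh t)) has_vector_derivative
        (K / \<rho>) *\<^sub>R (p0 + h t)) (at t within ?I)"
      by simp
    then have "(rhat has_vector_derivative (K / \<rho>) *\<^sub>R (p0 + h t)) (at t within ?I)"
      by (rule has_vector_derivative_transform[OF t, rotated]) (rule rhat_eq)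
    then show ?thesis
      using vector_derivative_unique_within[OF trivial_limit_time[OF t] rhat_derivative[OF t]] by blast
  qed
  have "((\<lambda>t. (K / \<rho>) *\<^sub>R (p0 + h t)) has_vector_derivative
      (K / \<rho>) *\<^sub>R (0 + (\<rho> *\<^sub>R E t + (\<rho> / c) *\<^sub>R cross3 (v t) (B t)))) (at t within ?I)"
    by (intro has_vector_derivative_add has_vector_derivative_const h t
        bounded_linear.has_vector_derivative[OF bounded_linear_scaleR_right])
  moreover have "(K / \<rho>) *\<^sub>R (0 + (\<rho> *\<^sub>R E t + (\<rho> / c) *\<^sub>R cross3 (v t) (B t)))
      = K *\<^sub>R (E t + (1 / c) *\<^sub>R cross3 (v t) (B t))"
    using \<rho> by (simp add: scaleR_add_right)
  ultimately have "((\<lambda>t. (K / \<rho>) *\<^sub>R (p0 + h t)) has_vector_derivative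
      K *\<^sub>R (E t + (1 / c) *\<^sub>R cross3 (v t) (B t))) (at t within ?I)"
    by simp
  then show ?thesis
    by (rule has_vector_derivative_transform[OF t, rotated]) (rule v_eq)
qed

section \<open>The limit potentials on the trajectory\<close>

context ball_tube
begin

text \<open>Derivatives within the slab are unique at points of the tube, since they are derivatives within the
  tube.\<close>

lemma slab_derivative_eq:
  assumes f: "(f has_derivative f') (at p within slab Tm Tp)" and p: "p \<in> S"
  shows "frechet_derivative f (at p within slab Tm Tp) = f'"
proof -
  have sub: "S \<subseteq> slab Tm Tp" by (auto simp: tube_def slab_def)
  have "(f has_derivative frechet_derivative f (at p within slab Tm Tp)) (at p within slab Tm Tp)"
    using f frechet_derivative_works differentiable_def by blast
  from has_derivative_subset[OF this sub] has_derivative_subset[OF f sub] show ?thesis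
    using derivative_tube_eq p by metis
qed

lemma slab_time_derivative:
  fixes k :: "real \<Rightarrow> 'b::real_normed_vector"
  assumes "(k has_vector_derivative k') (at t within {Tm..Tp})"
  shows "((\<lambda>z. k (fst z)) has_derivative (\<lambda>h. fst h *\<^sub>R k')) (at (t, x) within slab Tm Tp)"
proof -
  have "(fst has_derivative fst) (at (t, x) within slab Tm Tp)"
    by (intro bounded_linear_imp_has_derivative bounded_linear_fst)
  moreover have "fst ` slab Tm Tp \<subseteq> {Tm..Tp}" by (auto simp: slab_def)
  then have "(k has_derivative (\<lambda>x. x *\<^sub>R k')) (at (fst (t, x)) within fst ` slab Tm Tp)"
    using assms unfolding has_vector_derivative_def by (auto intro: has_derivative_subset)
  ultimately show ?thesis
    by (rule has_derivative_in_compose[where f=fst and g=k])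
qed

lemma trajectory_mem: "t \<in> {Tm..Tp} \<Longrightarrow> (t, rhat t) \<in> S"
  using R_pos by (simp add: mem_tube)

context
  fixes U :: "spacetime set"
  assumes U: "open U" and traj_U: "\<And>t. t \<in> {Tm..Tp} \<Longrightarrow> (t, rhat t) \<in> U"
begin

lemma along_trajectory_derivative:
  fixes g :: "spacetime \<Rightarrow> 'b::real_normed_vector"
  assumes g: "C1_on U g" and t: "t \<in> {Tm..Tp}"
  shows "((\<lambda>t. g (t, rhat t)) has_vector_derivative
    frechet_derivative g (at (t, rhat t) within U) (1, v t)) (at t within {Tm..Tp})"
proof -
  have g': "(g has_derivative frechet_derivative g (at (t, rhat t) within U)) (at (t, rhat t) within U)"
    using g traj_U[OF t] unfolding C1_on_def differentiable_on_def by (blast intro: frechet_derivative_works[THEN iffD1])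
  have \<gamma>: "((\<lambda>s. (s, rhat s)) has_derivative (\<lambda>h. h *\<^sub>R (1, v t))) (at t within {Tm..Tp})"
    using rhat_derivative[OF t] unfolding has_vector_derivative_def
    by (auto intro!: derivative_eq_intros)
  have "(g has_derivative frechet_derivative g (at (t, rhat t) within U)) (at (t, rhat t) within (\<lambda>s. (s, rhat s)) ` {Tm..Tp})"
    by (rule has_derivative_subset[OF g']) (use traj_U in auto)
  from has_derivative_in_compose[where f="\<lambda>s. (s, rhat s)" and g=g, OF \<gamma> this] show ?thesis
    unfolding has_vector_derivative_def by (simp only: linear_scale[OF has_derivative_linear[OF g']])
qed

lemma direction_sum_open:
  fixes g :: "spacetime \<Rightarrow> 'b::real_normed_vector"
  assumes g: "C1_on U g" and p: "p \<in> U"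
  shows "frechet_derivative g (at p within U) (s, w) = s *\<^sub>R pd_t U g p + (\<Sum>i\<in>UNIV. w $ i *\<^sub>R pd_x U i g p)"
proof -
  have lin: "linear (frechet_derivative g (at p within U))"
    using g p unfolding C1_on_def differentiable_on_def
    by (blast intro: has_derivative_linear frechet_derivative_works[THEN iffD1])
  have "(s, w) = s *\<^sub>R (1, 0) + (\<Sum>i\<in>UNIV. w $ i *\<^sub>R (0 :: real, axis i 1 :: real^3))"
    by (simp add: prod_eq_iff fst_sum snd_sum basis_expansion flip: scalar_mult_eq_scaleR)
  then show ?thesis
    unfolding pd_t_def pd_x_def
    by (simp only: linear_add[OF lin] linear_sum[OF lin] linear_scale[OF lin])
qed

lemma continuous_along_trajectory:
  assumes "continuous_on U g"
  shows "continuous_on {Tm..Tp} (\<lambda>t. g (t, rhat t))"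
  by (rule continuous_on_compose2[OF assms]) (auto intro!: continuous_intros continuous_rhat traj_U)

lemma continuous_along_trajectory_derivative:
  assumes g: "C1_on U g"
  shows "continuous_on {Tm..Tp} (\<lambda>t. frechet_derivative g (at (t, rhat t) within U) (1, v t))"
proof -
  have c: "continuous_on U (pd_t U g)" "continuous_on U (pd_x U i g)" for i
    using g unfolding C1_on_def pd_t_def pd_x_def by blast+
  have "continuous_on {Tm..Tp} (\<lambda>t. pd_t U g (t, rhat t) + (\<Sum>i\<in>UNIV. v t $ i *\<^sub>R pd_x U i g (t, rhat t)))"
    by (intro continuous_intros continuous_along_trajectory c continuous_velocity)
  then show ?thesis
    by (rule continuous_on_eq) (simp add: direction_sum_open[OF g traj_U])
qed

text \<open>On the trajectory the affine approximation of \<open>f\<close> has the same first derivatives as \<open>f\<close>: in the time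
  derivative, the motion of the base point cancels against the linear term.\<close>

lemma
  fixes f fi :: "spacetime \<Rightarrow> 'b::real_normed_vector"
  assumes f: "C2_on U f" and t: "t \<in> {Tm..Tp}"
    and fi: "\<And>t x. t \<in> {Tm..Tp} \<Longrightarrow> fi (t, x) = affine_at (f (t, rhat t)) (grad U f (t, rhat t)) (rhat t) x"
  shows affine_pd_t: "pd_t (slab Tm Tp) fi (t, rhat t) = pd_t U f (t, rhat t)"
    and affine_pd_x: "pd_x (slab Tm Tp) i fi (t, rhat t) = pd_x U i f (t, rhat t)"
proof -
  let ?p = "(t, rhat t)" and ?L = "frechet_derivative f (at (t, rhat t) within U)"
  have C1: "C1_on U f" and C1': "C1_on U (\<lambda>p. frechet_derivative f (at p within U) h)" for h
    using f unfolding C2_on_def by blast+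
  define G where "G i s = pd_x U i f (s, rhat s)" for i s
  have d1: "((\<lambda>z. f (fst z, rhat (fst z))) has_derivative (\<lambda>h. fst h *\<^sub>R ?L (1, v t))) (at ?p within slab Tm Tp)"
    by (rule slab_time_derivative[where k="\<lambda>s. f (s, rhat s)", OF along_trajectory_derivative[OF C1 t]])
  have d2: "((\<lambda>z. (snd z - rhat (fst z)) $ i) has_derivative (\<lambda>h. (snd h - fst h *\<^sub>R v t) $ i)) (at ?p within slab Tm Tp)" for i
    by (intro has_derivative_nth has_derivative_diff slab_time_derivative[OF rhat_derivative[OF t]]
        bounded_linear_imp_has_derivative bounded_linear_snd)
  have d3: "((\<lambda>z. G i (fst z)) has_derivative (\<lambda>h. fst h *\<^sub>R frechet_derivative (pd_x U i f) (at ?p within U) (1, v t))) (at ?p within slab Tm Tp)" for i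
  proof (rule slab_time_derivative)
    have "C1_on U (pd_x U i f)" using C1' unfolding pd_x_def by blast
    from along_trajectory_derivative[OF this t]
    show "(G i has_vector_derivative frechet_derivative (pd_x U i f) (at ?p within U) (1, v t)) (at t within {Tm..Tp})"
      unfolding G_def .
  qed
  have d: "((\<lambda>z. f (fst z, rhat (fst z)) + (\<Sum>i\<in>UNIV. (snd z - rhat (fst z)) $ i *\<^sub>R G i (fst z))) has_derivative
      (\<lambda>h. fst h *\<^sub>R ?L (1, v t) + (\<Sum>i\<in>UNIV. (snd ?p - rhat (fst ?p)) $ i *\<^sub>R (fst h *\<^sub>R frechet_derivative (pd_x U i f) (at ?p within U) (1, v t))
        + (snd h - fst h *\<^sub>R v t) $ i *\<^sub>R G i (fst ?p)))) (at ?p within slab Tm Tp)"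
    by (intro has_derivative_add d1 has_derivative_sum has_derivative_scaleR d2 d3)
  have "(fi has_derivative (\<lambda>h. fst h *\<^sub>R ?L (1, v t) + (\<Sum>i\<in>UNIV. (snd ?p - rhat (fst ?p)) $ i *\<^sub>R (fst h *\<^sub>R frechet_derivative (pd_x U i f) (at ?p within U) (1, v t))
        + (snd h - fst h *\<^sub>R v t) $ i *\<^sub>R G i (fst ?p)))) (at ?p within slab Tm Tp)"
  proof (rule has_derivative_transform[OF _ _ d])
    show "?p \<in> slab Tm Tp" using t by (simp add: slab_def)
    show "fi z = f (fst z, rhat (fst z)) + (\<Sum>i\<in>UNIV. (snd z - rhat (fst z)) $ i *\<^sub>R G i (fst z))"
      if "z \<in> slab Tm Tp" for z
      using that fi[of "fst z" "snd z"] by (auto simp: slab_def affine_at_def grad_def G_def)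
  qed
  note e = slab_derivative_eq[OF this trajectory_mem[OF t]]
  note ds = direction_sum_open[OF C1 traj_U[OF t]]
  have sum_axis: "(\<Sum>k\<in>UNIV. axis i 1 $ k *\<^sub>R G k t) = G i t" for i
    by (simp add: axis_def if_distrib[of "\<lambda>x. x *\<^sub>R _"] cong: if_cong)
  show "pd_t (slab Tm Tp) fi ?p = pd_t U f ?p"
    unfolding pd_t_def[of "slab Tm Tp"] e ds by (simp add: G_def sum_negf)
  show "pd_x (slab Tm Tp) i fi ?p = pd_x U i f ?p"
    unfolding pd_x_def[of "slab Tm Tp"] e ds by (simp add: sum_axis) (simp add: G_def)
qed

end

end

section \<open>Newton's law\<close>

theorem theorem3:
  fixes m q chi c Tm Tp :: real
    and G1' :: "real \<Rightarrow> real"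
    and D :: "spacetime set"
    and \<phi> \<phi>\<^sub>i :: "spacetime \<Rightarrow> real"
    and A A\<^sub>i :: "spacetime \<Rightarrow> real^3"
    and rhat :: "real \<Rightarrow> real^3"
    and \<psi> :: "nat \<Rightarrow> spacetime \<Rightarrow> complex"
  assumes "0 < m" and "0 < q" and "0 < chi" and "0 < c"
    and "open D" and "C2_on D \<phi>" and "C2_on D A"
    and "trajectory Tm Tp rhat"
    and "\<And>t. t \<in> {Tm..Tp} \<Longrightarrow> (t, rhat t) \<in> D"
    and "\<And>t x. t \<in> {Tm..Tp} \<Longrightarrow>
           \<phi>\<^sub>i (t, x) = affine_at (\<phi> (t, rhat t)) (grad D \<phi> (t, rhat t)) (rhat t) x"
    and "\<And>t x. t \<in> {Tm..Tp} \<Longrightarrow>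
           A\<^sub>i (t, x) = affine_at (A (t, rhat t)) (grad D A (t, rhat t)) (rhat t) x"
    and "nls.concentrate m q chi c G1' Tm Tp rhat \<phi>\<^sub>i A\<^sub>i \<psi>"
  shows "\<forall>t\<in>{Tm..Tp}.
    m *\<^sub>R acceleration Tm Tp rhat t =
      q *\<^sub>R electric_field c D \<phi> A (t, rhat t)
      + (q / c) *\<^sub>R cross3 (velocity Tm Tp rhat t) (curl D A (t, rhat t))"
proof -
  interpret nls m q chi c G1' Tm Tp rhat .
  \<comment> \<open>the radius is immaterial here: this tube serves for facts about the trajectory only\<close>
  interpret T: ball_tube Tm Tp rhat 1
    using assms(8) by unfold_locales auto
  let ?I = "{Tm..Tp}"
  have nonlin: "nonlinearity_condition G1'"
    using assms(12) unfolding concentrate_def by blast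
  obtain a R pn An t0 rho_inf where aR: "\<And>n. 0 < a n \<and> 0 < R n" and R0: "R \<longlonglongrightarrow> 0"
    and loc: "localized R \<phi>\<^sub>i pn" "localized R A\<^sub>i An"
    and psi: "\<And>n. C2_on (tube Tm Tp rhat (R n)) (\<psi> n)"
    and sol: "\<And>n. nls_solution (tube Tm Tp rhat (R n)) (a n) (pn n) (An n) (\<psi> n)"
    and P: "\<exists>C. \<forall>n. \<forall>t\<in>?I. norm (LINT x:cball (rhat t) (R n)|lborel. P (tube Tm Tp rhat (R n)) (An n) (\<psi> n) (t, x)) \<le> C"
    and rb: "\<exists>C c0 n0. 0 < c0 \<and> (\<forall>n\<ge>n0. \<forall>t\<in>?I. c0 \<le> rhobar (R n) (\<psi> n) t \<and> rhobar (R n) (\<psi> n) t \<le> C)"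
    and t0: "t0 \<in> ?I" and rho_inf: "(\<lambda>n. rhobar (R n) (\<psi> n) t0) \<longlonglongrightarrow> rho_inf"
    and Q0: "uniform_limit ?I (\<lambda>n. Q0 (R n) (a n) (pn n) (An n) (\<psi> n) t0) (\<lambda>_. 0) sequentially"
    and Q01: "uniform_limit ?I (\<lambda>n. Q01 (R n) (An n) (\<psi> n) t0) (\<lambda>_. 0) sequentially"
    and Q20: "uniform_limit ?I (\<lambda>n. Q20 (R n) (\<psi> n)) (\<lambda>_. 0) sequentially"
    and Q22: "uniform_limit ?I (\<lambda>n. Q22 (R n) (An n) (\<psi> n)) (\<lambda>_. 0) sequentially"
    and Q23: "uniform_limit ?I (\<lambda>n. Q23 (R n) (An n) (\<psi> n) t0) (\<lambda>_. 0) sequentially"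
    and Q3: "uniform_limit ?I (\<lambda>n t. LBINT s=ereal t0..ereal t.
                 (Q30 \<phi>\<^sub>i A\<^sub>i (R n) (pn n) (An n) (\<psi> n) s + Q31 A\<^sub>i (R n) (An n) (\<psi> n) s)) (\<lambda>_. 0) sequentially"
    using assms(12) unfolding concentrate_def by clarify blast
  obtain C where C: "\<And>n t. t \<in> ?I \<Longrightarrow>
      norm (LINT x:cball (rhat t) (R n)|lborel. P (tube Tm Tp rhat (R n)) (An n) (\<psi> n) (t, x)) \<le> C"
    using P by blast
  obtain c0 n0 where c0: "0 < c0" and rb_low: "\<And>n t. n \<ge> n0 \<Longrightarrow> t \<in> ?I \<Longrightarrow> c0 \<le> rhobar (R n) (\<psi> n) t"
    using rb by blast
  have N: "nls_tube m q chi c G1' Tm Tp rhat (R n) (a n) (pn n) (An n) (\<psi> n)" for n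
  proof unfold_locales
    show "C1_on (tube Tm Tp rhat (R n)) (pn n)" "C1_on (tube Tm Tp rhat (R n)) (An n)"
      using loc unfolding localized_def C2_on_def by blast+
  qed (use assms aR nonlin psi sol in auto)
  define E where "E t = electric_field c D \<phi> A (t, rhat t)" for t
  define B where "B t = curl D A (t, rhat t)" for t
  have E_eq: "E_inf \<phi>\<^sub>i A\<^sub>i t = E t" if t: "t \<in> ?I" for t
    unfolding E_inf_def E_def electric_field_def grad_def
    using T.affine_pd_x[OF assms(5,9,6) t assms(10)] T.affine_pd_t[OF assms(5,9,7) t assms(11)] by simp
  have B_eq: "B_inf A\<^sub>i t = B t" if t: "t \<in> ?I" for t
    unfolding B_inf_def B_def curl_def
    using T.affine_pd_x[OF assms(5,9,7) t assms(11)] by simp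
  have C1D: "C1_on D \<phi>" "C1_on D A" "C1_on D (pd_x D i A)" for i
    using assms(6,7) unfolding C2_on_def pd_x_def by blast+
  have cpd: "continuous_on D (pd_x D i \<phi>)" "continuous_on D (pd_t D A)" for i
    using C1D unfolding C1_on_def pd_t_def pd_x_def by blast+
  have cE: "continuous_on ?I E"
    unfolding E_def electric_field_def grad_def
    by (intro continuous_intros T.continuous_along_trajectory[OF assms(5,9)] cpd)
  \<comment> \<open>\<open>B\<close> is continuously differentiable in time, as \<open>A\<close> is twice continuously differentiable\<close>
  define dA where "dA i t = frechet_derivative (pd_x D i A) (at (t, rhat t) within D) (1, velocity Tm Tp rhat t)" for i t
  have dA: "((\<lambda>t. pd_x D i A (t, rhat t)) has_vector_derivative dA i t) (at t within ?I)" if "t \<in> ?I" for i t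
    unfolding dA_def by (rule T.along_trajectory_derivative[OF assms(5,9) C1D(3) that])
  have cdA: "continuous_on ?I (dA i)" for i
    unfolding dA_def by (rule T.continuous_along_trajectory_derivative[OF assms(5,9) C1D(3)])
  define B' where "B' t = (vector [dA 2 t $ 3 - dA 3 t $ 2, dA 3 t $ 1 - dA 1 t $ 3, dA 1 t $ 2 - dA 2 t $ 1] :: real^3)" for t
  have B': "(B has_vector_derivative B' t) (at t within ?I)" if "t \<in> ?I" for t
    unfolding B_def curl_def B'_def
    by (intro has_vector_derivative_vec3 DERIV_diff has_vector_derivative_nth dA that)
  have cB': "continuous_on ?I B'"
    unfolding B'_def vector3_eq_axis_sum by (intro continuous_intros cdA)
  define pb where "pb n = nls_tube.pbar q chi c Tm Tp rhat (R n) (An n) (\<psi> n)" for n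
  have rho_pos: "0 < rho_inf"
  proof -
    have "c0 \<le> rho_inf"
      using rb_low[OF _ t0] by (intro LIMSEQ_le_const[OF rho_inf]) blast
    then show ?thesis using c0 by simp
  qed
  have rb_pos: "0 < rhobar (R n) (\<psi> n) t" if "n \<ge> n0" "t \<in> ?I" for n t
    using rb_low[OF that] c0 by simp
  have newton: "(velocity Tm Tp rhat has_vector_derivative
      (q / m) *\<^sub>R (E t + (1 / c) *\<^sub>R cross3 (velocity Tm Tp rhat t) (B t))) (at t within ?I)" if t: "t \<in> ?I" for t
  proof (rule T.newton_limit[OF t0 _ c0 cE cB' B' _ _ _ _ rho_pos _ _ _ _ _ t,
        where r="\<lambda>n. center (R n) (\<psi> n)" and rb="\<lambda>n. rhobar (R n) (\<psi> n)" and pb=pb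
          and e="\<lambda>n t. Q20 (R n) (\<psi> n) t + Q22 (R n) (An n) (\<psi> n) t"
          and err="\<lambda>n t. Q01 (R n) (An n) (\<psi> n) t0 t - Q0 (R n) (a n) (pn n) (An n) (\<psi> n) t0 t
            + (LBINT s=ereal t0..ereal t. (Q30 \<phi>\<^sub>i A\<^sub>i (R n) (pn n) (An n) (\<psi> n) s + Q31 A\<^sub>i (R n) (An n) (\<psi> n) s))"])
    show "0 < q / m" using assms(1,2) by simp
    show "\<forall>\<^sub>F n in sequentially. \<forall>t\<in>?I. (center (R n) (\<psi> n) has_vector_derivative
        (1 / rhobar (R n) (\<psi> n) t) *\<^sub>R ((q / m) *\<^sub>R pb n t - (Q20 (R n) (\<psi> n) t + Q22 (R n) (An n) (\<psi> n) t))) (at t within ?I)"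
      using eventually_ge_at_top[of n0]
    proof eventually_elim
      case (elim n)
      show ?case
        using nls_tube.center_derivative[OF N _ rb_pos[OF elim]] by (simp add: pb_def diff_diff_eq)
    qed
    show "uniform_limit ?I (\<lambda>n t. Q20 (R n) (\<psi> n) t + Q22 (R n) (An n) (\<psi> n) t) (\<lambda>_. 0) sequentially"
      using uniform_limit_add[OF Q20 Q22] by simp
    show "uniform_limit ?I (\<lambda>n. center (R n) (\<psi> n)) rhat sequentially"
    proof (rule uniform_limitI)
      fix e :: real assume "0 < e"
      then have "\<forall>\<^sub>F n in sequentially. R n < e"
        using R0 order_tendstoD(2) by blast
      with eventually_ge_at_top[of n0]
      show "\<forall>\<^sub>F n in sequentially. \<forall>t\<in>?I. dist (center (R n) (\<psi> n) t) (rhat t) < e"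
      proof eventually_elim
        case (elim n)
        then show ?case
          using nls_tube.norm_center_diff_le[OF N _ rb_pos] by (fastforce simp: dist_norm)
      qed
    qed
    show "uniform_limit ?I (\<lambda>n. rhobar (R n) (\<psi> n)) (\<lambda>_. rho_inf) sequentially"
    proof -
      have "uniform_limit ?I (\<lambda>n t. rhobar (R n) (\<psi> n) t0) (\<lambda>_. rho_inf) sequentially"
        using rho_inf by (simp add: uniform_limit_iff tendsto_iff)
      from uniform_limit_add[OF this Q23]
      have "uniform_limit ?I (\<lambda>n t. rhobar (R n) (\<psi> n) t0 + Q23 (R n) (An n) (\<psi> n) t0 t) (\<lambda>_. rho_inf) sequentially"
        by simp
      then show ?thesis
        by (rule uniform_limit_cong[THEN iffD1, rotated 2])
           (simp_all flip: nls_tube.charge_balance[OF N t0])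
    qed
    show "\<forall>\<^sub>F n in sequentially. \<forall>t\<in>?I. c0 \<le> rhobar (R n) (\<psi> n) t"
      using eventually_ge_at_top[of n0] by eventually_elim (simp add: rb_low)
    show "\<forall>\<^sub>F n in sequentially. \<forall>t\<in>?I. norm (pb n t) \<le> C"
      using C by (simp add: pb_def nls_tube.pbar_def[OF N])
    show "\<forall>\<^sub>F n in sequentially. continuous_on ?I (pb n) \<and> continuous_on ?I (rhobar (R n) (\<psi> n))"
      using nls_tube.continuous_pbar[OF N] nls_tube.continuous_rhobar[OF N] by (simp add: pb_def)
    show "\<forall>\<^sub>F n in sequentially. \<forall>t\<in>?I. pb n t - pb n t0 =
        Q01 (R n) (An n) (\<psi> n) t0 t - Q0 (R n) (a n) (pn n) (An n) (\<psi> n) t0 t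
        + (LBINT s=ereal t0..ereal t. (Q30 \<phi>\<^sub>i A\<^sub>i (R n) (pn n) (An n) (\<psi> n) s + Q31 A\<^sub>i (R n) (An n) (\<psi> n) s))
        + (LBINT s=ereal t0..ereal t. rhobar (R n) (\<psi> n) s *\<^sub>R E s + (q / m / c) *\<^sub>R cross3 (pb n s) (B s))"
    proof (intro always_eventually allI ballI)
      fix n t assume t: "t \<in> ?I"
      interpret M: nls_tube m q chi c G1' Tm Tp rhat "R n" "a n" "pn n" "An n" "\<psi> n" by (rule N)
      let ?f = "\<lambda>s. rhobar (R n) (\<psi> n) s *\<^sub>R E s + (q / m / c) *\<^sub>R cross3 (pb n s) (B s)"
      let ?g = "\<lambda>s. Q30 \<phi>\<^sub>i A\<^sub>i (R n) (pn n) (An n) (\<psi> n) s + Q31 A\<^sub>i (R n) (An n) (\<psi> n) s"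
      have dec: "M.ball_integral M.lorentz s = ?f s + ?g s" if "s \<in> ?I" for s
        using M.lorentz_decomposition[OF that, of \<phi>\<^sub>i A\<^sub>i] by (simp add: E_eq[OF that] B_eq[OF that] pb_def)
      have cB: "continuous_on ?I B"
        unfolding continuous_on_eq_continuous_within using B' has_vector_derivative_continuous by blast
      have cf: "continuous_on ?I ?f"
        unfolding pb_def by (intro continuous_intros M.continuous_rhobar M.continuous_pbar cE cB continuous_on_cross)
      have cg: "continuous_on ?I ?g"
        by (rule continuous_on_eq[OF continuous_on_diff[OF M.continuous_ball_integral[OF M.continuous_lorentz] cf]])
           (simp add: dec)
      have "(LBINT s=ereal t0..ereal t. M.ball_integral M.lorentz s) = (LBINT s=ereal t0..ereal t. ?f s + ?g s)"
      proof (rule interval_integral_cong)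
        fix s assume "s \<in> einterval (min (ereal t0) (ereal t)) (max (ereal t0) (ereal t))"
        then have "s \<in> ?I"
          using t t0 by (auto simp: einterval_iff min_def max_def split: if_splits)
        then show "M.ball_integral M.lorentz s = ?f s + ?g s" by (rule dec)
      qed
      also have "\<dots> = (LBINT s=ereal t0..ereal t. ?f s) + (LBINT s=ereal t0..ereal t. ?g s)"
        by (rule T.time_integral_add[OF cf cg t0 t])
      finally show "pb n t - pb n t0 =
        Q01 (R n) (An n) (\<psi> n) t0 t - Q0 (R n) (a n) (pn n) (An n) (\<psi> n) t0 t
        + (LBINT s=ereal t0..ereal t. ?g s) + (LBINT s=ereal t0..ereal t. ?f s)"
        using M.momentum_balance_integrated[OF t0 t] unfolding pb_def by simp
    qed
    show "uniform_limit ?I (\<lambda>n t. Q01 (R n) (An n) (\<psi> n) t0 t - Q0 (R n) (a n) (pn n) (An n) (\<psi> n) t0 t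
        + (LBINT s=ereal t0..ereal t. (Q30 \<phi>\<^sub>i A\<^sub>i (R n) (pn n) (An n) (\<psi> n) s + Q31 A\<^sub>i (R n) (An n) (\<psi> n) s))) (\<lambda>_. 0) sequentially"
      using uniform_limit_add[OF uniform_limit_minus[OF Q01 Q0] Q3] by simp
  qed
  show ?thesis
  proof
    fix t assume t: "t \<in> ?I"
    have "acceleration Tm Tp rhat t = (q / m) *\<^sub>R (E t + (1 / c) *\<^sub>R cross3 (velocity Tm Tp rhat t) (B t))"
      unfolding acceleration_def
      by (rule vector_derivative_within[OF T.trivial_limit_time[OF t] newton[OF t]])
    then show "m *\<^sub>R acceleration Tm Tp rhat t =
      q *\<^sub>R electric_field c D \<phi> A (t, rhat t)
      + (q / c) *\<^sub>R cross3 (velocity Tm Tp rhat t) (curl D A (t, rhat t))"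
      using assms(1) by (simp add: E_def B_def scaleR_add_right)
  qed
qed

end
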